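(* Let $n\ge1$ and let $\mu$ be a partition such that $\mu_1\le n$ and $\widetilde\mu_1\le n$. Let $\mathcal W_n:\boldsymbol\zeta(n)\to\boldsymbol\zeta(n)$ be the algebra automorphism with $\mathcal W_n(\mathbf{H}_k(n))=\mathbf{I}_k(n)$ for $k=1,\dots,n$. Then, for every $\boldsymbol\varrho\in\boldsymbol\zeta(n)$, the eigenvalue of $\boldsymbol\varrho$ on the irreducible $gl(n)$-module $Schur_\mu(n)$ (with highest weight $\widetilde\mu$) equals the eigenvalue of $\mathcal W_n(\boldsymbol\varrho)$ on the irreducible $gl(n)$-module $Schur_{\widetilde\mu}(n)$ (with highest weight $\mu$).
   Context: $\boldsymbol\zeta(n)$ is the center of $\mathbf{U}(gl(n))$, $gl(n)=gl(n,\mathbb C)$ with standard basis $e_{i,j}$. For a square matrix with noncommuting entries, $\mathbf{cdet}(A)=\sum_\sigma(-1)^{|\sigma|}a_{\sigma(1),1}a_{\sigma(2),2}\cdots a_{\sigma(k),k}$ is the column determinant. For $1\le k\le n$, $$\mathbf{H}_k(n)=\sum_{1\le i_1<\cdots<i_k\le n}\mathbf{cdet}\big[e_{i_a,i_b}+\delta_{ab}(k-a)\big]_{a,b=1,\dots,k}.$$ By a theorem of Capelli, $\mathbf{H}_1(n),\dots,\mathbf{H}_n(n)$ are algebraically independent generators of $\boldsymbol\zeta(n)$. Virtual method. $gl(m_0|m_1+n)$ ($m_0,m_1$ sufficiently large) is the complex general linear Lie superalgebra with basis $e_{a,b}$, $a,b\in A_0\cup A_1\cup L$, $A_0=\{\alpha_1,\dots,\alpha_{m_0}\}$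 (parity $0$), $A_1=\{\beta_1,\dots,\beta_{m_1}\}$ (parity $1$), $L=\{1,\dots,n\}$ (parity $1$), $|e_{a,b}|=|a|+|b|$, and $[e_{a,b},e_{c,d}]=\delta_{bc}e_{a,d}-(-1)^{(|a|+|b|)(|c|+|d|)}\delta_{ad}e_{c,b}$. Symbols in $A_0\cup A_1$ are virtual. $gl(n)$ is the subalgebra spanned by $e_{i,j}$, $i,j\in L$. A product $e_{a_M,b_M}\cdots e_{a_1,b_1}$ is irregular if there are $i\le M$ and a virtual symbol $\gamma$ with $\#\{j\le i: b_j=\gamma\}>\#\{j<i: a_j=\gamma\}$. Let $\mathbf{Irr}$ be the left ideal of $\mathbf{U}(gl(m_0|m_1+n))$ generated by irregular products. The sum $Virt(m_0+m_1,n)=\mathbf{U}(gl(n))\oplus\mathbf{Irr}$ is direct and is a subalgebra in which $\mathbf{Irr}$ is a two-sided ideal; $\mathfrak p:Virt(m_0+m_1,n)\to\mathbf{U}(gl(n))$ is the projection with kernel $\mathbf{Irr}$. For $k\in\mathbb Z^+$ and any $\beta\in A_1$, $$\mathbf{I}_k(n)=\sum_{h_1+\cdots+h_n=k}\frac1{h_1!\cdots h_n!}\,\mathfrak p\big(e_{n,\beta}^{h_n}\cdots e_{1,\beta}^{h_1}e_{\beta,1}^{h_1}\cdots e_{\beta,n}^{h_n}\big)\in\boldsymbol\zeta(n)$$ (the monomials belong to $Virt(m_0+m_1,n)$). Also $\mathbf{I}_1(n),\dots,\mathbf{I}_n(n)$ are algebraically independent generators of $\boldsymbol\zeta(n)$,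 so $\mathcal W_n$ is an automorphism. For a partition $\mu$ with $\mu_1\le n$, $Schur_\mu(n)$ is the irreducible $gl(n)$-module of highest weight $\widetilde\mu$ (the conjugate partition, padded by zeros to length $n$). *)

theory Defs
  imports
    Complex_Main
    "HOL-Algebra.QuotRing"
    "HOL-Combinatorics.Permutations"
begin

section \<open>Free associative algebras over the complex numbers\<close>

text \<open>Elements are finitely supported functions on words over the alphabet \<open>G\<close>;
  the product is concatenation of words, extended bilinearly.\<close>

definition free_alg :: "'g set \<Rightarrow> ('g list \<Rightarrow> complex) ring" where
  "free_alg G =
    \<lparr>carrier = {p. finite {w. p w \<noteq> 0} \<and> {w. p w \<noteq> 0} \<subseteq> lists G},
     monoid.mult = (\<lambda>p q w. \<Sum>i\<le>length w. p (take i w) * q (drop i w)),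
     one = (\<lambda>w. if w = [] then 1 else 0),
     zero = (\<lambda>w. 0),
     add = (\<lambda>p q w. p w + q w)\<rparr>"

lemma ring_free_alg: "ring (free_alg G)"
proof (rule ringI)
  show "abelian_group (free_alg G)"
  proof (rule abelian_groupI)
    fix p q assume "p \<in> carrier (free_alg G)" "q \<in> carrier (free_alg G)"
    then have f: "finite ({w. p w \<noteq> 0} \<union> {w. q w \<noteq> 0})" "{w. p w \<noteq> 0} \<union> {w. q w \<noteq> 0} \<subseteq> lists G"
      by (auto simp: free_alg_def)
    have "{w. p w + q w \<noteq> 0} \<subseteq> {w. p w \<noteq> 0} \<union> {w. q w \<noteq> 0}"
      by auto
    with f show "p \<oplus>\<^bsub>free_alg G\<^esub> q \<in> carrier (free_alg G)"
      unfolding free_alg_def by (simp, meson finite_subset order_trans)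
  next
    fix p assume p: "p \<in> carrier (free_alg G)"
    show "\<exists>q\<in>carrier (free_alg G). q \<oplus>\<^bsub>free_alg G\<^esub> p = \<zero>\<^bsub>free_alg G\<^esub>"
      by (rule bexI[of _ "\<lambda>w. - p w"]) (use p in \<open>auto simp: free_alg_def\<close>)
  qed (auto simp: free_alg_def add.commute add.assoc)
  show "monoid (free_alg G)"
  proof (rule monoidI)
    fix p q assume pq: "p \<in> carrier (free_alg G)" "q \<in> carrier (free_alg G)"
    let ?S = "(\<lambda>(u, v). u @ v) ` ({w. p w \<noteq> 0} \<times> {w. q w \<noteq> 0})"
    have f: "finite ?S"
      using pq by (auto simp: free_alg_def)
    have g: "?S \<subseteq> lists G"
      using pq unfolding free_alg_def by (auto simp: subset_iff in_lists_conv_set)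
    have "w \<in> ?S" if "(\<Sum>i\<le>length w. p (take i w) * q (drop i w)) \<noteq> 0" for w
    proof -
      from that obtain i where "p (take i w) * q (drop i w) \<noteq> 0"
        by (meson sum.neutral)
      then show ?thesis
        by (intro image_eqI[of _ _ "(take i w, drop i w)"]) auto
    qed
    then have "{w. (\<Sum>i\<le>length w. p (take i w) * q (drop i w)) \<noteq> 0} \<subseteq> ?S"
      by blast
    with f g show "p \<otimes>\<^bsub>free_alg G\<^esub> q \<in> carrier (free_alg G)"
      unfolding free_alg_def by (simp, meson finite_subset order_trans)
  next
    fix p q r assume "p \<in> carrier (free_alg G)" "q \<in> carrier (free_alg G)" "r \<in> carrier (free_alg G)"
    have "(\<Sum>m\<le>length w. (\<Sum>i\<le>length (take m w). p (take i (take m w)) * q (drop i (take m w))) * r (drop m w))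
        = (\<Sum>i\<le>length w. p (take i w) * (\<Sum>j\<le>length (drop i w). q (take j (drop i w)) * r (drop j (drop i w))))"
      (is "?l = ?r") for w
    proof -
      have "?l = (\<Sum>m\<le>length w. \<Sum>i\<le>m. p (take i w) * q (take (m - i) (drop i w)) * r (drop m w))"
        by (intro sum.cong refl) (auto simp: sum_distrib_right min_def drop_take intro!: sum.cong)
      also have "\<dots> = (\<Sum>(m, i)\<in>Sigma {..length w} (\<lambda>m. {..m}).
          p (take i w) * q (take (m - i) (drop i w)) * r (drop m w))"
        by (simp add: sum.Sigma)
      also have "\<dots> = (\<Sum>(i, j)\<in>Sigma {..length w} (\<lambda>i. {..length w - i}).
          p (take i w) * q (take j (drop i w)) * r (drop (j + i) w))"
        by (rule sum.reindex_bij_witness[of _ "\<lambda>(i, j). (j + i, i)" "\<lambda>(m, i). (i, m - i)"]) auto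
      also have "\<dots> = ?r"
        by (simp add: sum.Sigma[symmetric] sum_distrib_left mult.assoc)
      finally show ?thesis .
    qed
    then show "p \<otimes>\<^bsub>free_alg G\<^esub> q \<otimes>\<^bsub>free_alg G\<^esub> r = p \<otimes>\<^bsub>free_alg G\<^esub> (q \<otimes>\<^bsub>free_alg G\<^esub> r)"
      by (simp add: free_alg_def)
  next
    fix p :: "'a list \<Rightarrow> complex"
    have "(\<Sum>i\<le>length w. (if take i w = [] then 1 else 0) * p (drop i w)) = p w"
      and "(\<Sum>i\<le>length w. p (take i w) * (if drop i w = [] then 1 else 0)) = p w" for w
    proof -
      have "(\<Sum>i\<le>length w. (if take i w = [] then 1 else 0) * p (drop i w))
          = (\<Sum>i\<le>length w. if i = 0 then p w else 0)"
        by (intro sum.cong) auto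
      then show "(\<Sum>i\<le>length w. (if take i w = [] then 1 else 0) * p (drop i w)) = p w"
        by simp
      have "(\<Sum>i\<le>length w. p (take i w) * (if drop i w = [] then 1 else 0))
          = (\<Sum>i\<le>length w. if i = length w then p w else 0)"
        by (intro sum.cong) auto
      then show "(\<Sum>i\<le>length w. p (take i w) * (if drop i w = [] then 1 else 0)) = p w"
        by simp
    qed
    then show "\<one>\<^bsub>free_alg G\<^esub> \<otimes>\<^bsub>free_alg G\<^esub> p = p" "p \<otimes>\<^bsub>free_alg G\<^esub> \<one>\<^bsub>free_alg G\<^esub> = p"
      by (simp_all add: free_alg_def)
  qed (auto simp: free_alg_def)
qed (auto simp: free_alg_def algebra_simps sum.distrib)

definition word :: "'g list \<Rightarrow> 'g list \<Rightarrow> complex" where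
  "word u = (\<lambda>w. if w = u then 1 else 0)"


section \<open>The Lie superalgebras \<open>gl(A)\<close> and their enveloping algebras\<close>

datatype symbol = Alpha nat | Beta nat | Proper nat

fun virtual :: "symbol \<Rightarrow> bool" where
  "virtual (Alpha _) = True"
| "virtual (Beta _) = True"
| "virtual (Proper _) = False"

fun parity :: "symbol \<Rightarrow> nat" where
  "parity (Alpha _) = 0"
| "parity (Beta _) = 1"
| "parity (Proper _) = 1"

definition proper_symbols :: "nat \<Rightarrow> symbol set" where
  "proper_symbols n = Proper ` {1..n}"

definition all_symbols :: "nat \<Rightarrow> nat \<Rightarrow> nat \<Rightarrow> symbol set" where
  "all_symbols m0 m1 n = Alpha ` {1..m0} \<union> Beta ` {1..m1} \<union> proper_symbols n"

text \<open>The pair \<open>(a, b)\<close> stands for the basis element \<open>e_{a,b}\<close>, of parity \<open>|a| + |b|\<close> modulo 2.\<close>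

type_synonym unit_symbol = "symbol \<times> symbol"

definition unit_sign :: "unit_symbol \<Rightarrow> unit_symbol \<Rightarrow> complex" where
  "unit_sign x y = (- 1) ^ ((parity (fst x) + parity (snd x)) * (parity (fst y) + parity (snd y)))"

text \<open>\<open>bracket x y z\<close> is the coefficient at the basis element \<open>z\<close> of the superbracket \<open>[x, y]\<close>.\<close>

definition bracket :: "unit_symbol \<Rightarrow> unit_symbol \<Rightarrow> unit_symbol \<Rightarrow> complex" where
  "bracket x y z =
     (if snd x = fst y \<and> z = (fst x, snd y) then 1 else 0)
     - unit_sign x y * (if fst x = snd y \<and> z = (fst y, snd x) then 1 else 0)"

text \<open>The defining relation \<open>x y - (-1)^{|x||y|} y x - [x, y]\<close>; the last term is supported on
  one-letter words.\<close>

definition env_rel :: "unit_symbol \<Rightarrow> unit_symbol \<Rightarrow> unit_symbol list \<Rightarrow> complex" where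
  "env_rel x y = (\<lambda>w. word [x, y] w - unit_sign x y * word [y, x] w
                       - (case w of [z] \<Rightarrow> bracket x y z | _ \<Rightarrow> 0))"

abbreviation tens :: "symbol set \<Rightarrow> (unit_symbol list \<Rightarrow> complex) ring" where
  "tens A \<equiv> free_alg (A \<times> A)"

definition env_ideal :: "symbol set \<Rightarrow> (unit_symbol list \<Rightarrow> complex) set" where
  "env_ideal A = Idl\<^bsub>tens A\<^esub> {env_rel x y | x y. x \<in> A \<times> A \<and> y \<in> A \<times> A}"

definition env_alg :: "symbol set \<Rightarrow> (unit_symbol list \<Rightarrow> complex) set ring" where
  "env_alg A = tens A Quot env_ideal A"

lemma word_closed: "set u \<subseteq> G \<Longrightarrow> word u \<in> carrier (free_alg G)"
  by (auto simp: free_alg_def word_def)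

lemma env_rel_closed:
  assumes "x \<in> A \<times> A" "y \<in> A \<times> A"
  shows "env_rel x y \<in> carrier (tens A)"
proof -
  let ?S = "{[x, y], [y, x], [(fst x, snd y)], [(fst y, snd x)]}"
  have "env_rel x y w = 0" if "w \<notin> ?S" for w
    using that unfolding env_rel_def word_def bracket_def by (clarsimp split: list.split)
  then have "{w. env_rel x y w \<noteq> 0} \<subseteq> ?S"
    by blast
  moreover have "finite ?S"
    by simp
  moreover have "?S \<subseteq> lists (A \<times> A)"
    using assms by (simp add: mem_Times_iff)
  ultimately have "finite {w. env_rel x y w \<noteq> 0}" "{w. env_rel x y w \<noteq> 0} \<subseteq> lists (A \<times> A)"
    by - (rule finite_subset, assumption+, rule order_trans, assumption+)
  then show ?thesis
    unfolding free_alg_def by simp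
qed

lemma ideal_env_ideal: "ideal (env_ideal A) (tens A)"
  unfolding env_ideal_def
  by (rule ring.genideal_ideal[OF ring_free_alg]) (use env_rel_closed in blast)

lemma ring_env_alg: "ring (env_alg A)"
  unfolding env_alg_def by (rule ideal.quotient_is_ring[OF ideal_env_ideal])

definition unit_elt :: "symbol set \<Rightarrow> symbol \<Rightarrow> symbol \<Rightarrow> (unit_symbol list \<Rightarrow> complex) set" where
  "unit_elt A a b = env_ideal A +>\<^bsub>tens A\<^esub> word [(a, b)]"

text \<open>The image of a complex number in \<open>U(gl(A))\<close>; the vector space structure of \<open>U(gl(A))\<close>
  is multiplication by these central elements.\<close>

definition scal :: "symbol set \<Rightarrow> complex \<Rightarrow> (unit_symbol list \<Rightarrow> complex) set" where
  "scal A c = env_ideal A +>\<^bsub>tens A\<^esub> (\<lambda>w. if w = [] then c else 0)"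

text \<open>\<open>gl(n)\<close> is \<open>gl(proper_symbols n)\<close>: all \<open>e_{i,j}\<close> between proper symbols are even, so
  the superbracket is the ordinary one.\<close>

abbreviation Ugl :: "nat \<Rightarrow> (unit_symbol list \<Rightarrow> complex) set ring" where
  "Ugl n \<equiv> env_alg (proper_symbols n)"

abbreviation egl :: "nat \<Rightarrow> nat \<Rightarrow> nat \<Rightarrow> (unit_symbol list \<Rightarrow> complex) set" where
  "egl n i j \<equiv> unit_elt (proper_symbols n) (Proper i) (Proper j)"

abbreviation scalgl :: "nat \<Rightarrow> complex \<Rightarrow> (unit_symbol list \<Rightarrow> complex) set" where
  "scalgl n c \<equiv> scal (proper_symbols n) c"

text \<open>The centre of \<open>U(gl(n))\<close>, as a ring.\<close>

definition \<zeta> :: "nat \<Rightarrow> (unit_symbol list \<Rightarrow> complex) set ring" where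
  "\<zeta> n = (Ugl n)\<lparr>carrier := {z \<in> carrier (Ugl n).
             \<forall>u\<in>carrier (Ugl n). z \<otimes>\<^bsub>Ugl n\<^esub> u = u \<otimes>\<^bsub>Ugl n\<^esub> z}\<rparr>"


section \<open>Capelli elements\<close>

text \<open>Ordered product of a list, leftmost factor first.\<close>

definition list_prod :: "('a, 'b) ring_scheme \<Rightarrow> 'a list \<Rightarrow> 'a" where
  "list_prod R xs = foldr (\<otimes>\<^bsub>R\<^esub>) xs \<one>\<^bsub>R\<^esub>"

definition cdet :: "('a, 'b) ring_scheme \<Rightarrow> nat \<Rightarrow> (nat \<Rightarrow> nat \<Rightarrow> 'a) \<Rightarrow> 'a" where
  "cdet R k X = (\<Oplus>\<^bsub>R\<^esub>\<sigma>\<in>{\<sigma>. \<sigma> permutes {1..k}}.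
                    [sign \<sigma>] \<cdot>\<^bsub>R\<^esub> list_prod R (map (\<lambda>j. X (\<sigma> j) j) [1..<k + 1]))"

text \<open>A strictly increasing list \<open>is\<close> encodes \<open>i_1 < \<dots> < i_k\<close>, with \<open>i_a = is ! (a - 1)\<close>.\<close>

definition Capelli_H :: "nat \<Rightarrow> nat \<Rightarrow> (unit_symbol list \<Rightarrow> complex) set" where
  "Capelli_H n k = (\<Oplus>\<^bsub>Ugl n\<^esub>is\<in>{is. length is = k \<and> sorted_wrt (<) is \<and> set is \<subseteq> {1..n}}.
      cdet (Ugl n) k (\<lambda>a b. egl n (is ! (a - 1)) (is ! (b - 1))
        \<oplus>\<^bsub>Ugl n\<^esub> (if a = b then scalgl n (of_nat (k - a)) else \<zero>\<^bsub>Ugl n\<^esub>)))"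


section \<open>The virtual projection\<close>

text \<open>A list \<open>ws\<close> of length \<open>M\<close> encodes the product \<open>e_{a_M,b_M} \<dots> e_{a_1,b_1}\<close>, so
  \<open>(a_j, b_j) = ws ! (M - j)\<close>.\<close>

definition irregular :: "unit_symbol list \<Rightarrow> bool" where
  "irregular ws \<longleftrightarrow>
    (\<exists>i\<in>{1..length ws}. \<exists>\<gamma>. virtual \<gamma> \<and>
       card {j \<in> {1..i}. snd (ws ! (length ws - j)) = \<gamma>}
         > card {j \<in> {1..<i}. fst (ws ! (length ws - j)) = \<gamma>})"

definition e_prod :: "symbol set \<Rightarrow> unit_symbol list \<Rightarrow> (unit_symbol list \<Rightarrow> complex) set" where
  "e_prod A ws = list_prod (env_alg A) (map (\<lambda>(a, b). unit_elt A a b) ws)"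

definition left_ideal :: "'a set \<Rightarrow> ('a, 'b) ring_scheme \<Rightarrow> bool" where
  "left_ideal J R \<longleftrightarrow> additive_subgroup J R \<and> (\<forall>r\<in>carrier R. \<forall>x\<in>J. r \<otimes>\<^bsub>R\<^esub> x \<in> J)"

definition Irr :: "nat \<Rightarrow> nat \<Rightarrow> nat \<Rightarrow> (unit_symbol list \<Rightarrow> complex) set set" where
  "Irr m0 m1 n = (let A = all_symbols m0 m1 n in
     \<Inter>{J. left_ideal J (env_alg A) \<and> {e_prod A ws | ws. ws \<in> lists (A \<times> A) \<and> irregular ws} \<subseteq> J})"

text \<open>The homomorphism \<open>U(gl(B)) \<rightarrow> U(gl(A))\<close> induced by \<open>gl(B) \<subseteq> gl(A)\<close>, for \<open>B \<subseteq> A\<close>: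
  a coset \<open>env_ideal B + p\<close> goes to \<open>env_ideal A + p\<close>.\<close>

definition embed :: "symbol set \<Rightarrow> (unit_symbol list \<Rightarrow> complex) set
    \<Rightarrow> (unit_symbol list \<Rightarrow> complex) set" where
  "embed A X = env_ideal A <+>\<^bsub>tens A\<^esub> X"

text \<open>The projection onto \<open>U(gl(n))\<close> along \<open>Irr\<close>. It is meaningful on
  \<open>U(gl(n)) \<oplus> Irr\<close>, where the element described is unique because the sum is direct.\<close>

definition virt_proj :: "nat \<Rightarrow> nat \<Rightarrow> nat \<Rightarrow> (unit_symbol list \<Rightarrow> complex) set
    \<Rightarrow> (unit_symbol list \<Rightarrow> complex) set" where
  "virt_proj m0 m1 n x = (THE u. u \<in> carrier (Ugl n) \<and>
      x \<ominus>\<^bsub>env_alg (all_symbols m0 m1 n)\<^esub> embed (all_symbols m0 m1 n) u \<in> Irr m0 m1 n)"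

text \<open>The word \<open>e_{n,\<beta>}^{h_n} \<dots> e_{1,\<beta>}^{h_1} e_{\<beta>,1}^{h_1} \<dots> e_{\<beta>,n}^{h_n}\<close>.\<close>

definition I_word :: "nat \<Rightarrow> symbol \<Rightarrow> (nat \<Rightarrow> nat) \<Rightarrow> unit_symbol list" where
  "I_word n \<beta> h =
     concat (map (\<lambda>i. replicate (h i) (Proper i, \<beta>)) (rev [1..<n + 1]))
     @ concat (map (\<lambda>i. replicate (h i) (\<beta>, Proper i)) [1..<n + 1])"

text \<open>The exponents \<open>(h_1, \<dots>, h_n)\<close> are functions vanishing outside \<open>{1..n}\<close>.\<close>

definition virtual_I :: "nat \<Rightarrow> nat \<Rightarrow> nat \<Rightarrow> symbol \<Rightarrow> nat \<Rightarrow> (unit_symbol list \<Rightarrow> complex) set" where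
  "virtual_I m0 m1 n \<beta> k =
     (\<Oplus>\<^bsub>Ugl n\<^esub>h\<in>{h :: nat \<Rightarrow> nat. (\<forall>i. i \<notin> {1..n} \<longrightarrow> h i = 0) \<and> (\<Sum>i=1..n. h i) = k}.
        scalgl n (1 / (\<Prod>i=1..n. fact (h i)))
        \<otimes>\<^bsub>Ugl n\<^esub> virt_proj m0 m1 n (e_prod (all_symbols m0 m1 n) (I_word n \<beta> h)))"


section \<open>Automorphisms of the centre\<close>

definition centre_automorphism :: "nat \<Rightarrow> ((unit_symbol list \<Rightarrow> complex) set
    \<Rightarrow> (unit_symbol list \<Rightarrow> complex) set) \<Rightarrow> bool" where
  "centre_automorphism n W \<longleftrightarrow> W \<in> ring_iso (\<zeta> n) (\<zeta> n) \<and>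
     (\<forall>c. \<forall>z\<in>carrier (\<zeta> n). W (scalgl n c \<otimes>\<^bsub>\<zeta> n\<^esub> z) = scalgl n c \<otimes>\<^bsub>\<zeta> n\<^esub> W z)"


section \<open>Modules\<close>

text \<open>\<open>\<rho>\<close> makes the complex vector space with scalar multiplication \<open>s\<close> a (left, unital)
  module over the algebra \<open>U(gl(n))\<close>, that is, a \<open>gl(n)\<close>-module.\<close>

definition gl_module :: "nat \<Rightarrow> (complex \<Rightarrow> 'v \<Rightarrow> 'v)
    \<Rightarrow> ((unit_symbol list \<Rightarrow> complex) set \<Rightarrow> 'v \<Rightarrow> 'v::ab_group_add) \<Rightarrow> bool" where
  "gl_module n s \<rho> \<longleftrightarrow> vector_space s \<and>
     (\<forall>u\<in>carrier (Ugl n). Vector_Spaces.linear s s (\<rho> u)) \<and>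
     (\<forall>v. \<rho> \<one>\<^bsub>Ugl n\<^esub> v = v) \<and>
     (\<forall>t\<in>carrier (Ugl n). \<forall>u\<in>carrier (Ugl n). \<forall>v.
        \<rho> (t \<oplus>\<^bsub>Ugl n\<^esub> u) v = \<rho> t v + \<rho> u v \<and> \<rho> (t \<otimes>\<^bsub>Ugl n\<^esub> u) v = \<rho> t (\<rho> u v)) \<and>
     (\<forall>c. \<forall>u\<in>carrier (Ugl n). \<forall>v. \<rho> (scalgl n c \<otimes>\<^bsub>Ugl n\<^esub> u) v = s c (\<rho> u v))"

definition irreducible_gl_module :: "nat \<Rightarrow> (complex \<Rightarrow> 'v \<Rightarrow> 'v)
    \<Rightarrow> ((unit_symbol list \<Rightarrow> complex) set \<Rightarrow> 'v \<Rightarrow> 'v::ab_group_add) \<Rightarrow> bool" where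
  "irreducible_gl_module n s \<rho> \<longleftrightarrow> gl_module n s \<rho> \<and> (\<exists>v::'v. v \<noteq> 0) \<and>
     (\<forall>S. module.subspace s S \<and> (\<forall>u\<in>carrier (Ugl n). \<forall>v\<in>S. \<rho> u v \<in> S)
        \<longrightarrow> S = {0} \<or> S = UNIV)"

definition has_highest_weight :: "nat \<Rightarrow> (nat \<Rightarrow> complex) \<Rightarrow> (complex \<Rightarrow> 'v \<Rightarrow> 'v)
    \<Rightarrow> ((unit_symbol list \<Rightarrow> complex) set \<Rightarrow> 'v \<Rightarrow> 'v::ab_group_add) \<Rightarrow> bool" where
  "has_highest_weight n wt s \<rho> \<longleftrightarrow> (\<exists>v. v \<noteq> 0 \<and>
     (\<forall>i\<in>{1..n}. \<rho> (egl n i i) v = s (wt i) v) \<and>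
     (\<forall>i\<in>{1..n}. \<forall>j\<in>{1..n}. i < j \<longrightarrow> \<rho> (egl n i j) v = 0))"

definition has_eigenvalue :: "(complex \<Rightarrow> 'v \<Rightarrow> 'v)
    \<Rightarrow> ((unit_symbol list \<Rightarrow> complex) set \<Rightarrow> 'v \<Rightarrow> 'v)
    \<Rightarrow> (unit_symbol list \<Rightarrow> complex) set \<Rightarrow> complex \<Rightarrow> bool" where
  "has_eigenvalue s \<rho> z c \<longleftrightarrow> (\<forall>v. \<rho> z v = s c v)"


section \<open>Partitions and Schur modules\<close>

text \<open>A partition is the list of its positive parts in weakly decreasing order.\<close>

definition is_partition :: "nat list \<Rightarrow> bool" where
  "is_partition \<mu> \<longleftrightarrow> sorted_wrt (\<ge>) \<mu> \<and> 0 \<notin> set \<mu>"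

definition part :: "nat list \<Rightarrow> nat \<Rightarrow> nat" where
  "part \<mu> i = (if 1 \<le> i \<and> i \<le> length \<mu> then \<mu> ! (i - 1) else 0)"

definition conj_partition :: "nat list \<Rightarrow> nat list" where
  "conj_partition \<mu> = map (\<lambda>j. card {i. 1 \<le> i \<and> i \<le> length \<mu> \<and> j \<le> part \<mu> i}) [1..<part \<mu> 1 + 1]"

lemma conj_partition_conj_partition:
  assumes "is_partition \<mu>"
  shows "conj_partition (conj_partition \<mu>) = \<mu>"
proof (cases "\<mu> = []")
  case True
  then show ?thesis by (simp add: conj_partition_def part_def)
next
  case False
  have mono: "\<mu> ! j \<le> \<mu> ! i" if "i \<le> j" "j < length \<mu>" for i j
    using assms that by (cases "i = j") (auto simp: is_partition_def sorted_wrt_iff_nth_less)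
  have pos: "\<mu> ! i \<ge> 1" if "i < length \<mu>" for i
    using assms that by (metis is_partition_def less_one linorder_not_less nth_mem)
  let ?c = "\<lambda>j. card {i. 1 \<le> i \<and> i \<le> length \<mu> \<and> j \<le> part \<mu> i}"
  have key: "i \<le> ?c j \<longleftrightarrow> j \<le> part \<mu> i" if i: "1 \<le> i" "i \<le> length \<mu>" for i j
  proof
    assume j: "j \<le> part \<mu> i"
    have "{1..i} \<subseteq> {i. 1 \<le> i \<and> i \<le> length \<mu> \<and> j \<le> part \<mu> i}"
    proof
      fix l assume "l \<in> {1..i}"
      with i have l: "1 \<le> l" "l \<le> i" "l \<le> length \<mu>"
        by auto
      then have "part \<mu> i \<le> part \<mu> l"
        using i mono[of "l - 1" "i - 1"] by (simp add: part_def)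
      with l j show "l \<in> {i. 1 \<le> i \<and> i \<le> length \<mu> \<and> j \<le> part \<mu> i}"
        by simp
    qed
    from card_mono[OF _ this] show "i \<le> ?c j"
      by simp
  next
    assume le: "i \<le> ?c j"
    show "j \<le> part \<mu> i"
    proof (rule ccontr)
      assume nj: "\<not> j \<le> part \<mu> i"
      have "{i. 1 \<le> i \<and> i \<le> length \<mu> \<and> j \<le> part \<mu> i} \<subseteq> {1..<i}"
      proof
        fix l assume l: "l \<in> {i. 1 \<le> i \<and> i \<le> length \<mu> \<and> j \<le> part \<mu> i}"
        have "l < i"
        proof (rule ccontr)
          assume "\<not> l < i"
          then have "part \<mu> l \<le> part \<mu> i"
            using l i mono[of "i - 1" "l - 1"] by (auto simp: part_def)
          with l nj show False by simp
        qed
        with l show "l \<in> {1..<i}" by simp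
      qed
      from card_mono[OF _ this] le i show False
        by simp
    qed
  qed
  have len: "length (conj_partition \<mu>) = part \<mu> 1"
    by (simp add: conj_partition_def)
  have part_conj: "part (conj_partition \<mu>) j = ?c j" if "1 \<le> j" "j \<le> part \<mu> 1" for j
    using that by (simp add: part_def[of "conj_partition \<mu>"] len, simp add: conj_partition_def del: upt_Suc)
  have p1: "part \<mu> 1 \<ge> 1"
    using False pos[of 0] by (simp add: part_def Suc_le_eq)
  have "{i. 1 \<le> i \<and> i \<le> length \<mu> \<and> 1 \<le> part \<mu> i} = {1..length \<mu>}"
    using pos by (auto simp: part_def)
  then have c1: "part (conj_partition \<mu>) 1 = length \<mu>"
    using part_conj[of 1] p1 by simp
  show ?thesis
  proof (rule nth_equalityI)
    show "length (conj_partition (conj_partition \<mu>)) = length \<mu>"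
      using c1 by (simp add: conj_partition_def[of "conj_partition \<mu>"] del: upt_Suc)
    fix i assume "i < length (conj_partition (conj_partition \<mu>))"
    then have i: "i < length \<mu>"
      using c1 by (simp add: conj_partition_def[of "conj_partition \<mu>"] del: upt_Suc)
    have "conj_partition (conj_partition \<mu>) ! i
        = card {j. 1 \<le> j \<and> j \<le> part \<mu> 1 \<and> Suc i \<le> part (conj_partition \<mu>) j}"
      using i c1 len by (simp add: conj_partition_def[of "conj_partition \<mu>"] nth_upt del: upt_Suc)
    also have "{j. 1 \<le> j \<and> j \<le> part \<mu> 1 \<and> Suc i \<le> part (conj_partition \<mu>) j}
        = {j. 1 \<le> j \<and> j \<le> part \<mu> 1 \<and> Suc i \<le> ?c j}"
      using part_conj by auto
    also have "\<dots> = {j. 1 \<le> j \<and> j \<le> part \<mu> 1 \<and> j \<le> part \<mu> (Suc i)}"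
      using key[of "Suc i"] i by simp
    also have "\<dots> = {1..\<mu> ! i}"
      using i mono[of 0 i] by (auto simp: part_def)
    finally show "conj_partition (conj_partition \<mu>) ! i = \<mu> ! i"
      by simp
  qed
qed

text \<open>The irreducible module of highest weight \<open>conj_partition \<mu>\<close>, padded by zeros
  (meaningful for \<open>part \<mu> 1 \<le> n\<close>).\<close>

definition is_Schur :: "nat \<Rightarrow> nat list \<Rightarrow> (complex \<Rightarrow> 'v \<Rightarrow> 'v)
    \<Rightarrow> ((unit_symbol list \<Rightarrow> complex) set \<Rightarrow> 'v \<Rightarrow> 'v::ab_group_add) \<Rightarrow> bool" where
  "is_Schur n \<mu> s \<rho> \<longleftrightarrow> irreducible_gl_module n s \<rho> \<and>
     has_highest_weight n (\<lambda>i. of_nat (part (conj_partition \<mu>) i)) s \<rho>"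

end

theory Submission
  imports Defs "HOL-Computational_Algebra.Polynomial" "HOL-Library.Multiset"
begin

text \<open>A central element acts by a scalar on an irreducible highest weight module, so two characters of
  the centre are compared, and it suffices to compare them on generators. On a highest weight vector
  \<open>H_k\<close> acts by the shifted elementary symmetric polynomial of the highest weight. Pushing each
  \<open>e_{i,\<beta>}\<close> to the right through the \<open>e_{\<beta>,j}\<close>, modulo \<open>Irr\<close>, turns the virtual monomials into row
  permanents with shifted diagonal, so \<open>I_k\<close> acts by the shifted complete symmetric polynomial.
  Removing the first row of \<open>\<mu>\<close> shows that the two polynomials agree at conjugate partitions.

  It remains to see that the \<open>H_k\<close> are central and generate the centre. The algebra acts by
  superderivations on words in letters \<open>y_{a,j}\<close>; pairing with words is faithful on \<open>U(gl(n))\<close> and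
  vanishes on \<open>Irr\<close> at words without virtual letters, which makes the virtual projection well defined.
  The pairing of a central element of degree \<open>d\<close> with words of length \<open>d\<close> is a symmetric invariant
  multilinear form on matrices. Such a form vanishes as soon as it vanishes on the slice of companion
  matrices \<open>C\<close>, because every matrix is a sum of some \<open>[A, C]\<close> and a tangent vector of the slice. On the
  slice the symbols of \<open>H_1, \<dots>, H_n\<close> are the coordinates up to sign, so subtracting a polynomial in
  the \<open>H_k\<close> lowers the degree.\<close>

section \<open>Free algebras and enveloping algebras\<close>

text \<open>The obstacle is recognising zero: uniqueness of a projection along a direct sum and
  identities in an enveloping algebra both ask when an element of a quotient by relations vanishes.
  One representation serves both. On polynomial functions of a matrix the units e_{i,j} act as
  vector fields; t is tested by applying it to a polynomial and evaluating at the unit matrix, and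
  the top-degree part of this test is a Poincare-Birkhoff-Witt statement. Adding virtual rows to the
  matrix lets the whole superalgebra act, and an irregular product asks for a virtual row that is
  not present. Words in noncommuting letters stand in for supercommutative polynomials, so that no
  sign rule for reordering letters has to be carried along; symmetry in the letters reappears later
  as a property of the functionals. Behind the slice is the fact that the characteristic polynomial
  of a companion matrix displays its last column. Centrality of I_k is read off from
  \<open>W\<close> having values in the centre.\<close>

typedef 'g fa = "carrier (free_alg (UNIV :: 'g set))"
  morphisms coeffs Fa
  using ring.ring_simprules(2)[OF ring_free_alg] by blast

setup_lifting type_definition_fa

instantiation fa :: (type) ring_1
begin

lift_definition zero_fa :: "'a fa" is "\<zero>\<^bsub>free_alg UNIV\<^esub>"
  by (rule ring.ring_simprules(2)[OF ring_free_alg])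

lift_definition one_fa :: "'a fa" is "\<one>\<^bsub>free_alg UNIV\<^esub>"
  by (rule ring.ring_simprules(6)[OF ring_free_alg])

lift_definition plus_fa :: "'a fa \<Rightarrow> 'a fa \<Rightarrow> 'a fa" is "\<lambda>p q. p \<oplus>\<^bsub>free_alg UNIV\<^esub> q"
  by (rule ring.ring_simprules(1)[OF ring_free_alg])

lift_definition uminus_fa :: "'a fa \<Rightarrow> 'a fa" is "\<lambda>p. \<ominus>\<^bsub>free_alg UNIV\<^esub> p"
  by (rule ring.ring_simprules(3)[OF ring_free_alg])

lift_definition minus_fa :: "'a fa \<Rightarrow> 'a fa \<Rightarrow> 'a fa" is "\<lambda>p q. p \<ominus>\<^bsub>free_alg UNIV\<^esub> q"
  by (rule ring.ring_simprules(4)[OF ring_free_alg])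

lift_definition times_fa :: "'a fa \<Rightarrow> 'a fa \<Rightarrow> 'a fa" is "\<lambda>p q. p \<otimes>\<^bsub>free_alg UNIV\<^esub> q"
  by (rule ring.ring_simprules(5)[OF ring_free_alg])

instance
proof
  fix a b c :: "'a fa"
  show "a * b * c = a * (b * c)"
    by transfer (rule ring.ring_simprules(11)[OF ring_free_alg])
  show "1 * a = a" by transfer (rule ring.ring_simprules(12)[OF ring_free_alg])
  show "a * 1 = a" by transfer (rule monoid.r_one[OF ring.is_monoid[OF ring_free_alg]])
  show "a + b + c = a + (b + c)" by transfer (rule ring.ring_simprules(7)[OF ring_free_alg])
  show "a + b = b + a" by transfer (rule ring.ring_simprules(10)[OF ring_free_alg])
  show "0 + a = a" by transfer (rule ring.ring_simprules(8)[OF ring_free_alg])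
  show "- a + a = 0" by transfer (rule ring.ring_simprules(9)[OF ring_free_alg])
  show "a - b = a + - b" by transfer (simp add: a_minus_def)
  show "(a + b) * c = a * c + b * c" by transfer (rule ring.ring_simprules(13)[OF ring_free_alg])
  show "a * (b + c) = a * b + a * c" by transfer (rule ring.ring_simprules(23)[OF ring_free_alg])
  show "(0::'a fa) \<noteq> 1" by transfer (simp add: free_alg_def fun_eq_iff)
qed

end

text \<open>The interface shared by the free algebra, the operators on functionals and the
  polynomials, so that evaluations and Capelli elements are written once for all of them.\<close>

class complex_algebra = ring_1 +
  fixes scaleC :: "complex \<Rightarrow> 'a \<Rightarrow> 'a"  (infixr "*\<^sub>C" 75)
  assumes scaleC_add_right: "c *\<^sub>C (a + b) = c *\<^sub>C a + c *\<^sub>C b"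
    and scaleC_add_left: "(c + d) *\<^sub>C a = c *\<^sub>C a + d *\<^sub>C a"
    and scaleC_scaleC [simp]: "c *\<^sub>C d *\<^sub>C a = (c * d) *\<^sub>C a"
    and scaleC_one [simp]: "1 *\<^sub>C a = a"
    and mult_scaleC_left [simp]: "c *\<^sub>C a * b = c *\<^sub>C (a * b)"
    and mult_scaleC_right [simp]: "a * c *\<^sub>C b = c *\<^sub>C (a * b)"
begin

lemma scaleC_zero_right [simp]: "c *\<^sub>C 0 = 0"
  using scaleC_add_right[of c 0 0] by simp

lemma scaleC_zero_left [simp]: "0 *\<^sub>C a = 0"
  using scaleC_add_left[of 0 0 a] by simp

lemma scaleC_minus_left: "(- c) *\<^sub>C a = - (c *\<^sub>C a)"
  using scaleC_add_left[of c "- c" a] by (intro minus_unique[symmetric]) simp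

lemma scaleC_minus_right: "c *\<^sub>C (- a) = - (c *\<^sub>C a)"
  using scaleC_add_right[of c a "- a"] by (intro minus_unique[symmetric]) simp

lemma scaleC_diff_right: "c *\<^sub>C (a - b) = c *\<^sub>C a - c *\<^sub>C b"
  using scaleC_add_right[of c a "- b"] by (simp add: scaleC_minus_right)

lemma scaleC_sum_right: "c *\<^sub>C sum f A = (\<Sum>i\<in>A. c *\<^sub>C f i)"
  by (induction A rule: infinite_finite_induct) (auto simp: scaleC_add_right)

lemma scaleC_of_nat: "of_nat n *\<^sub>C a = of_nat n * a"
  by (induction n) (auto simp: scaleC_add_left algebra_simps)

end

instantiation fa :: (type) complex_algebra
begin

lift_definition scaleC_fa :: "complex \<Rightarrow> 'a fa \<Rightarrow> 'a fa" is "\<lambda>c p w. c * p w"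
  by (auto simp: free_alg_def elim!: rev_finite_subset)

instance
proof
  fix c d :: complex and a b :: "'a fa"
  show "c *\<^sub>C (a + b) = c *\<^sub>C a + c *\<^sub>C b"
    by (transfer; simp add: free_alg_def fun_eq_iff distrib_left)
  show "(c + d) *\<^sub>C a = c *\<^sub>C a + d *\<^sub>C a"
    by (transfer; simp add: free_alg_def fun_eq_iff distrib_right)
  show "c *\<^sub>C d *\<^sub>C a = (c * d) *\<^sub>C a"
    by (transfer; simp add: fun_eq_iff mult.assoc)
  show "1 *\<^sub>C a = a"
    by (transfer; simp)
  show "c *\<^sub>C a * b = c *\<^sub>C (a * b)"
    by (transfer; simp add: free_alg_def fun_eq_iff mult.assoc sum_distrib_left)
  show "a * c *\<^sub>C b = c *\<^sub>C (a * b)"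
    by (transfer; simp add: free_alg_def fun_eq_iff mult.left_commute sum_distrib_left)
qed

end

lift_definition wd :: "'g list \<Rightarrow> 'g fa" is word
  by (rule word_closed) simp

lemma coeffs_simps [simp]:
  "coeffs 0 w = 0" "coeffs (a + b) w = coeffs a w + coeffs b w"
  "coeffs (c *\<^sub>C a) w = c * coeffs a w"
  by (transfer; simp add: free_alg_def)+

lemma coeffs_one: "coeffs 1 w = (if w = [] then 1 else 0)"
  by (transfer; simp add: free_alg_def)

lemma coeffs_wd: "coeffs (wd u) w = (if w = u then 1 else 0)"
  by (transfer; simp add: word_def)

lemma coeffs_uminus [simp]: "coeffs (- a) w = - coeffs a w"
proof -
  have "coeffs (- a) w + coeffs a w = 0"
    unfolding coeffs_simps(2)[symmetric] by simp
  then show ?thesis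
    by (rule eq_neg_iff_add_eq_0[THEN iffD2])
qed

lemma coeffs_minus [simp]: "coeffs (a - b) w = coeffs a w - coeffs b w"
  using coeffs_simps(2)[of a "- b" w] by simp

lemma coeffs_sum [simp]: "coeffs (sum f A) w = (\<Sum>i\<in>A. coeffs (f i) w)"
  by (induction A rule: infinite_finite_induct) auto

lemma fa_eqI: "(\<And>w. coeffs a w = coeffs b w) \<Longrightarrow> a = b"
  by (simp add: coeffs_inject[symmetric] fun_eq_iff)

lemma finite_supp: "finite {w. coeffs t w \<noteq> 0}"
  using coeffs[of t] by (simp add: free_alg_def)

lemma coeffs_times: "coeffs (a * b) w = (\<Sum>i\<le>length w. coeffs a (take i w) * coeffs b (drop i w))"
  by (transfer; simp add: free_alg_def)

lemma wd_Nil: "wd [] = 1"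
  by (rule fa_eqI) (simp add: coeffs_wd coeffs_one)

lemma wd_append: "wd (u @ v) = wd u * wd v"
proof (rule fa_eqI)
  fix w
  have "coeffs (wd u * wd v) w
      = (\<Sum>i\<le>length w. if i = length u then (if w = u @ v then 1 else 0) else 0)"
    unfolding coeffs_times coeffs_wd
  proof (intro sum.cong refl)
    fix i assume i: "i \<in> {..length w}"
    have "take i w = u \<and> drop i w = v \<longleftrightarrow> i = length u \<and> w = u @ v"
    proof
      assume h: "take i w = u \<and> drop i w = v"
      then have "length u = i"
        using i by auto
      moreover have "w = u @ v"
        using h append_take_drop_id[of i w] by simp
      ultimately show "i = length u \<and> w = u @ v" by simp
    qed simp
    then have "(if take i w = u \<and> drop i w = v then 1 else 0)
        = (if i = length u then (if w = u @ v then 1 else 0) else (0::complex))"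
      by presburger
    moreover have "(if take i w = u then 1 else 0) * (if drop i w = v then 1 else 0)
        = (if take i w = u \<and> drop i w = v then 1 else (0::complex))"
      by (cases "take i w = u"; cases "drop i w = v"; simp only: if_True if_False simp_thms mult_1_left mult_zero_left mult_zero_right)
    ultimately show "(if take i w = u then 1 else 0) * (if drop i w = v then 1 else 0)
        = (if i = length u then (if w = u @ v then 1 else 0) else (0::complex))"
      by (rule trans[rotated])
  qed
  then show "coeffs (wd (u @ v)) w = coeffs (wd u * wd v) w"
    by (auto simp: coeffs_wd)
qed

lemma wd_Cons: "wd (x # u) = wd [x] * wd u"
  using wd_append[of "[x]" u] by simp

lemma wd_eq_prod_list: "wd u = prod_list (map (\<lambda>x. wd [x]) u)"
proof (induction u)
  case (Cons x u)
  then show ?case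
    by (simp add: wd_Cons[of x u])
qed (simp add: wd_Nil)

lemma fa_expand:
  assumes "finite S" "\<And>w. coeffs t w \<noteq> 0 \<Longrightarrow> w \<in> S"
  shows "t = (\<Sum>w\<in>S. coeffs t w *\<^sub>C wd w)"
proof (rule fa_eqI)
  fix w
  have "(\<Sum>v\<in>S. coeffs t v * (if w = v then 1 else 0)) = (\<Sum>v\<in>S. if w = v then coeffs t v else 0)"
    by (intro sum.cong) auto
  then show "coeffs t w = coeffs (\<Sum>w\<in>S. coeffs t w *\<^sub>C wd w) w"
    using assms by (auto simp: coeffs_wd)
qed

text \<open>One type carries the words in all letters and smaller alphabets are subsets of it, so
  U(gl(n)) and the superalgebra share representatives before relations are imposed.\<close>

definition fa_on :: "'g set \<Rightarrow> 'g fa set" where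
  "fa_on A = {t. \<forall>w. coeffs t w \<noteq> 0 \<longrightarrow> set w \<subseteq> A}"

lemma fa_on_iff_carrier: "t \<in> fa_on A \<longleftrightarrow> coeffs t \<in> carrier (free_alg A)"
  using finite_supp[of t] by (auto simp: fa_on_def free_alg_def)

lemma fa_on_mono: "A \<subseteq> B \<Longrightarrow> fa_on A \<subseteq> fa_on B"
  by (auto simp: fa_on_def)

lemma fa_on_0 [simp]: "0 \<in> fa_on A" and fa_on_1 [simp]: "1 \<in> fa_on A"
  by (auto simp: fa_on_def coeffs_one)

lemma fa_on_add [simp]: "a \<in> fa_on A \<Longrightarrow> b \<in> fa_on A \<Longrightarrow> a + b \<in> fa_on A"
  by (auto simp: fa_on_def) (metis add.right_neutral subsetD)

lemma fa_on_uminus [simp]: "a \<in> fa_on A \<Longrightarrow> - a \<in> fa_on A"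
  by (auto simp: fa_on_def)

lemma fa_on_diff [simp]: "a \<in> fa_on A \<Longrightarrow> b \<in> fa_on A \<Longrightarrow> a - b \<in> fa_on A"
  by (simp only: diff_conv_add_uminus fa_on_add fa_on_uminus)

lemma fa_on_scaleC [simp]: "a \<in> fa_on A \<Longrightarrow> c *\<^sub>C a \<in> fa_on A"
  by (auto simp: fa_on_def)

lemma fa_on_sum: "(\<And>i. i \<in> I \<Longrightarrow> f i \<in> fa_on A) \<Longrightarrow> sum f I \<in> fa_on A"
  by (induction I rule: infinite_finite_induct) auto

lemma fa_on_wd [simp]: "wd u \<in> fa_on A \<longleftrightarrow> set u \<subseteq> A"
  by (auto simp: fa_on_def coeffs_wd)

lemma fa_on_mult [simp]:
  assumes "a \<in> fa_on A" "b \<in> fa_on A"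
  shows "a * b \<in> fa_on A"
  unfolding fa_on_def
proof (clarify, goal_cases)
  case (1 w x)
  from 1(1) obtain i where "coeffs a (take i w) * coeffs b (drop i w) \<noteq> 0"
    unfolding coeffs_times by (meson sum.neutral)
  then have "set (take i w) \<subseteq> A" "set (drop i w) \<subseteq> A"
    using assms by (auto simp: fa_on_def)
  then have "set w \<subseteq> A"
    by (metis append_take_drop_id set_append Un_least)
  with 1(2) show ?case by blast
qed

lemma fa_on_prod_list: "(\<And>x. x \<in> set xs \<Longrightarrow> x \<in> fa_on A) \<Longrightarrow> prod_list xs \<in> fa_on A"
  by (induction xs) auto

lemma fa_on_of_nat [simp]: "of_nat k \<in> fa_on A"
  by (induction k) auto

lemma fa_on_of_int [simp]: "of_int k \<in> fa_on A"
  by (cases k) auto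

lemma fa_on_induct [consumes 1, case_names zero add scale word]:
  assumes "t \<in> fa_on A" "P 0" "\<And>a b. a \<in> fa_on A \<Longrightarrow> b \<in> fa_on A \<Longrightarrow> P a \<Longrightarrow> P b \<Longrightarrow> P (a + b)"
    "\<And>c a. a \<in> fa_on A \<Longrightarrow> P a \<Longrightarrow> P (c *\<^sub>C a)" "\<And>w. set w \<subseteq> A \<Longrightarrow> P (wd w)"
  shows "P t"
proof -
  have "P (\<Sum>w\<in>S. coeffs t w *\<^sub>C wd w) \<and> (\<Sum>w\<in>S. coeffs t w *\<^sub>C wd w) \<in> fa_on A"
    if "finite S" "S \<subseteq> {w. coeffs t w \<noteq> 0}" for S
    using that
  proof (induction S)
    case (insert w S)
    then have "set w \<subseteq> A" using assms(1) by (auto simp: fa_on_def)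
    with insert show ?case
      by (auto intro!: assms(3) assms(4) assms(5))
  qed (simp add: assms)
  from this[OF finite_supp order_refl]
  have "P (\<Sum>w | coeffs t w \<noteq> 0. coeffs t w *\<^sub>C wd w)" ..
  then show ?thesis
    by (subst fa_expand[OF finite_supp, of t t]) auto
qed

section \<open>The universal property of the free algebra\<close>

definition eval :: "('g \<Rightarrow> 'r::complex_algebra) \<Rightarrow> 'g fa \<Rightarrow> 'r" where
  "eval g t = (\<Sum>w | coeffs t w \<noteq> 0. coeffs t w *\<^sub>C prod_list (map g w))"

lemma eval_eq:
  assumes "finite S" "\<And>w. coeffs t w \<noteq> 0 \<Longrightarrow> w \<in> S"
  shows "eval g t = (\<Sum>w\<in>S. coeffs t w *\<^sub>C prod_list (map g w))"
  unfolding eval_def by (rule sum.mono_neutral_left) (use assms in auto)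

lemma eval_add [simp]: "eval g (a + b) = eval g a + eval g b"
proof -
  let ?S = "{w. coeffs a w \<noteq> 0} \<union> {w. coeffs b w \<noteq> 0}"
  have "finite ?S" by (simp add: finite_supp)
  then show ?thesis
    by (subst (1 2 3) eval_eq[of ?S]) (auto simp: scaleC_add_left sum.distrib)
qed

lemma eval_scaleC [simp]: "eval g (c *\<^sub>C a) = c *\<^sub>C eval g a"
  by (subst (1 2) eval_eq[OF finite_supp[of a]]) (auto simp: scaleC_sum_right)

lemma eval_zero [simp]: "eval g 0 = 0"
  by (simp add: eval_def)

lemma eval_uminus [simp]: "eval g (- a) = - eval g a"
  using eval_add[of g a "- a"] by (intro minus_unique[symmetric]) (simp del: eval_add)

lemma eval_diff [simp]: "eval g (a - b) = eval g a - eval g b"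
  by (simp only: diff_conv_add_uminus eval_add eval_uminus)

lemma eval_sum [simp]: "eval g (sum f I) = (\<Sum>i\<in>I. eval g (f i))"
  by (induction I rule: infinite_finite_induct) auto

lemma eval_wd [simp]: "eval g (wd u) = prod_list (map g u)"
  by (subst eval_eq[of "{u}"]) (auto simp: coeffs_wd split: if_splits)

lemma eval_one [simp]: "eval g 1 = 1"
  using eval_wd[of g "[]"] by (simp add: wd_Nil)

lemma eval_mult [simp]: "eval g (a * b) = eval g a * eval g b"
proof -
  have "a \<in> fa_on UNIV" "b \<in> fa_on UNIV" by (auto simp: fa_on_def)
  then show ?thesis
  proof (induction a rule: fa_on_induct)
    case (word u)
    from word(2) show ?case
    proof (induction b rule: fa_on_induct)
      case (word v)
      then show ?case by (simp add: wd_append[symmetric])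
    qed (simp_all add: distrib_left)
  qed (simp_all add: distrib_right)
qed

lemma eval_prod_list [simp]: "eval g (prod_list xs) = prod_list (map (eval g) xs)"
  by (induction xs) auto

lemma eval_of_nat [simp]: "eval g (of_nat k) = of_nat k"
  by (induction k) auto

lemma eval_of_int [simp]: "eval g (of_int k) = of_int k"
  by (cases k) auto

section \<open>Relations and cosets\<close>

lemma coeffs_add_ring: "coeffs (a + b) = coeffs a \<oplus>\<^bsub>free_alg A\<^esub> coeffs b"
  by (simp add: fun_eq_iff free_alg_def)

lemma coeffs_mult_ring: "coeffs (a * b) = coeffs a \<otimes>\<^bsub>free_alg A\<^esub> coeffs b"
  by (simp add: fun_eq_iff free_alg_def coeffs_times)

lemma coeffs_zero_ring: "coeffs 0 = \<zero>\<^bsub>free_alg A\<^esub>"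
  by (simp add: fun_eq_iff free_alg_def)

lemma coeffs_one_ring: "coeffs 1 = \<one>\<^bsub>free_alg A\<^esub>"
  by (simp add: fun_eq_iff free_alg_def coeffs_one)

lemma coeffs_uminus_ring:
  assumes "a \<in> fa_on A"
  shows "coeffs (- a) = \<ominus>\<^bsub>free_alg A\<^esub> coeffs a"
proof -
  have "coeffs (- a) \<oplus>\<^bsub>free_alg A\<^esub> coeffs a = \<zero>\<^bsub>free_alg A\<^esub>"
    unfolding coeffs_add_ring[symmetric] by (simp add: coeffs_zero_ring[symmetric])
  then show ?thesis
    using assms by (intro abelian_group.minus_equality[symmetric] ring.is_abelian_group ring_free_alg)
      (auto simp: fa_on_iff_carrier[symmetric])
qed

lemma carrier_eq_coeffs: "carrier (free_alg A) = coeffs ` fa_on A"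
proof (intro equalityI subsetI)
  fix p assume p: "p \<in> carrier (free_alg A)"
  then have "p \<in> carrier (free_alg UNIV)" by (auto simp: free_alg_def)
  then have "coeffs (Fa p) = p" by (rule Fa_inverse)
  with p show "p \<in> coeffs ` fa_on A"
    by (intro image_eqI[of _ _ "Fa p"]) (auto simp: fa_on_iff_carrier)
qed (auto simp: fa_on_iff_carrier)

text \<open>Equations in U(gl(A)) are treated as membership of a difference of representatives in
  this set.\<close>

definition env_ker :: "symbol set \<Rightarrow> unit_symbol fa set" where
  "env_ker A = {t. coeffs t \<in> env_ideal A}"

definition br :: "unit_symbol \<Rightarrow> unit_symbol \<Rightarrow> unit_symbol fa" where
  "br x y = (if snd x = fst y then wd [(fst x, snd y)] else 0)
     - unit_sign x y *\<^sub>C (if fst x = snd y then wd [(fst y, snd x)] else 0)"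

definition relator :: "unit_symbol \<Rightarrow> unit_symbol \<Rightarrow> unit_symbol fa" where
  "relator x y = wd [x, y] - unit_sign x y *\<^sub>C wd [y, x] - br x y"

lemma coeffs_relator: "coeffs (relator x y) = env_rel x y"
  by (rule ext) (auto simp: relator_def br_def env_rel_def coeffs_wd word_def bracket_def split: list.splits)

lemma env_ideal_eq: "env_ideal A = coeffs ` env_ker A"
proof -
  have "env_ideal A \<subseteq> carrier (tens A)"
    using ideal_env_ideal[of A] ideal.Icarr by fast
  then show ?thesis
    by (auto simp: env_ker_def carrier_eq_coeffs)
qed

lemma env_ker_subset: "env_ker A \<subseteq> fa_on (A \<times> A)"
  using ideal.Icarr[OF ideal_env_ideal, of _ A] by (auto simp: env_ker_def fa_on_iff_carrier)

lemma env_ker_zero [simp]: "0 \<in> env_ker A"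
  using additive_subgroup.zero_closed[OF ideal.axioms(1)[OF ideal_env_ideal[of A]]]
  by (simp add: env_ker_def coeffs_zero_ring[symmetric])

lemma env_ker_add [simp]: "a \<in> env_ker A \<Longrightarrow> b \<in> env_ker A \<Longrightarrow> a + b \<in> env_ker A"
  using additive_subgroup.a_closed[OF ideal.axioms(1)[OF ideal_env_ideal[of A]], of "coeffs a" "coeffs b"]
  by (simp add: env_ker_def coeffs_add_ring[symmetric])

lemma env_ker_lmult [simp]: "a \<in> env_ker A \<Longrightarrow> r \<in> fa_on (A \<times> A) \<Longrightarrow> r * a \<in> env_ker A"
  using ideal.I_l_closed[OF ideal_env_ideal[of A], of "coeffs a" "coeffs r"]
  by (simp add: env_ker_def coeffs_mult_ring[symmetric] fa_on_iff_carrier)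

lemma env_ker_rmult [simp]: "a \<in> env_ker A \<Longrightarrow> r \<in> fa_on (A \<times> A) \<Longrightarrow> a * r \<in> env_ker A"
  using ideal.I_r_closed[OF ideal_env_ideal[of A], of "coeffs a" "coeffs r"]
  by (simp add: env_ker_def coeffs_mult_ring[symmetric] fa_on_iff_carrier)

lemma env_ker_scaleC [simp]: "a \<in> env_ker A \<Longrightarrow> c *\<^sub>C a \<in> env_ker A"
  using env_ker_lmult[of a A "c *\<^sub>C 1"] by simp

lemma env_ker_uminus [simp]: "a \<in> env_ker A \<Longrightarrow> - a \<in> env_ker A"
  using env_ker_scaleC[of a A "- 1"] by (simp add: scaleC_minus_left)

lemma env_ker_diff [simp]: "a \<in> env_ker A \<Longrightarrow> b \<in> env_ker A \<Longrightarrow> a - b \<in> env_ker A"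
  by (simp only: diff_conv_add_uminus env_ker_add env_ker_uminus)

lemma env_ker_sum: "(\<And>i. i \<in> I \<Longrightarrow> f i \<in> env_ker A) \<Longrightarrow> sum f I \<in> env_ker A"
  by (induction I rule: infinite_finite_induct) auto

lemma env_ker_relator [simp]: "x \<in> A \<times> A \<Longrightarrow> y \<in> A \<times> A \<Longrightarrow> relator x y \<in> env_ker A"
proof -
  assume xy: "x \<in> A \<times> A" "y \<in> A \<times> A"
  have "{env_rel x y | x y. x \<in> A \<times> A \<and> y \<in> A \<times> A} \<subseteq> env_ideal A"
    unfolding env_ideal_def
    by (rule ring.genideal_self[OF ring_free_alg]) (use env_rel_closed in blast)
  with xy have "env_rel x y \<in> env_ideal A" by blast
  then show ?thesis
    by (simp add: env_ker_def coeffs_relator)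
qed

lemma env_ker_minimal:
  assumes "0 \<in> J" "\<And>a b. a \<in> J \<Longrightarrow> b \<in> J \<Longrightarrow> a + b \<in> J" "\<And>a. a \<in> J \<Longrightarrow> - a \<in> J"
    "\<And>a r. a \<in> J \<Longrightarrow> r \<in> fa_on (A \<times> A) \<Longrightarrow> r * a \<in> J" "\<And>a r. a \<in> J \<Longrightarrow> r \<in> fa_on (A \<times> A) \<Longrightarrow> a * r \<in> J"
    "\<And>x y. x \<in> A \<times> A \<Longrightarrow> y \<in> A \<times> A \<Longrightarrow> relator x y \<in> J"
  shows "env_ker A \<subseteq> J"
proof -
  let ?J = "coeffs ` (J \<inter> fa_on (A \<times> A))"
  have "ideal ?J (tens A)"
  proof (rule idealI[OF ring_free_alg])
    show "subgroup ?J (add_monoid (tens A))"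
    proof
      show "?J \<subseteq> carrier (add_monoid (tens A))"
        by (auto simp: carrier_eq_coeffs)
      show "x \<otimes>\<^bsub>add_monoid (tens A)\<^esub> y \<in> ?J" if "x \<in> ?J" "y \<in> ?J" for x y
        using that by (auto simp: coeffs_add_ring[symmetric] intro!: imageI assms)
      show "\<one>\<^bsub>add_monoid (tens A)\<^esub> \<in> ?J"
        by (auto simp: coeffs_zero_ring[symmetric] intro!: imageI assms)
      show "inv\<^bsub>add_monoid (tens A)\<^esub> x \<in> ?J" if "x \<in> ?J" for x
      proof -
        from that obtain a where a: "x = coeffs a" "a \<in> J" "a \<in> fa_on (A \<times> A)" by auto
        then have "inv\<^bsub>add_monoid (tens A)\<^esub> x = coeffs (- a)"
          by (simp only: a_inv_def[symmetric] coeffs_uminus_ring)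
        with a show ?thesis
          by (auto intro!: imageI assms)
      qed
    qed
    show "x \<otimes>\<^bsub>tens A\<^esub> a \<in> ?J" "a \<otimes>\<^bsub>tens A\<^esub> x \<in> ?J"
      if "a \<in> ?J" "x \<in> carrier (tens A)" for a x
    proof -
      from that obtain b y where "a = coeffs b" "b \<in> J" "b \<in> fa_on (A \<times> A)" "x = coeffs y" "y \<in> fa_on (A \<times> A)"
        by (auto simp: carrier_eq_coeffs)
      then show "x \<otimes>\<^bsub>tens A\<^esub> a \<in> ?J" "a \<otimes>\<^bsub>tens A\<^esub> x \<in> ?J"
        using assms(4)[of b y] assms(5)[of b y] by (auto simp: coeffs_mult_ring[symmetric])
    qed
  qed
  moreover have "{env_rel x y | x y. x \<in> A \<times> A \<and> y \<in> A \<times> A} \<subseteq> ?J"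
  proof clarify
    fix a b c d assume "a \<in> A" "b \<in> A" "c \<in> A" "d \<in> A"
    then have "relator (a, b) (c, d) \<in> J \<inter> fa_on (A \<times> A)"
      using assms(6)[of "(a, b)" "(c, d)"] by (auto simp: relator_def br_def)
    then show "env_rel (a, b) (c, d) \<in> ?J"
      by (auto simp: coeffs_relator[symmetric])
  qed
  ultimately have "env_ideal A \<subseteq> ?J"
    unfolding env_ideal_def by (rule ring.genideal_minimal[OF ring_free_alg])
  then show ?thesis
    by (auto simp: env_ker_def coeffs_inject)
qed

lemma eval_env_ker:
  assumes "t \<in> env_ker A" "\<And>x y. x \<in> A \<times> A \<Longrightarrow> y \<in> A \<times> A \<Longrightarrow> eval g (relator x y) = 0"
  shows "eval g t = 0"
proof -
  have "env_ker A \<subseteq> {t. eval g t = 0}"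
    by (rule env_ker_minimal) (auto simp: assms(2))
  with assms(1) show ?thesis by auto
qed

definition coset :: "symbol set \<Rightarrow> unit_symbol fa \<Rightarrow> (unit_symbol list \<Rightarrow> complex) set" where
  "coset A t = env_ideal A +>\<^bsub>tens A\<^esub> coeffs t"

lemma coset_eq: "coset A t = coeffs ` {t'. t' - t \<in> env_ker A}"
proof -
  have "coset A t = (\<lambda>k. coeffs (k + t)) ` env_ker A"
    unfolding coset_def a_r_coset_def' env_ideal_eq by (auto simp: coeffs_add_ring[symmetric])
  also have "\<dots> = coeffs ` {t'. t' - t \<in> env_ker A}"
  proof (intro equalityI subsetI)
    fix x assume "x \<in> coeffs ` {t'. t' - t \<in> env_ker A}"
    then obtain t' where "t' - t \<in> env_ker A" "x = coeffs ((t' - t) + t)" by auto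
    then show "x \<in> (\<lambda>k. coeffs (k + t)) ` env_ker A" by blast
  qed auto
  finally show ?thesis .
qed

lemma coset_eq_iff: "coset A t = coset A t' \<longleftrightarrow> t - t' \<in> env_ker A"
proof
  assume "coset A t = coset A t'"
  moreover have "coeffs t \<in> coset A t" by (auto simp: coset_eq)
  ultimately show "t - t' \<in> env_ker A" by (auto simp: coset_eq coeffs_inject)
next
  assume h: "t - t' \<in> env_ker A"
  have "u - t \<in> env_ker A \<longleftrightarrow> u - t' \<in> env_ker A" for u
    using env_ker_add[OF _ h, of "u - t"] env_ker_diff[OF _ h, of "u - t'"] by auto
  then show "coset A t = coset A t'" by (simp add: coset_eq)
qed

lemma carrier_env: "carrier (env_alg A) = coset A ` fa_on (A \<times> A)"
  unfolding env_alg_def FactRing_def A_RCOSETS_def' coset_def by (auto simp: carrier_eq_coeffs)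

lemma coset_carrier [simp]: "t \<in> fa_on (A \<times> A) \<Longrightarrow> coset A t \<in> carrier (env_alg A)"
  by (auto simp: carrier_env)

lemma coset_hom: "(\<lambda>p. env_ideal A +>\<^bsub>tens A\<^esub> p) \<in> ring_hom (tens A) (env_alg A)"
  unfolding env_alg_def by (rule ideal.rcos_ring_hom[OF ideal_env_ideal])

lemma coset_add:
  assumes "a \<in> fa_on (A \<times> A)" "b \<in> fa_on (A \<times> A)"
  shows "coset A (a + b) = coset A a \<oplus>\<^bsub>env_alg A\<^esub> coset A b"
  using ring_hom_memE(3)[OF coset_hom[of A], of "coeffs a" "coeffs b"] assms
  by (simp add: coset_def coeffs_add_ring[symmetric] fa_on_iff_carrier)

lemma coset_mult:
  assumes "a \<in> fa_on (A \<times> A)" "b \<in> fa_on (A \<times> A)"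
  shows "coset A (a * b) = coset A a \<otimes>\<^bsub>env_alg A\<^esub> coset A b"
  using ring_hom_memE(2)[OF coset_hom[of A], of "coeffs a" "coeffs b"] assms
  by (simp add: coset_def coeffs_mult_ring[symmetric] fa_on_iff_carrier)

lemma coset_one: "coset A 1 = \<one>\<^bsub>env_alg A\<^esub>"
  using ring_hom_memE(4)[OF coset_hom[of A]] by (simp add: coset_def coeffs_one_ring[of "A \<times> A"])

lemma coset_zero: "coset A 0 = \<zero>\<^bsub>env_alg A\<^esub>"
proof -
  have "coset A 0 = env_ideal A"
    by (simp add: coset_eq env_ideal_eq)
  then show ?thesis by (simp add: env_alg_def FactRing_def)
qed

lemma coset_uminus:
  assumes "a \<in> fa_on (A \<times> A)"
  shows "coset A (- a) = \<ominus>\<^bsub>env_alg A\<^esub> coset A a"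
proof -
  have "coset A (- a) \<oplus>\<^bsub>env_alg A\<^esub> coset A a = \<zero>\<^bsub>env_alg A\<^esub>"
    using assms by (simp add: coset_add[symmetric] coset_zero)
  then show ?thesis
    using assms by (intro abelian_group.minus_equality[symmetric] ring.is_abelian_group ring_env_alg) auto
qed

lemma coset_diff:
  assumes "a \<in> fa_on (A \<times> A)" "b \<in> fa_on (A \<times> A)"
  shows "coset A (a - b) = coset A a \<ominus>\<^bsub>env_alg A\<^esub> coset A b"
  using assms by (simp only: diff_conv_add_uminus coset_add fa_on_uminus coset_uminus a_minus_def)

lemma coset_sum:
  assumes "finite I" "\<And>i. i \<in> I \<Longrightarrow> f i \<in> fa_on (A \<times> A)"
  shows "coset A (sum f I) = (\<Oplus>\<^bsub>env_alg A\<^esub>i\<in>I. coset A (f i))"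
  using assms
proof (induction I)
  case empty
  then show ?case
    by (simp add: coset_zero abelian_monoid.finsum_empty[OF abelian_group.axioms(1)[OF ring.is_abelian_group[OF ring_env_alg]]])
next
  case (insert x F)
  interpret ring "env_alg A" by (rule ring_env_alg)
  from insert show ?case
    by (simp add: coset_add fa_on_sum finsum_insert)
qed

lemma coset_prod_list:
  assumes "\<And>x. x \<in> set xs \<Longrightarrow> x \<in> fa_on (A \<times> A)"
  shows "coset A (prod_list xs) = list_prod (env_alg A) (map (coset A) xs)"
  using assms by (induction xs) (auto simp: list_prod_def coset_one coset_mult fa_on_prod_list)

lemma unit_elt_coset: "unit_elt A a b = coset A (wd [(a, b)])"
  by (simp add: unit_elt_def coset_def wd.rep_eq)

lemma scal_coset: "scal A c = coset A (c *\<^sub>C 1)"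
proof -
  have "coeffs (c *\<^sub>C 1 :: unit_symbol fa) = (\<lambda>w. if w = [] then c else 0)"
    by (rule ext) (simp add: coeffs_one)
  then show ?thesis
    unfolding scal_def coset_def by (simp only:)
qed

lemma e_prod_coset:
  assumes "set ws \<subseteq> A \<times> A"
  shows "e_prod A ws = coset A (wd ws)"
proof -
  have "coset A (wd ws) = list_prod (env_alg A) (map (coset A) (map (\<lambda>x. wd [x]) ws))"
    by (subst wd_eq_prod_list, subst coset_prod_list) (use assms in auto)
  then show ?thesis
    by (simp add: e_prod_def unit_elt_coset comp_def case_prod_unfold)
qed

lemma env_ker_mono:
  assumes "B \<subseteq> A"
  shows "env_ker B \<subseteq> env_ker A"
proof -
  have "fa_on (B \<times> B) \<subseteq> fa_on (A \<times> A)" using assms by (intro fa_on_mono) auto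
  moreover have "B \<times> B \<subseteq> A \<times> A" using assms by auto
  ultimately show ?thesis
    by (intro env_ker_minimal) (auto intro: env_ker_lmult env_ker_rmult env_ker_relator)
qed

text \<open>The ideal of the smaller alphabet lies in that of the larger one, so adding the larger
  ideal absorbs the choice of representative.\<close>

lemma embed_coset:
  assumes "B \<subseteq> A"
  shows "embed A (coset B t) = coset A t"
proof -
  have "embed A (coset B t) = {coeffs (k + t') | k t'. k \<in> env_ker A \<and> t' - t \<in> env_ker B}"
    unfolding embed_def set_add_def' coset_eq env_ideal_eq
    by (auto simp: coeffs_add_ring[symmetric])
  also have "\<dots> = coeffs ` {t'. t' - t \<in> env_ker A}"
  proof (intro equalityI subsetI)
    fix x assume "x \<in> {coeffs (k + t') | k t'. k \<in> env_ker A \<and> t' - t \<in> env_ker B}"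
    then obtain k t' where "k \<in> env_ker A" "t' - t \<in> env_ker B" "x = coeffs (k + t')" by blast
    with env_ker_mono[OF assms] env_ker_add[of k A "t' - t"] show "x \<in> coeffs ` {t'. t' - t \<in> env_ker A}"
      by (auto simp: add_diff_eq)
  next
    fix x assume "x \<in> coeffs ` {t'. t' - t \<in> env_ker A}"
    then obtain t' where "t' - t \<in> env_ker A" "x = coeffs (t' - t + t)" by auto
    moreover have "t - t \<in> env_ker B" by simp
    ultimately show "x \<in> {coeffs (k + t') | k t'. k \<in> env_ker A \<and> t' - t \<in> env_ker B}" by blast
  qed
  finally show ?thesis by (simp add: coset_eq)
qed

lemma add_pow_sign:
  assumes "x \<in> carrier (env_alg A)"
  shows "[(1::int)] \<cdot>\<^bsub>env_alg A\<^esub> x = x" "[(-1::int)] \<cdot>\<^bsub>env_alg A\<^esub> x = \<ominus>\<^bsub>env_alg A\<^esub> x"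
proof -
  interpret ring "env_alg A" by (rule ring_env_alg)
  show "[(1::int)] \<cdot>\<^bsub>env_alg A\<^esub> x = x" "[(-1::int)] \<cdot>\<^bsub>env_alg A\<^esub> x = \<ominus>\<^bsub>env_alg A\<^esub> x"
    using assms add.int_pow_1[of x] add.int_pow_neg[of x 1] by simp_all
qed

section \<open>The representation by superderivations\<close>

text \<open>Acting on functionals removes any finiteness condition. Linearity belongs to the type
  because, with products composed in reverse order, distributivity in the left factor is linearity
  of the right factor.\<close>

typedef 'x op = "{F :: ('x \<Rightarrow> complex) \<Rightarrow> ('x \<Rightarrow> complex).
    \<forall>f g c d. F (\<lambda>x. c * f x + d * g x) = (\<lambda>x. c * F f x + d * F g x)}"
  morphisms app Op
  by (rule exI[of _ "\<lambda>f x. 0"]) simp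

setup_lifting type_definition_op

lemma app_lin: "app F (\<lambda>x. c * f x + d * g x) = (\<lambda>x. c * app F f x + d * app F g x)"
  using app[of F] by blast

text \<open>Multiplication is composition in the opposite order: an algebra acting from the left on words acts
  from the right on functionals.\<close>

instantiation op :: (type) complex_algebra
begin

lift_definition zero_op :: "'a op" is "\<lambda>f x. 0" by simp
lift_definition one_op :: "'a op" is "\<lambda>f. f" by simp
lift_definition plus_op :: "'a op \<Rightarrow> 'a op \<Rightarrow> 'a op" is "\<lambda>F G f x. F f x + G f x"
  by (simp add: fun_eq_iff algebra_simps)
lift_definition uminus_op :: "'a op \<Rightarrow> 'a op" is "\<lambda>F f x. - F f x"
  by (simp add: fun_eq_iff)
lift_definition minus_op :: "'a op \<Rightarrow> 'a op \<Rightarrow> 'a op" is "\<lambda>F G f x. F f x - G f x"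
  by (simp add: fun_eq_iff algebra_simps)
lift_definition times_op :: "'a op \<Rightarrow> 'a op \<Rightarrow> 'a op" is "\<lambda>F G f. G (F f)"
  by simp
lift_definition scaleC_op :: "complex \<Rightarrow> 'a op \<Rightarrow> 'a op" is "\<lambda>c F f x. c * F f x"
  by (simp add: fun_eq_iff algebra_simps)

instance
proof
  fix a b c :: "'a op" and x y :: complex
  show "a * b * c = a * (b * c)" "1 * a = a" "a * 1 = a"
    by (transfer; simp)+
  show "a + b + c = a + (b + c)" "a + b = b + a" "0 + a = a" "- a + a = 0" "a - b = a + - b"
    by (transfer; simp add: fun_eq_iff algebra_simps)+
  show "(a + b) * c = a * c + b * c"
  proof (transfer, rule ext)
    fix F G H :: "('a \<Rightarrow> complex) \<Rightarrow> 'a \<Rightarrow> complex" and f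
    assume "\<forall>f g c d. H (\<lambda>x. c * f x + d * g x) = (\<lambda>x. c * H f x + d * H g x)"
    from this[rule_format, of 1 "F f" 1 "G f"]
    show "H (\<lambda>x. F f x + G f x) = (\<lambda>x. H (F f) x + H (G f) x)" by simp
  qed
  show "a * (b + c) = a * b + a * c"
    by (transfer; simp)
  show "(0::'a op) \<noteq> 1"
  proof (transfer, rule notI)
    assume "(\<lambda>f (x::'a). 0::complex) = (\<lambda>f. f)"
    from fun_cong[OF fun_cong[OF this, of "\<lambda>x. 1"]] show False by simp
  qed
  show "x *\<^sub>C (a + b) = x *\<^sub>C a + x *\<^sub>C b" "(x + y) *\<^sub>C a = x *\<^sub>C a + y *\<^sub>C a"
    "x *\<^sub>C y *\<^sub>C a = (x * y) *\<^sub>C a" "1 *\<^sub>C a = a" "a * x *\<^sub>C b = x *\<^sub>C (a * b)"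
    by (transfer; simp add: fun_eq_iff algebra_simps)+
  show "x *\<^sub>C a * b = x *\<^sub>C (a * b)"
  proof (transfer, rule ext)
    fix F H :: "('a \<Rightarrow> complex) \<Rightarrow> 'a \<Rightarrow> complex" and f x
    assume "\<forall>f g c d. H (\<lambda>x. c * f x + d * g x) = (\<lambda>x. c * H f x + d * H g x)"
    from this[rule_format, of x "F f" 0 "F f"]
    show "H (\<lambda>y. x * F f y) = (\<lambda>y. x * H (F f) y)" by simp
  qed
qed

end

lemma app_simps [simp]:
  "app 0 f x = 0" "app 1 f = f" "app (F + G) f x = app F f x + app G f x" "app (- F) f x = - app F f x"
  "app (F - G) f x = app F f x - app G f x" "app (F * G) f = app G (app F f)"
  "app (c *\<^sub>C F) f x = c * app F f x"
  by (transfer; simp)+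

lemma app_sum [simp]: "app (sum F I) f x = (\<Sum>i\<in>I. app (F i) f x)"
  by (induction I rule: infinite_finite_induct) auto

lemma op_eqI: "(\<And>f x. app F f x = app G f x) \<Longrightarrow> F = G"
  by (simp add: app_inject[symmetric] fun_eq_iff)

section \<open>Letters and superderivations\<close>

type_synonym letter = "symbol \<times> nat"

definition const_part :: "letter \<Rightarrow> complex" where
  "const_part l = (if fst l = Proper (snd l) then 1 else 0)"

definition letter_sign :: "symbol \<Rightarrow> symbol \<Rightarrow> letter \<Rightarrow> complex" where
  "letter_sign a b l = (- 1) ^ ((parity a + parity b) * (parity (fst l) + 1))"

text \<open>\<open>der a b f\<close> is \<open>f \<circ> D\<close> for the superderivation \<open>D\<close> of the free algebra with \<open>D y_{b,j} = y_{a,j} + \<delta>_{a,j}\<close>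
  and \<open>D y_{c,j} = 0\<close> for \<open>c \<noteq> b\<close>. The letter \<open>(a, j)\<close> stands for \<open>y_{a,j}\<close>, of parity \<open>|a| + 1\<close>; it is a matrix
  entry minus \<open>\<delta>_{a,j}\<close>, so that evaluation at the unit matrix is the constant term.\<close>

fun der :: "symbol \<Rightarrow> symbol \<Rightarrow> (letter list \<Rightarrow> complex) \<Rightarrow> letter list \<Rightarrow> complex" where
  "der a b f [] = 0"
| "der a b f (l # w) = (if fst l = b then f ((a, snd l) # w) + const_part (a, snd l) * f w else 0)
     + letter_sign a b l * der a b (\<lambda>u. f (l # u)) w"

lemma der_lin: "der a b (\<lambda>u. c * f u + d * g u) w = c * der a b f w + d * der a b g w"
proof (induction w arbitrary: f g)
  case (Cons l w)
  show ?case by (auto simp: Cons algebra_simps)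
qed simp

lemma der_add: "der a b (\<lambda>u. f u + g u) w = der a b f w + der a b g w"
  using der_lin[of a b 1 f 1 g] by simp

lemma der_scale: "der a b (\<lambda>u. c * f u) w = c * der a b f w"
  using der_lin[of a b c f 0 f] by simp

lemma der_if: "der a b (\<lambda>u. if P then f u else 0) w = (if P then der a b f w else 0)"
  using der_scale[of a b 0 f w] by simp

lemma parity_cases: "parity a = 0 \<or> parity a = 1"
  by (cases a) auto

lemma letter_sign_swap: "letter_sign a b (c, j) = unit_sign (a, b) (c, d) * letter_sign a b (d, j)"
  using parity_cases[of a] parity_cases[of b] parity_cases[of c] parity_cases[of d]
  by (auto simp: letter_sign_def unit_sign_def)

text \<open>A letter with a constant term is proper, hence even, and is crossed without a
  sign.\<close>

lemma letter_sign_const_part: "const_part (c, j) * (unit_sign (a, b) (c, d) * letter_sign a b (d, j)) = const_part (c, j)"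
  using letter_sign_swap[of a b c j d] by (auto simp: const_part_def letter_sign_def)

lemma unit_sign_sym: "unit_sign x y = unit_sign y x"
  by (simp add: unit_sign_def mult.commute)

lemma unit_sign_sq: "unit_sign x y * unit_sign x y = 1"
  by (simp add: unit_sign_def power_add[symmetric])

lemma letter_sign_trans: "letter_sign a b l * letter_sign b d l = letter_sign a d l"
  using parity_cases[of a] parity_cases[of b] parity_cases[of "fst l"] parity_cases[of d]
  by (auto simp: letter_sign_def)

text \<open>The supercommutator of two superderivations is again one, hence determined by its values
  on letters. Along a word, the terms in which both act on the first letter give the bracket, those
  in which neither does are the induction hypothesis, and the mixed ones cancel.\<close>

lemma der_rel: "der c d (der a b f) w - unit_sign (a, b) (c, d) * der a b (der c d f) w
    = (if b = c then der a d f w else 0) - unit_sign (a, b) (c, d) * (if a = d then der c b f w else 0)"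
proof (induction w arbitrary: f)
  case (Cons l w)
  obtain x j where l: "l = (x, j)" by (cases l)
  let ?us = "unit_sign (a, b) (c, d)"
  have IH: "der c d (der a b (\<lambda>u. f (l # u))) w = ?us * der a b (der c d (\<lambda>u. f (l # u))) w
    + (if b = c then der a d (\<lambda>u. f (l # u)) w else 0)
    - ?us * (if a = d then der c b (\<lambda>u. f (l # u)) w else 0)"
    using Cons[of "\<lambda>u. f (l # u)"] by (simp add: algebra_simps)
  have e1: "der c d (der a b f) (l # w) =
      (if x = d then (if c = b then f ((a, j) # w) + const_part (a, j) * f w else 0)
         + letter_sign a b (c, j) * der a b (\<lambda>u. f ((c, j) # u)) w + const_part (c, j) * der a b f w else 0)
      + letter_sign c d l * ((if x = b then der c d (\<lambda>u. f ((a, j) # u)) w + const_part (a, j) * der c d f w else 0)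
      + letter_sign a b l * der c d (der a b (\<lambda>u. f (l # u))) w)"
    by (simp add: l der_add der_scale der_if)
  have e2: "der a b (der c d f) (l # w) =
      (if x = b then (if a = d then f ((c, j) # w) + const_part (c, j) * f w else 0)
         + letter_sign c d (a, j) * der c d (\<lambda>u. f ((a, j) # u)) w + const_part (a, j) * der c d f w else 0)
      + letter_sign a b l * ((if x = d then der a b (\<lambda>u. f ((c, j) # u)) w + const_part (c, j) * der a b f w else 0)
      + letter_sign c d l * der a b (der c d (\<lambda>u. f (l # u))) w)"
    by (simp add: l der_add der_scale der_if)
  have s1: "letter_sign a b (c, j) = ?us * letter_sign a b (d, j)" by (rule letter_sign_swap)
  have s2: "const_part (c, j) = ?us * letter_sign a b (d, j) * const_part (c, j)"
    using letter_sign_const_part[of c j a b d] by (simp add: mult.commute)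
  have s3: "?us * letter_sign c d (a, j) = letter_sign c d (b, j)"
    using letter_sign_swap[of c d a j b] unit_sign_sq[of "(a, b)" "(c, d)"]
    by (simp add: unit_sign_sym[of "(c, d)"] mult.assoc[symmetric])
  have s4: "?us * const_part (a, j) = letter_sign c d (b, j) * const_part (a, j)"
  proof -
    have "?us * const_part (a, j) = ?us * (const_part (a, j) * (?us * letter_sign c d (b, j)))"
      using letter_sign_const_part[of a j c d b] by (simp add: unit_sign_sym[of "(c, d)"])
    also have "\<dots> = (?us * ?us) * (letter_sign c d (b, j) * const_part (a, j))" by (simp only: ac_simps)
    finally show ?thesis by (simp add: unit_sign_sq)
  qed
  have s5: "b = c \<Longrightarrow> letter_sign c d l * (letter_sign a b l * z) = letter_sign a d l * z" for z
    unfolding letter_sign_trans[of a b l d, symmetric] by (simp only: ac_simps)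
  have s6: "a = d \<Longrightarrow> letter_sign c d l * (letter_sign a b l * z) = letter_sign c b l * z" for z
    unfolding letter_sign_trans[of c d l b, symmetric] by (simp only: ac_simps)
  define A B C D E where "A = der a b (\<lambda>u. f ((c, j) # u)) w" and "B = der a b f w"
    and "C = der c d (\<lambda>u. f ((a, j) # u)) w" and "D = der c d f w"
    and "E = der a b (der c d (\<lambda>u. f (l # u))) w"
  \<comment> \<open>Mixed terms: e_{c,d} acts on the first letter and e_{a,b} on a later one. The
    sign for crossing the letter before and after its replacement differs by
    \<open>unit_sign\<close>; \<open>t2\<close> is the mirror image.\<close>
  have t1: "letter_sign a b (c, j) * A + const_part (c, j) * B - ?us * (letter_sign a b l * (A + const_part (c, j) * B)) = 0"
    if "x = d"
  proof -
    have "const_part (c, j) * B = ?us * letter_sign a b (d, j) * const_part (c, j) * B" using s2 by simp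
    then show ?thesis using that s1 by (simp add: l algebra_simps)
  qed
  have t2: "letter_sign c d l * (C + const_part (a, j) * D) - ?us * (letter_sign c d (a, j) * C + const_part (a, j) * D) = 0"
    if "x = b"
  proof -
    have "?us * (letter_sign c d (a, j) * C + const_part (a, j) * D) = (?us * letter_sign c d (a, j)) * C + (?us * const_part (a, j)) * D"
      by (simp add: algebra_simps)
    also have "\<dots> = letter_sign c d (b, j) * C + letter_sign c d (b, j) * const_part (a, j) * D"
      by (simp only: s3 s4)
    finally show ?thesis using that by (simp add: l algebra_simps)
  qed
  have t3: "letter_sign c d l * (letter_sign a b l * der c d (der a b (\<lambda>u. f (l # u))) w) =
     ?us * (letter_sign a b l * (letter_sign c d l * E)) + (if b = c then letter_sign a d l * der a d (\<lambda>u. f (l # u)) w else 0)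
     - ?us * (if a = d then letter_sign c b l * der c b (\<lambda>u. f (l # u)) w else 0)"
  proof -
    have 5: "letter_sign c d l * (letter_sign a b l * (if b = c then z else 0)) = (if b = c then letter_sign a d l * z else 0)" for z
    proof (cases "b = c")
      case True
      show ?thesis unfolding if_P[OF True] by (rule s5[OF True])
    next
      case False
      show ?thesis unfolding if_not_P[OF False] by simp
    qed
    have 6: "letter_sign c d l * (letter_sign a b l * (if a = d then z else 0)) = (if a = d then letter_sign c b l * z else 0)" for z
    proof (cases "a = d")
      case True
      show ?thesis unfolding if_P[OF True] by (rule s6[OF True])
    next
      case False
      show ?thesis unfolding if_not_P[OF False] by simp
    qed
    have "letter_sign c d l * (letter_sign a b l * (u * E + X - u * Y))
        = u * (letter_sign a b l * (letter_sign c d l * E)) + letter_sign c d l * (letter_sign a b l * X)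
          - u * (letter_sign c d l * (letter_sign a b l * Y))" for u X Y
      by (simp add: algebra_simps)
    then show ?thesis
      unfolding IH E_def[symmetric] 5[symmetric] 6[symmetric] .
  qed
  define V W where "V = letter_sign c d l * (letter_sign a b l * der c d (der a b (\<lambda>u. f (l # u))) w)"
    and "W = letter_sign a b l * (letter_sign c d l * E)"
  define m1 m1' m2 m2' F1 F2 where "m1 = letter_sign a b (c, j) * A + const_part (c, j) * B"
    and "m1' = letter_sign a b l * (A + const_part (c, j) * B)"
    and "m2 = letter_sign c d l * (C + const_part (a, j) * D)" and "m2' = letter_sign c d (a, j) * C + const_part (a, j) * D"
    and "F1 = f ((a, j) # w) + const_part (a, j) * f w" and "F2 = f ((c, j) # w) + const_part (c, j) * f w"
  have e1': "der c d (der a b f) (l # w) =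
      (if x = d then (if b = c then F1 else 0) + m1 else 0) + ((if x = b then m2 else 0) + V)"
    unfolding e1 A_def[symmetric] B_def[symmetric] C_def[symmetric] D_def[symmetric]
      m1_def m2_def F1_def V_def by (simp add: distrib_left)
  have e2': "der a b (der c d f) (l # w) =
      (if x = b then (if a = d then F2 else 0) + m2' else 0) + ((if x = d then m1' else 0) + W)"
    unfolding e2 A_def[symmetric] B_def[symmetric] C_def[symmetric] D_def[symmetric] E_def[symmetric]
      m1'_def m2'_def F2_def W_def by (simp add: distrib_left)
  have m: "x = d \<Longrightarrow> m1 = ?us * m1'" "x = b \<Longrightarrow> m2 = ?us * m2'"
    using t1 t2 unfolding m1_def m2_def m1'_def m2'_def by auto
  have r: "(if b = c then der a d f (l # w) else 0) = (if b = c \<and> x = d then F1 else 0)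
      + (if b = c then letter_sign a d l * der a d (\<lambda>u. f (l # u)) w else 0)"
    "(if a = d then der c b f (l # w) else 0) = (if a = d \<and> x = b then F2 else 0)
      + (if a = d then letter_sign c b l * der c b (\<lambda>u. f (l # u)) w else 0)"
    by (auto simp: l F1_def F2_def)
  show ?case
    unfolding e1' e2' r t3[folded V_def W_def]
    by (simp add: m ring_distribs)
qed simp

lift_definition der_op :: "unit_symbol \<Rightarrow> letter list op" is "\<lambda>x. der (fst x) (snd x)"
  by (simp add: fun_eq_iff der_lin)

lemma app_der_op: "app (der_op (a, b)) f = der a b f"
  by transfer simp

lemma der_op_relator: "eval der_op (relator x y) = 0"
proof (rule op_eqI)
  fix f w
  obtain a b c d where xy: "x = (a, b)" "y = (c, d)" by (cases x, cases y)
  show "app (eval der_op (relator x y)) f w = app 0 f w"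
    using der_rel[of c d a b f w]
    by (auto simp: xy relator_def br_def app_der_op split: if_splits)
qed

lemma der_op_env_ker: "t \<in> env_ker A \<Longrightarrow> eval der_op t = 0"
  by (rule eval_env_ker) (auto simp: der_op_relator)

section \<open>Irregular products kill functionals at words without virtual letters\<close>

lemma der_eq_0:
  assumes "\<And>w1 l w2. w = w1 @ l # w2 \<Longrightarrow> fst l = b \<Longrightarrow>
      h (w1 @ (a, snd l) # w2) = 0 \<and> (const_part (a, snd l) \<noteq> 0 \<longrightarrow> h (w1 @ w2) = 0)"
  shows "der a b h w = 0"
  using assms
proof (induction w arbitrary: h)
  case (Cons l w)
  have "der a b (\<lambda>u. h (l # u)) w = 0"
  proof (rule Cons.IH)
    fix w1 l' w2 assume "w = w1 @ l' # w2" "fst l' = b"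
    with Cons.prems[of "l # w1" l' w2]
    show "h (l # w1 @ (a, snd l') # w2) = 0 \<and> (const_part (a, snd l') \<noteq> 0 \<longrightarrow> h (l # w1 @ w2) = 0)"
      by simp
  qed
  with Cons.prems[of "[]" l w] show ?case by auto
qed simp

text \<open>The factors of index at most i form a suffix of the list. The count of left indices is
  over j < i, and \<open>tl\<close> drops exactly the factor of index i.\<close>

lemma irregular_alt:
  "irregular ws \<longleftrightarrow> (\<exists>us vs \<gamma>. ws = us @ vs \<and> vs \<noteq> [] \<and> virtual \<gamma> \<and>
     length (filter (\<lambda>x. fst x = \<gamma>) (tl vs)) < length (filter (\<lambda>x. snd x = \<gamma>) vs))"
proof -
  have c: "card {j \<in> {1..i}. P (ws ! (length ws - j))} = length (filter P (drop (length ws - i) ws))"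
    if "i \<le> length ws" for P i
  proof -
    have "bij_betw (\<lambda>k. i - k) {k. k < length (drop (length ws - i) ws) \<and> P (drop (length ws - i) ws ! k)}
        {j \<in> {1..i}. P (ws ! (length ws - j))}"
      by (rule bij_betw_byWitness[where f' = "\<lambda>j. i - j"]) (use that in auto)
    from bij_betw_same_card[OF this] show ?thesis by (simp add: length_filter_conv_card)
  qed
  have c': "card {j \<in> {1..<i}. P (ws ! (length ws - j))} = length (filter P (tl (drop (length ws - i) ws)))"
    if "i \<le> length ws" "1 \<le> i" for P i
  proof -
    have "{1..<i} = {1..i - 1}" using that by auto
    moreover have "tl (drop (length ws - i) ws) = drop (length ws - (i - 1)) ws"
      using that by (simp add: drop_Suc[symmetric] tl_drop Suc_diff_le)
    ultimately show ?thesis using c[of "i - 1" P] that by simp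
  qed
  show ?thesis
  proof
    assume "irregular ws"
    then obtain i \<gamma> where i: "i \<in> {1..length ws}" "virtual \<gamma>"
      "card {j \<in> {1..i}. snd (ws ! (length ws - j)) = \<gamma>}
         > card {j \<in> {1..<i}. fst (ws ! (length ws - j)) = \<gamma>}"
      unfolding irregular_def by blast
    then have "length (filter (\<lambda>x. fst x = \<gamma>) (tl (drop (length ws - i) ws)))
        < length (filter (\<lambda>x. snd x = \<gamma>) (drop (length ws - i) ws))"
      using c[of i "\<lambda>x. snd x = \<gamma>"] c'[of i "\<lambda>x. fst x = \<gamma>"] by simp
    with i show "\<exists>us vs \<gamma>. ws = us @ vs \<and> vs \<noteq> [] \<and> virtual \<gamma> \<and>
     length (filter (\<lambda>x. fst x = \<gamma>) (tl vs)) < length (filter (\<lambda>x. snd x = \<gamma>) vs)"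
      by (intro exI[of _ "take (length ws - i) ws"] exI[of _ "drop (length ws - i) ws"] exI[of _ \<gamma>]) auto
  next
    assume "\<exists>us vs \<gamma>. ws = us @ vs \<and> vs \<noteq> [] \<and> virtual \<gamma> \<and>
     length (filter (\<lambda>x. fst x = \<gamma>) (tl vs)) < length (filter (\<lambda>x. snd x = \<gamma>) vs)"
    then obtain us vs \<gamma> where v: "ws = us @ vs" "vs \<noteq> []" "virtual \<gamma>"
      "length (filter (\<lambda>x. fst x = \<gamma>) (tl vs)) < length (filter (\<lambda>x. snd x = \<gamma>) vs)" by blast
    have i: "length vs \<in> {1..length ws}" using v by (cases vs) auto
    have d: "drop (length ws - length vs) ws = vs" using v by simp
    show "irregular ws"
      unfolding irregular_def
      by (rule bexI[OF _ i], rule exI[of _ \<gamma>])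
        (use i v(3,4) c[of "length vs" "\<lambda>x. snd x = \<gamma>"] c'[of "length vs" "\<lambda>x. fst x = \<gamma>"] in \<open>simp add: d\<close>)
  qed
qed

lemma irregularI:
  assumes "snd x = \<gamma>" "virtual \<gamma>" "\<And>y. y \<in> set vs \<Longrightarrow> fst y \<noteq> \<gamma>"
  shows "irregular (us @ x # vs)"
proof -
  have "filter (\<lambda>x. fst x = \<gamma>) vs = []" using assms(3) by (auto simp: filter_empty_conv)
  then show ?thesis
    unfolding irregular_alt
    by (intro exI[of _ us] exI[of _ "x # vs"] exI[of _ \<gamma>]) (use assms in auto)
qed

text \<open>Read on words, the rightmost factor acts first, and e_{a,b} consumes a letter with row b
  and creates one with row a. If \<gamma> is to be consumed more often than it is available in the
  word or created on the way, nothing remains. The leftmost factor acts last, so what it creates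
  cannot be consumed: this is the \<open>tl\<close>.\<close>

lemma der_count_zero:
  assumes "virtual \<gamma>" "vs \<noteq> []"
    "length (filter (\<lambda>l. fst l = \<gamma>) w) + length (filter (\<lambda>x. fst x = \<gamma>) (tl vs))
      < length (filter (\<lambda>x. snd x = \<gamma>) vs)"
  shows "app (eval der_op (wd vs)) f w = 0"
  using assms(2-)
proof (induction vs arbitrary: w rule: rev_induct)
  case (snoc x vs)
  obtain a b where x: "x = (a, b)" by (cases x)
  have "der a b (app (eval der_op (wd vs)) f) w = 0"
  proof (rule der_eq_0)
    fix w1 l w2 assume w: "w = w1 @ l # w2" "fst l = b"
    show "app (eval der_op (wd vs)) f (w1 @ (a, snd l) # w2) = 0
        \<and> (const_part (a, snd l) \<noteq> 0 \<longrightarrow> app (eval der_op (wd vs)) f (w1 @ w2) = 0)"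
    proof (cases "vs = []")
      case True
      with snoc.prems(2) w show ?thesis by (auto simp: x split: if_splits)
    next
      case False
      have 1: "app (eval der_op (wd vs)) f (w1 @ (a, snd l) # w2) = 0"
        by (rule snoc.IH) (use False snoc.prems(2) w in \<open>auto simp: x split: if_splits\<close>)
      \<comment> \<open>When a letter is deleted instead of replaced, the constant term forces
        \<open>a\<close> to be proper, so no copy of \<gamma> is lost from the balance.\<close>
      have 2: "app (eval der_op (wd vs)) f (w1 @ w2) = 0" if "const_part (a, snd l) \<noteq> 0"
      proof -
        have "a \<noteq> \<gamma>" using that assms(1) by (auto simp: const_part_def split: if_splits)
        then show ?thesis
          by (intro snoc.IH) (use False snoc.prems(2) w in \<open>auto simp: x split: if_splits\<close>)
      qed
      from 1 2 show ?thesis by simp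
    qed
  qed
  then show ?case by (simp add: x app_der_op)
qed simp

lemma irregular_vanish:
  assumes "irregular ws" "\<And>l. l \<in> set w \<Longrightarrow> \<not> virtual (fst l)"
  shows "app (eval der_op (wd ws)) f w = 0"
proof -
  from assms(1) obtain us vs \<gamma> where v: "ws = us @ vs" "vs \<noteq> []" "virtual \<gamma>"
      "length (filter (\<lambda>x. fst x = \<gamma>) (tl vs)) < length (filter (\<lambda>x. snd x = \<gamma>) vs)"
    unfolding irregular_alt by blast
  have "filter (\<lambda>l. fst l = \<gamma>) w = []"
    using assms(2) v(3) by (auto simp: filter_empty_conv)
  with v have "app (eval der_op (wd vs)) g w = 0" for g
    by (intro der_count_zero[of \<gamma>]) auto
  then show ?thesis by (simp add: v(1))
qed

section \<open>Faithfulness on \<open>U(gl(n))\<close>\<close>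

text \<open>A strict bound: degree at most d reads \<open>deg_lt (Suc d)\<close>, and bound 0
  singles out the zero element, where inductions start.\<close>

definition deg_lt :: "nat \<Rightarrow> 'g fa \<Rightarrow> bool" where
  "deg_lt d t \<longleftrightarrow> (\<forall>w. coeffs t w \<noteq> 0 \<longrightarrow> length w < d)"

lemma deg_lt_0 [simp]: "deg_lt d 0"
  by (simp add: deg_lt_def)

lemma deg_lt_add: "deg_lt d a \<Longrightarrow> deg_lt d b \<Longrightarrow> deg_lt d (a + b)"
  by (auto simp: deg_lt_def) (metis add.right_neutral)

lemma deg_lt_scaleC: "deg_lt d a \<Longrightarrow> deg_lt d (c *\<^sub>C a)"
  by (auto simp: deg_lt_def)

lemma deg_lt_uminus: "deg_lt d a \<Longrightarrow> deg_lt d (- a)"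
  by (auto simp: deg_lt_def)

lemma deg_lt_diff: "deg_lt d a \<Longrightarrow> deg_lt d b \<Longrightarrow> deg_lt d (a - b)"
  by (simp only: diff_conv_add_uminus deg_lt_add deg_lt_uminus)

lemma deg_lt_sum: "(\<And>i. i \<in> I \<Longrightarrow> deg_lt d (f i)) \<Longrightarrow> deg_lt d (sum f I)"
  by (induction I rule: infinite_finite_induct) (auto simp: deg_lt_add)

lemma deg_lt_wd [simp]: "deg_lt d (wd u) \<longleftrightarrow> length u < d"
  by (auto simp: deg_lt_def coeffs_wd)

lemma coeffs_mult_nonzero:
  assumes "coeffs (a * b) w \<noteq> 0"
  obtains u v where "w = u @ v" "coeffs a u \<noteq> 0" "coeffs b v \<noteq> 0"
proof -
  from assms obtain i where "coeffs a (take i w) * coeffs b (drop i w) \<noteq> 0"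
    unfolding coeffs_times by (meson sum.neutral)
  with that[of "take i w" "drop i w"] show thesis by auto
qed

lemma deg_lt_mult1: "deg_lt (Suc m) a \<Longrightarrow> deg_lt k b \<Longrightarrow> deg_lt (m + k) (a * b)"
  unfolding deg_lt_def by (auto elim!: coeffs_mult_nonzero) fastforce

lemma deg_lt_mult2: "deg_lt m a \<Longrightarrow> deg_lt (Suc k) b \<Longrightarrow> deg_lt (m + k) (a * b)"
  unfolding deg_lt_def by (auto elim!: coeffs_mult_nonzero) fastforce

lemma deg_lt_exists: "\<exists>d. deg_lt d t"
proof -
  have "\<exists>d. \<forall>k\<in>length ` {w. coeffs t w \<noteq> 0}. k \<le> d"
    using finite_imageI[OF finite_supp[of t], of length] finite_nat_set_iff_bounded_le by blast
  then obtain d where "\<And>w. coeffs t w \<noteq> 0 \<Longrightarrow> length w \<le> d" by auto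
  then have "deg_lt (Suc d) t" by (auto simp: deg_lt_def less_Suc_eq_le)
  then show ?thesis ..
qed

definition counit :: "letter list \<Rightarrow> complex" where
  "counit w = (if w = [] then 1 else 0)"

text \<open>Differentiate by t, then evaluate at the unit matrix: t regarded as a distribution
  supported there.\<close>

definition pairing :: "unit_symbol fa \<Rightarrow> letter list \<Rightarrow> complex" where
  "pairing t = app (eval der_op t) counit"

lemma pairing_add [simp]: "pairing (a + b) w = pairing a w + pairing b w"
  and pairing_diff [simp]: "pairing (a - b) w = pairing a w - pairing b w"
  and pairing_scaleC [simp]: "pairing (c *\<^sub>C a) w = c * pairing a w"
  and pairing_sum [simp]: "pairing (sum f I) w = (\<Sum>i\<in>I. pairing (f i) w)"
  and pairing_0 [simp]: "pairing 0 w = 0"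
  by (simp_all add: pairing_def)

lemma pairing_snoc: "pairing (wd (v @ [(a, b)])) = der a b (pairing (wd v))"
  by (simp add: pairing_def app_der_op)

lemma pairing_Nil: "pairing (wd []) = counit"
  by (simp add: pairing_def)

lemma pairing_env_ker: "t \<in> env_ker A \<Longrightarrow> pairing t w = 0"
  using der_op_env_ker[of t A] by (simp add: pairing_def)

text \<open>A factor keeps the length of a word or lowers it by one, so too few factors never reach
  the empty word.\<close>

lemma pairing_long: "length v < length w \<Longrightarrow> pairing (wd v) w = 0"
proof (induction v arbitrary: w rule: rev_induct)
  case Nil
  then show ?case by (auto simp: pairing_Nil counit_def)
next
  case (snoc x v)
  obtain a b where x: "x = (a, b)" by (cases x)
  show ?case
    unfolding x pairing_snoc by (rule der_eq_0) (use snoc in auto)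
qed

lemma pairing_deg_lt: "deg_lt d t \<Longrightarrow> d \<le> length w \<Longrightarrow> pairing t w = 0"
proof -
  assume a: "deg_lt d t" "d \<le> length w"
  have "pairing (wd x) w = 0" if "coeffs t x \<noteq> 0" for x
    using a that by (intro pairing_long) (auto simp: deg_lt_def intro: less_le_trans)
  then show ?thesis
    by (subst fa_expand[OF finite_supp, of t t]) (auto intro!: sum.neutral)
qed

abbreviation gl_basis :: "nat \<Rightarrow> unit_symbol set" where
  "gl_basis n \<equiv> proper_symbols n \<times> proper_symbols n"

definition letters :: "nat \<Rightarrow> letter set" where
  "letters n = proper_symbols n \<times> {1..n}"

fun idx :: "symbol \<Rightarrow> nat" where
  "idx (Proper i) = i"
| "idx _ = 0"

text \<open>The letter on which \<open>e_{i,j}\<close> has constant term 1.\<close>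

definition dual_letter :: "unit_symbol \<Rightarrow> letter" where
  "dual_letter x = (snd x, idx (fst x))"

lemma dual_letter_letters: "x \<in> gl_basis n \<Longrightarrow> dual_letter x \<in> letters n"
  by (auto simp: dual_letter_def letters_def proper_symbols_def)

lemma dual_letter_inj: "inj_on dual_letter (gl_basis n)"
  by (auto simp: inj_on_def dual_letter_def proper_symbols_def)

lemma letter_sign_Proper [simp]: "letter_sign (Proper i) (Proper j) l = 1"
  by (simp add: letter_sign_def)

text \<open>Replacing a letter keeps the length, where h vanishes, so only deletions of the letter
  with constant term survive. On a functional that sees only the multiset, each occurrence of that
  letter contributes equally.\<close>

lemma der_top:
  assumes "\<And>u. length w \<le> length u \<Longrightarrow> h u = 0"
    and "\<And>u. Suc (length u) = length w \<Longrightarrow> h u = (if mset u = M then c else 0)"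
  shows "der (Proper i) (Proper j) h w =
    of_nat (count (mset w) (Proper j, i)) * (if mset w = add_mset (Proper j, i) M then c else 0)"
  using assms
proof (induction w arbitrary: h M c)
  case (Cons l w)
  let ?y = "(Proper j, i)"
  have h0: "h ((Proper i, k) # w) = 0" for k by (rule Cons.prems(1)) simp
  have h1: "h w = (if mset w = M then c else 0)" by (rule Cons.prems(2)) simp
  have e: "der (Proper i) (Proper j) h (l # w) = (if l = ?y then (if mset w = M then c else 0) else 0)
      + der (Proper i) (Proper j) (\<lambda>u. h (l # u)) w"
    by (cases l) (auto simp: h0 h1 const_part_def)
  show ?case
  proof (cases "l \<in># M")
    case True
    then obtain M' where M: "M = add_mset l M'" by (meson mset_add)
    have "der (Proper i) (Proper j) (\<lambda>u. h (l # u)) w =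
      of_nat (count (mset w) ?y) * (if mset w = add_mset ?y M' then c else 0)"
      by (rule Cons.IH) (auto simp: Cons.prems M)
    then show ?thesis unfolding e by (auto simp: M algebra_simps)
  next
    case False
    \<comment> \<open>With l outside M the functional \<open>h (l # u)\<close> is zero at the
      relevant length, so the induction hypothesis is applied with the constant 0 and an arbitrary
      multiset.\<close>
    have "der (Proper i) (Proper j) (\<lambda>u. h (l # u)) w = 0"
    proof -
      have "der (Proper i) (Proper j) (\<lambda>u. h (l # u)) w =
         of_nat (count (mset w) ?y) * (if mset w = add_mset ?y {#} then 0 else 0)"
      proof (rule Cons.IH[where M = "{#}" and c = 0])
        fix u :: "letter list" assume "Suc (length u) = length w"
        then have "h (l # u) = (if mset (l # u) = M then c else 0)" by (intro Cons.prems(2)) simp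
        moreover have "mset (l # u) \<noteq> M" using False by auto
        ultimately show "h (l # u) = (if mset u = {#} then 0 else 0)" by simp
      qed (simp add: Cons.prems(1))
      then show ?thesis by simp
    qed
    moreover have "count (mset w) ?y = 0" if "mset (l # w) = add_mset ?y M" "l = ?y"
      using that False by (auto simp: not_in_iff)
    moreover have "l = ?y" if "mset (l # w) = add_mset ?y M"
    proof -
      have "l \<in># add_mset ?y M" using that by (metis list.set_intros(1) set_mset_mset)
      with False show ?thesis by auto
    qed
    ultimately show ?thesis unfolding e by auto
  qed
qed simp

text \<open>At equal length every factor has to delete its dual letter, so v pairs only with
  rearrangements of its dual word. The constant c is the product of the factorials of the
  multiplicities.\<close>

lemma pairing_top:
  assumes "set v \<subseteq> gl_basis n"
  shows "\<exists>c. c \<noteq> 0 \<and> (\<forall>w. length w = length v \<longrightarrow>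
    pairing (wd v) w = (if mset w = mset (map dual_letter v) then c else 0))"
  using assms
proof (induction v rule: rev_induct)
  case Nil
  then show ?case by (intro exI[of _ 1]) (auto simp: pairing_Nil counit_def)
next
  case (snoc x v)
  obtain i j where x: "x = (Proper i, Proper j)"
    using snoc.prems by (auto simp: proper_symbols_def)
  from snoc obtain c where c: "c \<noteq> 0"
    "\<And>w. length w = length v \<Longrightarrow> pairing (wd v) w = (if mset w = mset (map dual_letter v) then c else 0)"
    by auto
  let ?y = "(Proper j, i)" and ?M = "mset (map dual_letter v)"
  have "pairing (wd (v @ [x])) w = (if mset w = mset (map dual_letter (v @ [x]))
      then of_nat (count (add_mset ?y ?M) ?y) * c else 0)"
    if "length w = length (v @ [x])" for w
    unfolding x pairing_snoc
    by (subst der_top[where M = ?M and c = c]) (use that c(2) in \<open>auto simp: pairing_long dual_letter_def\<close>)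
  moreover have "of_nat (count (add_mset ?y ?M) ?y) * c \<noteq> 0"
    using c(1) by (metis count_add_mset mult_eq_0_iff nat.distinct(1) of_nat_eq_0_iff)
  ultimately show ?case by blast
qed

section \<open>Reordering products modulo lower degree\<close>

lemma br_fa_on: "x \<in> A \<times> A \<Longrightarrow> y \<in> A \<times> A \<Longrightarrow> br x y \<in> fa_on (A \<times> A)"
  by (auto simp: br_def)

lemma br_deg_lt: "deg_lt 2 (br x y)"
  by (auto simp: br_def intro!: deg_lt_diff deg_lt_scaleC deg_lt_uminus)

lemma unit_sign_gl_basis: "x \<in> gl_basis n \<Longrightarrow> unit_sign x y = 1"
  by (auto simp: unit_sign_def proper_symbols_def)

lemma move_front:
  assumes "set (us @ x # vs) \<subseteq> gl_basis n"
  shows "\<exists>lo. lo \<in> fa_on (gl_basis n) \<and> deg_lt (length (us @ x # vs)) lo \<and>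
    wd (us @ x # vs) - wd (x # us @ vs) - lo \<in> env_ker (proper_symbols n)"
  using assms
proof (induction us)
  case Nil
  then show ?case by (intro exI[of _ 0]) simp
next
  case (Cons u us)
  then obtain lo where lo: "lo \<in> fa_on (gl_basis n)" "deg_lt (length (us @ x # vs)) lo"
    "wd (us @ x # vs) - wd (x # us @ vs) - lo \<in> env_ker (proper_symbols n)" by auto
  have in_gl_basis: "u \<in> gl_basis n" "x \<in> gl_basis n" "set us \<subseteq> gl_basis n" "set vs \<subseteq> gl_basis n" using Cons.prems by auto
  let ?lo = "wd [u] * lo + br u x * wd (us @ vs)"
  have "deg_lt (1 + length (us @ x # vs)) (wd [u] * lo)"
    by (rule deg_lt_mult1) (use lo in auto)
  moreover have "deg_lt (2 + length (us @ vs)) (br u x * wd (us @ vs))"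
    by (rule deg_lt_mult2) (auto simp: br_deg_lt)
  ultimately have "deg_lt (length ((u # us) @ x # vs)) ?lo"
    by (auto intro!: deg_lt_add)
  moreover have "?lo \<in> fa_on (gl_basis n)"
    using in_gl_basis lo br_fa_on[of u "proper_symbols n" x] by simp
  moreover have "wd ((u # us) @ x # vs) - wd (x # (u # us) @ vs) - ?lo
    = wd [u] * (wd (us @ x # vs) - wd (x # us @ vs) - lo) + relator u x * wd (us @ vs)"
    by (simp add: algebra_simps relator_def unit_sign_gl_basis[OF in_gl_basis(1)] wd_append[symmetric])
  moreover have "\<dots> \<in> env_ker (proper_symbols n)"
    using in_gl_basis lo by (intro env_ker_add env_ker_lmult env_ker_rmult env_ker_relator) auto
  ultimately show ?case by metis
qed

text \<open>The spanning half of Poincare-Birkhoff-Witt: a commutator of two units is a combination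
  of single units, so the order of the factors matters only in lower degree.\<close>

lemma wd_mset_eq:
  assumes "mset v = mset v'" "set v \<subseteq> gl_basis n"
  shows "\<exists>lo. lo \<in> fa_on (gl_basis n) \<and> deg_lt (length v) lo \<and> wd v - wd v' - lo \<in> env_ker (proper_symbols n)"
  using assms
proof (induction v arbitrary: v')
  case Nil
  then show ?case by (intro exI[of _ 0]) simp
next
  case (Cons x v)
  have "x \<in> set v'" using Cons.prems(1) by (metis list.set_intros(1) set_mset_mset)
  then obtain us vs where v': "v' = us @ x # vs" by (meson split_list)
  then have m: "mset v = mset (us @ vs)" using Cons.prems(1) by simp
  have in_gl_basis: "x \<in> gl_basis n" "set v \<subseteq> gl_basis n" "set v' \<subseteq> gl_basis n"
    using Cons.prems by (auto simp: mset_eq_setD[OF Cons.prems(1)[symmetric]])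
  from Cons.IH[OF m in_gl_basis(2)] obtain lo1 where lo1: "lo1 \<in> fa_on (gl_basis n)" "deg_lt (length v) lo1"
    "wd v - wd (us @ vs) - lo1 \<in> env_ker (proper_symbols n)" by blast
  from move_front[of us x vs n] in_gl_basis(3) v' obtain lo2 where lo2: "lo2 \<in> fa_on (gl_basis n)" "deg_lt (length v') lo2"
    "wd v' - wd (x # us @ vs) - lo2 \<in> env_ker (proper_symbols n)" by auto
  let ?lo = "wd [x] * lo1 - lo2"
  have len: "length v' = length (x # v)" using Cons.prems(1) by (metis size_mset)
  have "deg_lt (1 + length v) (wd [x] * lo1)"
    by (rule deg_lt_mult1) (use lo1 in auto)
  then have "deg_lt (length (x # v)) ?lo"
    using lo2 len by (intro deg_lt_diff) auto
  moreover have "?lo \<in> fa_on (gl_basis n)" using lo1 lo2 in_gl_basis by simp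
  moreover have "wd (x # v) - wd v' - ?lo
    = wd [x] * (wd v - wd (us @ vs) - lo1) - (wd v' - wd (x # us @ vs) - lo2)"
    by (simp add: algebra_simps wd_append[symmetric])
  moreover have "\<dots> \<in> env_ker (proper_symbols n)"
    using in_gl_basis by (intro env_ker_diff[OF env_ker_lmult[OF lo1(3)] lo2(3)]) simp
  ultimately show ?case by metis
qed

text \<open>Top-degree words are replaced by one representative per multiset, at the cost of lower
  terms. The pairing separates these representatives, so what is left in top degree has zero
  coefficients.\<close>

lemma reduce_degree:
  assumes t: "t \<in> fa_on (gl_basis n)" "deg_lt (Suc d) t"
    and Phi0: "\<And>w. set w \<subseteq> letters n \<Longrightarrow> pairing t w = 0"
  shows "\<exists>t'. t' \<in> fa_on (gl_basis n) \<and> deg_lt d t' \<and> t - t' \<in> env_ker (proper_symbols n)"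
proof -
  \<comment> \<open>The choice depends only on the multiset, so words with equal multisets share
    their representative.\<close>
  define rep where "rep v = (SOME u. mset u = mset v)" for v :: "unit_symbol list"
  have rep: "mset (rep v) = mset v" for v
    unfolding rep_def by (rule someI_ex) auto
  have rep_cong: "mset u = mset v \<Longrightarrow> rep u = rep v" for u v
    by (simp add: rep_def)
  let ?S = "{w. coeffs t w \<noteq> 0}"
  have fin: "finite ?S" by (rule finite_supp)
  have S: "set w \<subseteq> gl_basis n" "length w \<le> d" if "w \<in> ?S" for w
    using that t by (auto simp: fa_on_def deg_lt_def less_Suc_eq_le)
  have "\<forall>w\<in>?S. \<exists>lo. lo \<in> fa_on (gl_basis n) \<and> deg_lt (length w) lo \<and> wd w - wd (rep w) - lo \<in> env_ker (proper_symbols n)"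
    using wd_mset_eq[OF rep[symmetric]] S by blast
  then obtain lo where lo: "\<And>w. w \<in> ?S \<Longrightarrow> lo w \<in> fa_on (gl_basis n)" "\<And>w. w \<in> ?S \<Longrightarrow> deg_lt (length w) (lo w)"
     "\<And>w. w \<in> ?S \<Longrightarrow> wd w - wd (rep w) - lo w \<in> env_ker (proper_symbols n)"
    by metis
  define A B where "A = {w \<in> ?S. length w < d}" and "B = {w \<in> ?S. length w = d}"
  have AB: "?S = A \<union> B" "A \<inter> B = {}" "finite A" "finite B"
  proof -
    have "length w < d \<or> length w = d" if "coeffs t w \<noteq> 0" for w
      using S(2)[of w] that by auto
    then show "?S = A \<union> B" by (auto simp: A_def B_def)
  qed (use fin in \<open>auto simp: A_def B_def\<close>)
  define t' R where "t' = (\<Sum>w\<in>A. coeffs t w *\<^sub>C wd w) + (\<Sum>w\<in>B. coeffs t w *\<^sub>C lo w)"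
    and "R = (\<Sum>w\<in>B. coeffs t w *\<^sub>C wd (rep w))"
  have t': "t' \<in> fa_on (gl_basis n)"
    unfolding t'_def using S lo by (auto intro!: fa_on_add fa_on_sum simp: A_def B_def)
  have t'd: "deg_lt d t'"
    unfolding t'_def using lo(2) by (auto intro!: deg_lt_add deg_lt_sum deg_lt_scaleC simp: A_def B_def)
  have teq: "t = (\<Sum>w\<in>A. coeffs t w *\<^sub>C wd w) + (\<Sum>w\<in>B. coeffs t w *\<^sub>C wd w)"
  proof -
    have "w \<in> A \<union> B" if "coeffs t w \<noteq> 0" for w using that unfolding AB(1)[symmetric] by simp
    then have "t = (\<Sum>w\<in>A \<union> B. coeffs t w *\<^sub>C wd w)"
      by (intro fa_expand) (use AB in auto)
    then show ?thesis by (simp add: AB sum.union_disjoint)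
  qed
  have "\<And>a b c. a = b + c \<Longrightarrow> a - b = (c :: unit_symbol fa)" by simp
  from this[OF teq] have "t - t' - R = (\<Sum>w\<in>B. coeffs t w *\<^sub>C (wd w - wd (rep w) - lo w))"
    by (simp add: t'_def R_def scaleC_diff_right sum_subtractf diff_diff_eq[symmetric])
  moreover have "\<dots> \<in> env_ker (proper_symbols n)"
    using lo(3) by (auto intro!: env_ker_sum simp: B_def)
  ultimately have tR: "t - t' - R \<in> env_ker (proper_symbols n)" by simp
  have PhiR: "pairing R w = 0" if "set w \<subseteq> letters n" "length w = d" for w
    using pairing_env_ker[OF tR, of w] Phi0[OF that(1)] pairing_deg_lt[OF t'd, of w] that(2) by simp
  have R_supp: "rep u = u \<and> set u \<subseteq> gl_basis n \<and> length u = d" if u: "coeffs R u \<noteq> 0" for u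
  proof -
    from u obtain w where w: "w \<in> B" "coeffs t w * coeffs (wd (rep w)) u \<noteq> 0"
      unfolding R_def coeffs_sum coeffs_simps by (meson sum.neutral)
    then have "u = rep w" by (auto simp: coeffs_wd split: if_splits)
    moreover have "set (rep w) = set w" "length (rep w) = length w"
      using rep by (metis set_mset_mset, metis size_mset)
    ultimately show ?thesis
      using w(1) S(1)[of w] rep_cong[OF rep[of w]] by (auto simp: B_def)
  qed
  \<comment> \<open>Pairing with the dual word of u isolates the coefficient of u:
    \<open>dual_letter\<close> is injective, so another representative has a different dual
    multiset.\<close>
  have "R = 0"
  proof (rule fa_eqI, rule ccontr)
    fix u assume "coeffs R u \<noteq> coeffs 0 u"
    then have u: "coeffs R u \<noteq> 0" by simp
    let ?w = "map dual_letter u"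
    from pairing_top obtain c where c: "c \<noteq> 0" "pairing (wd u) ?w = c"
      using R_supp[OF u] by (metis length_map)
    have 0: "pairing (wd u') ?w = 0" if u': "coeffs R u' \<noteq> 0" "u' \<noteq> u" for u'
    proof -
      have "mset (map dual_letter u') \<noteq> mset ?w"
      proof
        assume "mset (map dual_letter u') = mset ?w"
        then have "image_mset (inv_into (gl_basis n) dual_letter) (mset (map dual_letter u'))
            = image_mset (inv_into (gl_basis n) dual_letter) (mset ?w)" by simp
        moreover have "map (inv_into (gl_basis n) dual_letter) (map dual_letter v) = v" if "set v \<subseteq> gl_basis n" for v
          using that by (induction v) (auto simp: inv_into_f_f[OF dual_letter_inj])
        ultimately have "mset u' = mset u"
          using R_supp[OF u] R_supp[OF u'(1)] by (metis mset_map)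
        then show False using rep_cong R_supp[OF u] R_supp[OF u'(1)] u'(2) by metis
      qed
      moreover obtain c' where "\<forall>w. length w = length u' \<longrightarrow>
          pairing (wd u') w = (if mset w = mset (map dual_letter u') then c' else 0)"
        using pairing_top R_supp[OF u'(1)] by blast
      ultimately show ?thesis using R_supp[OF u] R_supp[OF u'(1)] by auto
    qed
    have "pairing R ?w = (\<Sum>v | coeffs R v \<noteq> 0. coeffs R v * pairing (wd v) ?w)"
      by (subst fa_expand[OF finite_supp, of R R]) simp_all
    also have "\<dots> = (\<Sum>v\<in>{u}. coeffs R v * pairing (wd v) ?w)"
      by (rule sum.mono_neutral_right[OF finite_supp]) (use u 0 in auto)
    also have "\<dots> \<noteq> 0" using u c by simp
    finally have "pairing R ?w \<noteq> 0" .
    moreover have "pairing R ?w = 0"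
      by (rule PhiR) (use R_supp[OF u] dual_letter_letters in auto)
    ultimately show False by simp
  qed
  with tR t' t'd show ?thesis by auto
qed

text \<open>Plays the part of linear independence in Poincare-Birkhoff-Witt. The pairing depends
  only on the class of t, so its vanishing survives each exchange of t for an element of smaller
  degree.\<close>

theorem pairing_faithful:
  assumes "t \<in> fa_on (gl_basis n)" "\<And>w. set w \<subseteq> letters n \<Longrightarrow> pairing t w = 0"
  shows "t \<in> env_ker (proper_symbols n)"
proof -
  obtain d where "deg_lt d t" using deg_lt_exists by blast
  then show ?thesis using assms
  proof (induction d arbitrary: t)
    case 0
    then have "t = 0" by (intro fa_eqI) (auto simp: deg_lt_def)
    then show ?case by simp
  next
    case (Suc d)
    from reduce_degree[OF Suc.prems(2,1,3)] obtain t' where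
      t': "t' \<in> fa_on (gl_basis n)" "deg_lt d t'" "t - t' \<in> env_ker (proper_symbols n)" by blast
    have "pairing t' w = 0" if "set w \<subseteq> letters n" for w
      using pairing_env_ker[OF t'(3), of w] Suc.prems(3)[OF that] by simp
    with Suc.IH t' have "t' \<in> env_ker (proper_symbols n)" by blast
    from env_ker_add[OF t'(3) this] show ?case by simp
  qed
qed

section \<open>The virtual projection\<close>

lemma proper_subset_all: "proper_symbols n \<subseteq> all_symbols m0 m1 n"
  by (auto simp: all_symbols_def)

lemma gl_basis_subset_all: "gl_basis n \<subseteq> all_symbols m0 m1 n \<times> all_symbols m0 m1 n"
  using proper_subset_all by blast

lemma fa_on_gl_basis_all: "t \<in> fa_on (gl_basis n) \<Longrightarrow> t \<in> fa_on (all_symbols m0 m1 n \<times> all_symbols m0 m1 n)"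
  using fa_on_mono[OF gl_basis_subset_all] by blast

lemma coset_in_iff:
  assumes "env_ker A \<subseteq> J" "\<And>a b. a \<in> J \<Longrightarrow> b \<in> J \<Longrightarrow> a + b \<in> J"
  shows "coset A t \<in> coset A ` J \<longleftrightarrow> t \<in> J"
proof
  assume "coset A t \<in> coset A ` J"
  then obtain t' where "t' \<in> J" "t - t' \<in> env_ker A" by (auto simp: coset_eq_iff)
  then have "(t - t') + t' \<in> J" using assms by blast
  then show "t \<in> J" by simp
qed auto

lemma left_ideal_coset:
  assumes "J \<subseteq> fa_on (A \<times> A)" "0 \<in> J" "\<And>a b. a \<in> J \<Longrightarrow> b \<in> J \<Longrightarrow> a + b \<in> J"
    "\<And>a r. a \<in> J \<Longrightarrow> r \<in> fa_on (A \<times> A) \<Longrightarrow> r * a \<in> J"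
  shows "left_ideal (coset A ` J) (env_alg A)"
  unfolding left_ideal_def
proof (intro conjI)
  have neg: "- a \<in> J" if "a \<in> J" for a
    using assms(4)[OF that, of "- 1"] by simp
  have "subgroup (coset A ` J) (add_monoid (env_alg A))"
  proof
    show "coset A ` J \<subseteq> carrier (add_monoid (env_alg A))" using assms(1) by auto
    show "x \<otimes>\<^bsub>add_monoid (env_alg A)\<^esub> y \<in> coset A ` J" if "x \<in> coset A ` J" "y \<in> coset A ` J" for x y
    proof -
      from that obtain a b where ab: "x = coset A a" "y = coset A b" "a \<in> J" "b \<in> J" by auto
      then have "x \<otimes>\<^bsub>add_monoid (env_alg A)\<^esub> y = coset A (a + b)"
        using coset_add[of a A b] assms(1) by auto
      with ab assms(3) show ?thesis by blast
    qed
    show "\<one>\<^bsub>add_monoid (env_alg A)\<^esub> \<in> coset A ` J"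
      using assms(2) coset_zero[of A] by (auto intro!: image_eqI[of _ _ 0])
    show "inv\<^bsub>add_monoid (env_alg A)\<^esub> x \<in> coset A ` J" if "x \<in> coset A ` J" for x
    proof -
      from that obtain a where a: "x = coset A a" "a \<in> J" by auto
      then have "inv\<^bsub>add_monoid (env_alg A)\<^esub> x = coset A (- a)"
        using coset_uminus[of a A] assms(1) by (auto simp only: a_inv_def)
      with a neg show ?thesis by blast
    qed
  qed
  then show "additive_subgroup (coset A ` J) (env_alg A)"
    by (rule additive_subgroup.intro)
  show "\<forall>r\<in>carrier (env_alg A). \<forall>x\<in>coset A ` J. r \<otimes>\<^bsub>env_alg A\<^esub> x \<in> coset A ` J"
  proof (intro ballI)
    fix r x assume "r \<in> carrier (env_alg A)" "x \<in> coset A ` J"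
    then obtain a b where ab: "x = coset A a" "r = coset A b" "a \<in> J" "b \<in> fa_on (A \<times> A)"
      by (auto simp: carrier_env)
    then have "r \<otimes>\<^bsub>env_alg A\<^esub> x = coset A (b * a)"
      using coset_mult[of b A a] assms(1) by auto
    with ab assms(4) show "r \<otimes>\<^bsub>env_alg A\<^esub> x \<in> coset A ` J" by blast
  qed
qed

section \<open>The left ideal of irregular products, pulled back to the free algebra\<close>

context
  fixes m0 m1 n :: nat and A :: "symbol set"
  defines "A \<equiv> all_symbols m0 m1 n"
begin

definition irr_elts :: "unit_symbol fa set" where
  "irr_elts = {t \<in> fa_on (A \<times> A). coset A t \<in> Irr m0 m1 n}"

lemma left_ideal_Irr: "left_ideal (Irr m0 m1 n) (env_alg A)"
proof -
  let ?G = "{e_prod A ws | ws. ws \<in> lists (A \<times> A) \<and> irregular ws}"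
  let ?J = "{J. left_ideal J (env_alg A) \<and> ?G \<subseteq> J}"
  interpret ring "env_alg A" by (rule ring_env_alg)
  have Irr: "Irr m0 m1 n = \<Inter>?J" by (simp add: Irr_def Let_def A_def)
  have G: "?G \<subseteq> carrier (env_alg A)" by (auto simp: e_prod_coset lists_eq_set)
  have "additive_subgroup (carrier (env_alg A)) (env_alg A)"
    by (rule additive_subgroup.intro, rule add.subgroup_self)
  \<comment> \<open>The whole algebra is one of the intersected left ideals, so the intersection is
    over a nonempty family.\<close>
  with G have carr: "carrier (env_alg A) \<in> ?J"
    by (simp add: left_ideal_def)
  have sub: "additive_subgroup J (env_alg A)" if "J \<in> ?J" for J
    using that by (simp add: left_ideal_def)
  have "subgroup (\<Inter>?J) (add_monoid (env_alg A))"
  proof (rule add.subgroups_Inter)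
    show "subgroup H (add_monoid (env_alg A))" if "H \<in> ?J" for H
      by (rule additive_subgroup.a_subgroup[OF sub[OF that]])
    show "?J \<noteq> {}" using carr by (rule ex_in_conv[THEN iffD1, OF exI])
  qed
  then have "additive_subgroup (\<Inter>?J) (env_alg A)"
    by (rule additive_subgroup.intro)
  then show ?thesis
    unfolding Irr by (auto simp: left_ideal_def)
qed

lemma irr_elts_irregular:
  assumes "set ws \<subseteq> A \<times> A" "irregular ws"
  shows "wd ws \<in> irr_elts"
  using assms unfolding irr_elts_def Irr_def Let_def A_def[symmetric]
  by (auto simp: e_prod_coset[symmetric] lists_eq_set)

lemma irr_elts_env_ker: "t \<in> env_ker A \<Longrightarrow> t \<in> irr_elts"
proof -
  assume t: "t \<in> env_ker A"
  then have "coset A t = \<zero>\<^bsub>env_alg A\<^esub>"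
    unfolding coset_zero[symmetric] coset_eq_iff by simp
  with t env_ker_subset left_ideal_Irr show ?thesis
    by (auto simp: irr_elts_def left_ideal_def additive_subgroup.zero_closed)
qed

lemma irr_elts_add: "a \<in> irr_elts \<Longrightarrow> b \<in> irr_elts \<Longrightarrow> a + b \<in> irr_elts"
  using left_ideal_Irr
  by (auto simp: irr_elts_def coset_add left_ideal_def intro: additive_subgroup.a_closed)

lemma irr_elts_lmult: "a \<in> irr_elts \<Longrightarrow> r \<in> fa_on (A \<times> A) \<Longrightarrow> r * a \<in> irr_elts"
  using left_ideal_Irr by (auto simp: irr_elts_def coset_mult left_ideal_def)

text \<open>Containing the relations makes \<open>J\<close> a union of cosets, so minimality of
  \<open>Irr\<close> in the quotient can be pulled back to representatives.\<close>

lemma irr_elts_minimal: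
  assumes "J \<subseteq> fa_on (A \<times> A)" "env_ker A \<subseteq> J" "\<And>a b. a \<in> J \<Longrightarrow> b \<in> J \<Longrightarrow> a + b \<in> J"
    "\<And>a r. a \<in> J \<Longrightarrow> r \<in> fa_on (A \<times> A) \<Longrightarrow> r * a \<in> J"
    "\<And>ws. set ws \<subseteq> A \<times> A \<Longrightarrow> irregular ws \<Longrightarrow> wd ws \<in> J"
  shows "irr_elts \<subseteq> J"
proof
  fix t assume t: "t \<in> irr_elts"
  have 0: "0 \<in> J" using assms(2) env_ker_zero by blast
  have "left_ideal (coset A ` J) (env_alg A)"
    by (rule left_ideal_coset[OF assms(1) 0 assms(3,4)])
  moreover have "{e_prod A ws | ws. ws \<in> lists (A \<times> A) \<and> irregular ws} \<subseteq> coset A ` J"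
  proof
    fix x assume "x \<in> {e_prod A ws | ws. ws \<in> lists (A \<times> A) \<and> irregular ws}"
    then obtain ws where "x = e_prod A ws" "set ws \<subseteq> A \<times> A" "irregular ws"
      by (auto simp: lists_eq_set)
    then show "x \<in> coset A ` J"
      using e_prod_coset[of ws A] assms(5)[of ws] by auto
  qed
  ultimately have "Irr m0 m1 n \<subseteq> coset A ` J"
    unfolding Irr_def Let_def A_def by blast
  with t have "coset A t \<in> coset A ` J" by (auto simp: irr_elts_def)
  then show "t \<in> J" using coset_in_iff[of A J t] assms(2,3) by blast
qed

lemma irr_elts_uminus: "a \<in> irr_elts \<Longrightarrow> - a \<in> irr_elts"
  using irr_elts_lmult[of a "- 1"] by simp

lemma irr_elts_diff: "a \<in> irr_elts \<Longrightarrow> b \<in> irr_elts \<Longrightarrow> a - b \<in> irr_elts"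
  by (simp only: diff_conv_add_uminus irr_elts_add irr_elts_uminus)

lemma irr_elts_zero: "0 \<in> irr_elts"
  by (rule irr_elts_env_ker) simp

lemma irr_elts_sum: "(\<And>i. i \<in> I \<Longrightarrow> f i \<in> irr_elts) \<Longrightarrow> sum f I \<in> irr_elts"
  by (induction I rule: infinite_finite_induct) (auto simp: irr_elts_zero intro: irr_elts_add)

text \<open>Proper factors on the right create no virtual symbols, so the excess count on the suffix
  persists.\<close>

lemma irregular_append_proper:
  assumes "irregular ws" "set v \<subseteq> gl_basis n"
  shows "irregular (ws @ v)"
proof -
  from assms(1) obtain us vs \<gamma> where v: "ws = us @ vs" "vs \<noteq> []" "virtual \<gamma>"
      "length (filter (\<lambda>x. fst x = \<gamma>) (tl vs)) < length (filter (\<lambda>x. snd x = \<gamma>) vs)"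
    unfolding irregular_alt by blast
  have "filter (\<lambda>x. fst x = \<gamma>) v = []"
    using assms(2) v(3) by (auto simp: filter_empty_conv proper_symbols_def)
  with v show ?thesis
    unfolding irregular_alt by (intro exI[of _ us] exI[of _ "vs @ v"] exI[of _ \<gamma>]) auto
qed

text \<open>The elements whose product with a fixed proper word lies in \<open>Irr\<close> form a
  left ideal containing the irregular words, hence contain all of \<open>Irr\<close>.\<close>

lemma irr_elts_rmult:
  assumes "a \<in> irr_elts" "r \<in> fa_on (gl_basis n)"
  shows "a * r \<in> irr_elts"
proof -
  have wd: "a * wd v \<in> irr_elts" if v: "set v \<subseteq> gl_basis n" for v
  proof -
    have v': "set v \<subseteq> A \<times> A" using v gl_basis_subset_all unfolding A_def by blast
    have "irr_elts \<subseteq> {a \<in> fa_on (A \<times> A). a * wd v \<in> irr_elts}"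
    proof (rule irr_elts_minimal)
      show "env_ker A \<subseteq> {a \<in> fa_on (A \<times> A). a * wd v \<in> irr_elts}"
        using env_ker_subset[of A] v' by (auto intro!: irr_elts_env_ker env_ker_rmult)
      show "wd ws \<in> {a \<in> fa_on (A \<times> A). a * wd v \<in> irr_elts}" if "set ws \<subseteq> A \<times> A" "irregular ws" for ws
        using that v v' by (auto simp: wd_append[symmetric] intro!: irr_elts_irregular irregular_append_proper)
    qed (auto simp: distrib_right mult.assoc intro: irr_elts_add irr_elts_lmult)
    with assms(1) show ?thesis by blast
  qed
  from assms(2) show ?thesis
  proof (induction r rule: fa_on_induct)
    case (scale c b)
    then show ?case using irr_elts_lmult[of "a * b" "c *\<^sub>C 1"] by simp
  qed (auto simp: irr_elts_zero distrib_left wd intro: irr_elts_add)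
qed

text \<open>Demanding the vanishing for all f makes it stable under left multiplication: a left
  factor of t only changes the functional to which t is applied.\<close>

lemma irr_elts_vanish:
  assumes "t \<in> irr_elts" "set w \<subseteq> letters n"
  shows "app (eval der_op t) f w = 0"
proof -
  have w: "\<not> virtual (fst l)" if "l \<in> set w" for l
    using that assms(2) by (auto simp: letters_def proper_symbols_def)
  have "irr_elts \<subseteq> {t \<in> fa_on (A \<times> A). \<forall>f. app (eval der_op t) f w = 0}"
    by (rule irr_elts_minimal)
      (use env_ker_subset[of A] in \<open>auto simp: der_op_env_ker irregular_vanish[OF _ w] simp del: eval_wd\<close>)
  with assms(1) show ?thesis by auto
qed

lemma virt_proj_eq:
  assumes "x \<in> fa_on (A \<times> A)" "u \<in> fa_on (gl_basis n)" "x - u \<in> irr_elts"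
  shows "virt_proj m0 m1 n (coset A x) = coset (proper_symbols n) u"
proof -
  let ?P = "proper_symbols n"
  have PA: "?P \<subseteq> A" unfolding A_def by (rule proper_subset_all)
  have e: "coset A x \<ominus>\<^bsub>env_alg A\<^esub> embed A (coset ?P v) = coset A (x - v)" if "v \<in> fa_on (gl_basis n)" for v
    unfolding embed_coset[OF PA] using fa_on_gl_basis_all[OF that, of m0 m1, folded A_def] assms(1)
    by (simp add: coset_diff)
  show ?thesis
    unfolding virt_proj_def A_def[symmetric]
  proof (rule the_equality)
    show "coset ?P u \<in> carrier (Ugl n) \<and> coset A x \<ominus>\<^bsub>env_alg A\<^esub> embed A (coset ?P u) \<in> Irr m0 m1 n"
      using assms by (simp add: e irr_elts_def)
    fix v assume v: "v \<in> carrier (Ugl n) \<and> coset A x \<ominus>\<^bsub>env_alg A\<^esub> embed A v \<in> Irr m0 m1 n"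
    then obtain v' where v': "v = coset ?P v'" "v' \<in> fa_on (gl_basis n)" by (auto simp: carrier_env)
    with v assms(1) have "x - v' \<in> irr_elts"
      using fa_on_gl_basis_all[OF v'(2), of m0 m1, folded A_def] by (simp add: e irr_elts_def)
    from irr_elts_diff[OF assms(3) this] have d: "v' - u \<in> irr_elts" by simp
    \<comment> \<open>Directness of the sum: two candidates differ by an element of
      \<open>Irr\<close> over proper symbols, which pairs to zero with every proper word.\<close>
    have "v' - u \<in> env_ker ?P"
      by (rule pairing_faithful) (use v' assms(2) irr_elts_vanish[OF d] in \<open>auto simp: pairing_def\<close>)
    then show "v = coset ?P u" by (simp add: v' coset_eq_iff)
  qed
qed

end

section \<open>Images of the virtual monomials\<close>

definition gl_e :: "nat \<Rightarrow> nat \<Rightarrow> unit_symbol fa" where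
  "gl_e i j = wd [(Proper i, Proper j)]"

lemma gl_e_fa_on: "i \<in> {1..n} \<Longrightarrow> j \<in> {1..n} \<Longrightarrow> gl_e i j \<in> fa_on (gl_basis n)"
  by (simp add: gl_e_def proper_symbols_def)

definition remove_nth :: "nat \<Rightarrow> 'a list \<Rightarrow> 'a list" where
  "remove_nth t xs = take t xs @ drop (Suc t) xs"

lemma remove_nth_0 [simp]: "remove_nth 0 (x # xs) = xs"
  and remove_nth_Suc [simp]: "remove_nth (Suc t) (x # xs) = x # remove_nth t xs"
  by (simp_all add: remove_nth_def)

lemma length_remove_nth: "t < length xs \<Longrightarrow> Suc (length (remove_nth t xs)) = length xs"
  by (simp add: remove_nth_def)

lemma set_remove_nth: "set (remove_nth t xs) \<subseteq> set xs"
  by (auto simp: remove_nth_def dest: in_set_takeD in_set_dropD)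

lemma mset_remove_nth: "t < length xs \<Longrightarrow> add_mset (xs ! t) (mset (remove_nth t xs)) = mset xs"
proof (induction xs arbitrary: t)
  case (Cons x xs)
  then show ?case by (cases t) (auto simp: add_mset_commute)
qed simp

text \<open>The projection of \<open>e_{i_k,\<beta>} \<dots> e_{i_1,\<beta>} e_{\<beta>,j_1} \<dots> e_{\<beta>,j_k}\<close>, with \<open>i_1\<close> first in the first list.\<close>

fun virt_img :: "nat list \<Rightarrow> nat list \<Rightarrow> unit_symbol fa" where
  "virt_img [] js = 1"
| "virt_img (i # is) js = (\<Sum>t<length js. virt_img is (remove_nth t js) *
     (gl_e i (js ! t) - (if i = js ! t then of_nat (length js - 1) else 0)))"

lemma virt_img_fa_on: "set is \<subseteq> {1..n} \<Longrightarrow> set js \<subseteq> {1..n} \<Longrightarrow> virt_img is js \<in> fa_on (gl_basis n)"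
proof (induction "is" arbitrary: js)
  case (Cons i "is")
  have "js ! t \<in> {1..n}" if "t < length js" for t
    using that Cons.prems(2) nth_mem by blast
  moreover have "virt_img is (remove_nth t js) \<in> fa_on (gl_basis n)" for t
    using Cons.prems set_remove_nth[of t js] by (intro Cons.IH) auto
  ultimately show ?case
    using Cons.prems unfolding virt_img.simps by (intro fa_on_sum fa_on_mult fa_on_diff gl_e_fa_on) auto
qed simp

context
  fixes m0 m1 n :: nat and \<beta> :: symbol and A :: "symbol set"
  assumes beta: "\<beta> \<in> Beta ` {1..m1}"
  defines "A \<equiv> all_symbols m0 m1 n"
begin

abbreviation "irr \<equiv> irr_elts m0 m1 n"

lemma beta_A: "\<beta> \<in> A" and virtual_beta: "virtual \<beta>" and beta_Proper: "Proper i \<noteq> \<beta>" "\<beta> \<noteq> Proper i"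
  and parity_beta: "parity \<beta> = 1"
  using beta by (auto simp: A_def all_symbols_def)

lemma Proper_A: "i \<in> {1..n} \<Longrightarrow> Proper i \<in> A"
  by (auto simp: A_def all_symbols_def proper_symbols_def)

definition beta_wd :: "nat list \<Rightarrow> unit_symbol fa" where
  "beta_wd js = wd (map (\<lambda>j. (\<beta>, Proper j)) js)"

lemma beta_wd_Cons: "beta_wd (j # js) = wd [(\<beta>, Proper j)] * beta_wd js"
  unfolding beta_wd_def by (simp add: wd_append[symmetric])

lemma beta_wd_fa_on: "set js \<subseteq> {1..n} \<Longrightarrow> beta_wd js \<in> fa_on (A \<times> A)"
  using beta_A Proper_A by (auto simp: beta_wd_def)

text \<open>beta and the proper symbols are all odd, so every unit formed from them is even and the
  computation with virtual monomials is free of signs.\<close>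

lemma sign_one: "unit_sign (x, y) (z, v) = 1" if "x \<in> {\<beta>} \<union> range Proper" "y \<in> {\<beta>} \<union> range Proper"
  using that parity_beta by (auto simp: unit_sign_def)

lemma beta_wd_swap: 
  assumes "j \<in> {1..n}" "k \<in> {1..n}" "set js \<subseteq> {1..n}"
  shows "beta_wd (j # k # js) - beta_wd (k # j # js) \<in> env_ker A"
proof -
  have "beta_wd (j # k # js) - beta_wd (k # j # js) = relator (\<beta>, Proper j) (\<beta>, Proper k) * beta_wd js"
    by (simp add: beta_wd_Cons relator_def br_def sign_one beta_Proper algebra_simps)
      (simp add: mult.assoc[symmetric] wd_append[symmetric])
  also have "\<dots> \<in> env_ker A"
    using assms beta_A Proper_A by (intro env_ker_rmult env_ker_relator beta_wd_fa_on) auto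
  finally show ?thesis .
qed

lemma beta_wd_Cons_env_ker:
  assumes "beta_wd js - beta_wd js' \<in> env_ker A" "j \<in> {1..n}"
  shows "beta_wd (j # js) - beta_wd (j # js') \<in> env_ker A"
  using env_ker_lmult[OF assms(1), of "wd [(\<beta>, Proper j)]"] assms(2) beta_A Proper_A
  by (simp add: beta_wd_Cons right_diff_distrib)

lemma beta_wd_move:
  assumes "j \<in> {1..n}" "set us \<subseteq> {1..n}" "set vs \<subseteq> {1..n}"
  shows "beta_wd (us @ j # vs) - beta_wd (j # us @ vs) \<in> env_ker A"
  using assms(2)
proof (induction us)
  case (Cons u us)
  have "beta_wd (u # us @ j # vs) - beta_wd (u # j # us @ vs) \<in> env_ker A"
    using Cons by (intro beta_wd_Cons_env_ker) auto
  moreover have "beta_wd (u # j # us @ vs) - beta_wd (j # u # us @ vs) \<in> env_ker A"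
    using Cons.prems assms by (intro beta_wd_swap) auto
  ultimately show ?case
    using env_ker_add by fastforce
qed simp

lemma beta_wd_mset:
  assumes "mset js = mset js'" "set js \<subseteq> {1..n}"
  shows "beta_wd js - beta_wd js' \<in> env_ker A"
  using assms
proof (induction js arbitrary: js')
  case (Cons j js)
  have "j \<in> set js'" using Cons.prems(1) by (metis list.set_intros(1) set_mset_mset)
  then obtain us vs where js': "js' = us @ j # vs" by (meson split_list)
  have s: "set js' \<subseteq> {1..n}" using Cons.prems mset_eq_setD by metis
  have "beta_wd (j # js) - beta_wd (j # us @ vs) \<in> env_ker A"
    using Cons.prems js' by (intro beta_wd_Cons_env_ker Cons.IH) auto
  moreover have "beta_wd js' - beta_wd (j # us @ vs) \<in> env_ker A"
    unfolding js' using s js' Cons.prems by (intro beta_wd_move) auto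
  ultimately show ?case using env_ker_diff by fastforce
qed simp

text \<open>By [e_{i,j}, e_{beta,k}] = -\<delta>_{i,k} e_{beta,j}, commuting e_{i,j} through the
  word turns one occurrence of i into j at a time.\<close>

lemma gl_e_beta_wd:
  assumes "i \<in> {1..n}" "j \<in> {1..n}" "set js \<subseteq> {1..n}"
  shows "gl_e i j * beta_wd js - (beta_wd js * gl_e i j - (\<Sum>s<length js. if js ! s = i then beta_wd (js[s := j]) else 0)) \<in> env_ker A"
  using assms(3)
proof (induction js)
  case (Cons k js)
  let ?b = "wd [(\<beta>, Proper k)]" and ?S = "\<Sum>s<length js. if js ! s = i then beta_wd (js[s := j]) else 0"
  have S: "(\<Sum>s<length (k # js). if (k # js) ! s = i then beta_wd ((k # js)[s := j]) else 0)
    = (if k = i then beta_wd (j # js) else 0) + ?b * ?S"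
    unfolding length_Cons sum.lessThan_Suc_shift
    by (auto simp: sum_distrib_left beta_wd_Cons intro!: sum.cong)
  have "gl_e i j * beta_wd (k # js) - (beta_wd (k # js) * gl_e i j - ((if k = i then beta_wd (j # js) else 0) + ?b * ?S))
    = ?b * (gl_e i j * beta_wd js - (beta_wd js * gl_e i j - ?S)) + relator (Proper i, Proper j) (\<beta>, Proper k) * beta_wd js"
    by (simp add: beta_wd_Cons relator_def br_def sign_one beta_Proper algebra_simps gl_e_def)
      (simp add: mult.assoc[symmetric] wd_append[symmetric])
  also have "\<dots> \<in> env_ker A"
    using Cons assms(1,2) beta_A Proper_A by (intro env_ker_add env_ker_lmult env_ker_rmult env_ker_relator beta_wd_fa_on) auto
  finally show ?case unfolding S .
qed (simp add: beta_wd_def wd_Nil)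

text \<open>By [e_{beta,beta}, e_{beta,k}] = e_{beta,k}, the element e_{beta,beta} counts the
  factors of the word.\<close>

lemma beta_beta_wd:
  assumes "set js \<subseteq> {1..n}"
  shows "wd [(\<beta>, \<beta>)] * beta_wd js - (beta_wd js * wd [(\<beta>, \<beta>)] + of_nat (length js) * beta_wd js) \<in> env_ker A"
  using assms
proof (induction js)
  case (Cons k js)
  let ?b = "wd [(\<beta>, Proper k)]"
  have c: "of_nat m * ?b = ?b * of_nat m" for m by (metis mult_of_nat_commute)
  have "wd [(\<beta>, \<beta>)] * beta_wd (k # js) - (beta_wd (k # js) * wd [(\<beta>, \<beta>)] + of_nat (length (k # js)) * beta_wd (k # js))
    = ?b * (wd [(\<beta>, \<beta>)] * beta_wd js - (beta_wd js * wd [(\<beta>, \<beta>)] + of_nat (length js) * beta_wd js))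
      + relator (\<beta>, \<beta>) (\<beta>, Proper k) * beta_wd js"
    by (simp add: beta_wd_Cons relator_def br_def sign_one beta_Proper algebra_simps)
      (simp add: mult.assoc[symmetric] wd_append[symmetric] c)
  also have "\<dots> \<in> env_ker A"
    using Cons beta_A Proper_A by (intro env_ker_add env_ker_lmult env_ker_rmult env_ker_relator beta_wd_fa_on) auto
  finally show ?case .
qed (simp add: beta_wd_def wd_Nil)

text \<open>Moving \<open>e_{i,j}\<close> to the right end produces \<open>t\<close> unit shifts for the later letters and \<open>e_{\<beta>,\<beta>}\<close> the
  rest; together they add up to \<open>|js| - 1\<close> whatever the position.\<close>

lemma annihilate:
  assumes "i \<in> {1..n}" "set js \<subseteq> {1..n}"
  shows "wd [(Proper i, \<beta>)] * beta_wd js - (\<Sum>t<length js. beta_wd (remove_nth t js) *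
     (gl_e i (js ! t) - (if i = js ! t then of_nat (length js - 1) else 0))) \<in> irr"
  using assms(2)
proof (induction js)
  case Nil
  \<comment> \<open>With nothing to its right, the factor consumes beta before any beta is created.
    The same reason puts e_{beta,beta} into \<open>irr\<close> further on.\<close>
  have "wd [(Proper i, \<beta>)] \<in> irr"
    using irregularI[of "(Proper i, \<beta>)" \<beta> "[]" "[]"] virtual_beta beta_A Proper_A assms(1)
    by (intro irr_elts_irregular) (auto simp: A_def)
  then show ?case by (simp add: beta_wd_def wd_Nil)
next
  case (Cons j js)
  have j: "j \<in> {1..n}" and js: "set js \<subseteq> {1..n}" using Cons.prems by auto
  let ?b = "wd [(\<beta>, Proper j)]" and ?d = "wd [(\<beta>, \<beta>)]" and ?x = "wd [(Proper i, \<beta>)]"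
  let ?m = "length js"
  let ?c = "\<lambda>t. gl_e i (js ! t) - (if i = js ! t then of_nat (?m - 1) else 0)"
  let ?IH = "?x * beta_wd js - (\<Sum>t<?m. beta_wd (remove_nth t js) * ?c t)"
  let ?EB = "gl_e i j * beta_wd js - (beta_wd js * gl_e i j - (\<Sum>s<?m. if js ! s = i then beta_wd (js[s := j]) else 0))"
  let ?dB = "?d * beta_wd js - (beta_wd js * ?d + of_nat ?m * beta_wd js)"
  let ?R = "\<Sum>s<?m. if js ! s = i then beta_wd (j # remove_nth s js) - beta_wd (js[s := j]) else 0"
  \<comment> \<open>Lengthening the list by one raises every diagonal shift by one; the last sum
    collects this surplus for the old positions.\<close>
  have shift: "(\<Sum>t<length (j # js). beta_wd (remove_nth t (j # js)) *
     (gl_e i ((j # js) ! t) - (if i = (j # js) ! t then of_nat (length (j # js) - 1) else 0)))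
    = beta_wd js * (gl_e i j - (if i = j then of_nat ?m else 0))
      + ?b * (\<Sum>t<?m. beta_wd (remove_nth t js) * ?c t)
      - (\<Sum>s<?m. if js ! s = i then beta_wd (j # remove_nth s js) else 0)"
  proof -
    have "?b * (\<Sum>t<?m. beta_wd (remove_nth t js) * ?c t)
      - (\<Sum>s<?m. if js ! s = i then beta_wd (j # remove_nth s js) else 0)
      = (\<Sum>t<?m. beta_wd (j # remove_nth t js) * (gl_e i (js ! t) - (if i = js ! t then of_nat ?m else 0)))"
      unfolding sum_distrib_left sum_subtractf[symmetric]
    proof (intro sum.cong refl)
      fix t assume "t \<in> {..<?m}"
      then have m: "(of_nat ?m :: unit_symbol fa) = of_nat (?m - 1) + 1" by (cases ?m) auto
      show "?b * (beta_wd (remove_nth t js) * ?c t) - (if js ! t = i then beta_wd (j # remove_nth t js) else 0)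
        = beta_wd (j # remove_nth t js) * (gl_e i (js ! t) - (if i = js ! t then of_nat ?m else 0))"
        unfolding m by (auto simp: beta_wd_Cons algebra_simps)
    qed
    then show ?thesis
      unfolding length_Cons sum.lessThan_Suc_shift diff_Suc_1 by (simp add: add_diff_eq[symmetric])
  qed
  have "?x * beta_wd (j # js) - (\<Sum>t<length (j # js). beta_wd (remove_nth t (j # js)) *
     (gl_e i ((j # js) ! t) - (if i = (j # js) ! t then of_nat (length (j # js) - 1) else 0)))
    = ?b * ?IH + ?EB - (if i = j then ?dB + beta_wd js * ?d else 0) + ?R
      + relator (Proper i, \<beta>) (\<beta>, Proper j) * beta_wd js"
    unfolding shift
  proof -
    have R: "?R = (\<Sum>s<?m. if js ! s = i then beta_wd (j # remove_nth s js) else 0)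
       - (\<Sum>s<?m. if js ! s = i then beta_wd (js[s := j]) else 0)"
      unfolding sum_subtractf[symmetric] by (intro sum.cong) auto
    \<comment> \<open>The bracket [e_{i,beta}, e_{beta,j}] = e_{i,j} - \<delta>_{i,j}
      e_{beta,beta}.\<close>
    have e: "relator (Proper i, \<beta>) (\<beta>, Proper j) = ?x * ?b - ?b * ?x - gl_e i j + (if i = j then ?d else 0)"
      by (auto simp: relator_def br_def sign_one gl_e_def wd_append[symmetric])
    have c: "of_nat ?m * beta_wd js = beta_wd js * of_nat ?m" by (metis mult_of_nat_commute)
    show "?x * beta_wd (j # js) - (beta_wd js * (gl_e i j - (if i = j then of_nat ?m else 0))
      + ?b * (\<Sum>t<?m. beta_wd (remove_nth t js) * ?c t)
      - (\<Sum>s<?m. if js ! s = i then beta_wd (j # remove_nth s js) else 0))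
      = ?b * ?IH + ?EB - (if i = j then ?dB + beta_wd js * ?d else 0) + ?R
      + relator (Proper i, \<beta>) (\<beta>, Proper j) * beta_wd js"
      unfolding R e c
      by (cases "i = j") (simp_all add: beta_wd_Cons ring_distribs mult.assoc)
  qed
  also have "\<dots> \<in> irr"
  proof (rule irr_elts_add[OF irr_elts_add[OF irr_elts_diff[OF irr_elts_add]]])
    have fA: "?b \<in> fa_on (A \<times> A)" "?d \<in> fa_on (A \<times> A)" "beta_wd js \<in> fa_on (A \<times> A)"
      using beta_A Proper_A j beta_wd_fa_on[OF js] by auto
    show "?b * ?IH \<in> irr"
      using Cons.IH[OF js] fA(1) unfolding A_def by (rule irr_elts_lmult)
    show "?EB \<in> irr"
      using gl_e_beta_wd[OF assms(1) j js] unfolding A_def by (rule irr_elts_env_ker)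
    have "?dB \<in> irr" using beta_beta_wd[OF js] unfolding A_def by (rule irr_elts_env_ker)
    moreover have "?d \<in> irr"
      using irregularI[of "(\<beta>, \<beta>)" \<beta> "[]" "[]"] virtual_beta beta_A
      by (intro irr_elts_irregular) (auto simp: A_def)
    then have "beta_wd js * ?d \<in> irr"
      using fA(3) unfolding A_def by (rule irr_elts_lmult)
    ultimately have s: "?dB + beta_wd js * ?d \<in> irr" by (rule irr_elts_add)
    show "(if i = j then ?dB + beta_wd js * ?d else 0) \<in> irr"
    proof (cases "i = j")
      case True
      show ?thesis unfolding if_P[OF True] by (rule s)
    next
      case False
      show ?thesis unfolding if_not_P[OF False] by (rule irr_elts_zero)
    qed
    \<comment> \<open>Putting j into slot s or in front of the other letters gives the same
      multiset, and the e_{beta,k} commute: the surplus of \<open>shift\<close> cancels the terms of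
      the commutator.\<close>
    have "beta_wd (j # remove_nth s js) - beta_wd (js[s := j]) \<in> env_ker A" if "s < ?m" for s
    proof (rule beta_wd_mset)
      show "mset (j # remove_nth s js) = mset (js[s := j])"
        using mset_remove_nth[OF that, symmetric] that by (simp add: mset_update)
      show "set (j # remove_nth s js) \<subseteq> {1..n}" using j js set_remove_nth[of s js] by auto
    qed
    then show "?R \<in> irr"
      by (intro irr_elts_sum) (auto simp: irr_elts_zero A_def intro: irr_elts_env_ker)
    have "relator (Proper i, \<beta>) (\<beta>, Proper j) * beta_wd js \<in> env_ker A"
      using assms(1) j beta_A Proper_A fA by (intro env_ker_rmult env_ker_relator) auto
    then show "relator (Proper i, \<beta>) (\<beta>, Proper j) * beta_wd js \<in> irr"
      unfolding A_def by (rule irr_elts_env_ker)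
  qed
  finally show ?case .
qed

text \<open>The head of the first list is the innermost of the e_{i,beta} and is absorbed first. The
  factors from gl(n) this produces stand on the far right, where multiplication by them preserves
  \<open>irr\<close>.\<close>

lemma virtual_word:
  assumes "set is \<subseteq> {1..n}" "set js \<subseteq> {1..n}" "length is = length js"
  shows "wd (map (\<lambda>i. (Proper i, \<beta>)) (rev is)) * beta_wd js - virt_img is js \<in> irr"
  using assms
proof (induction "is" arbitrary: js)
  case Nil
  then show ?case by (simp add: beta_wd_def wd_Nil irr_elts_zero)
next
  case (Cons i "is")
  let ?W = "wd (map (\<lambda>i. (Proper i, \<beta>)) (rev is))" and ?x = "wd [(Proper i, \<beta>)]"
  let ?c = "\<lambda>t. gl_e i (js ! t) - (if i = js ! t then of_nat (length js - 1) else 0)"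
  have j: "js ! t \<in> {1..n}" if "t < length js" for t
    using that Cons.prems(2) nth_mem by blast
  have "wd (map (\<lambda>i. (Proper i, \<beta>)) (rev (i # is))) * beta_wd js - virt_img (i # is) js
    = ?W * (?x * beta_wd js - (\<Sum>t<length js. beta_wd (remove_nth t js) * ?c t))
      + (\<Sum>t<length js. (?W * beta_wd (remove_nth t js) - virt_img is (remove_nth t js)) * ?c t)"
    by (simp add: wd_append left_diff_distrib sum_subtractf right_diff_distrib sum_distrib_left mult.assoc)
  also have "\<dots> \<in> irr"
  proof (rule irr_elts_add[OF irr_elts_lmult irr_elts_sum[OF irr_elts_rmult]])
    show "?x * beta_wd js - (\<Sum>t<length js. beta_wd (remove_nth t js) * ?c t) \<in> irr"
      using Cons.prems by (intro annihilate) auto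
    show "?W \<in> fa_on (all_symbols m0 m1 n \<times> all_symbols m0 m1 n)"
      using Cons.prems beta_A Proper_A by (auto simp: A_def)
    fix t assume t: "t \<in> {..<length js}"
    show "?W * beta_wd (remove_nth t js) - virt_img is (remove_nth t js) \<in> irr"
      using Cons.prems t length_remove_nth[of t js] set_remove_nth[of t js] by (intro Cons.IH) auto
    show "?c t \<in> fa_on (gl_basis n)"
      using Cons.prems t j by (auto intro!: fa_on_diff gl_e_fa_on)
  qed
  finally show ?case .
qed

text \<open>Both halves of \<open>I_word\<close> come from a single sorted list, read backwards in
  the left half.\<close>

lemma virt_proj_I_word:
  "virt_proj m0 m1 n (e_prod A (I_word n \<beta> h))
    = coset (proper_symbols n) (virt_img (concat (map (\<lambda>i. replicate (h i) i) [1..<n + 1]))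
        (concat (map (\<lambda>i. replicate (h i) i) [1..<n + 1])))"
proof -
  let ?l = "concat (map (\<lambda>i. replicate (h i) i) [1..<n + 1])"
  have l: "set ?l \<subseteq> {1..n}" by auto
  have I: "I_word n \<beta> h = map (\<lambda>i. (Proper i, \<beta>)) (rev ?l) @ map (\<lambda>j. (\<beta>, Proper j)) ?l"
    by (simp add: I_word_def rev_concat map_concat comp_def rev_map[symmetric] del: upt_Suc)
  have s: "set (I_word n \<beta> h) \<subseteq> A \<times> A"
    unfolding I using l beta_A Proper_A by auto
  have "wd (I_word n \<beta> h) = wd (map (\<lambda>i. (Proper i, \<beta>)) (rev ?l)) * beta_wd ?l"
    unfolding I by (simp add: wd_append beta_wd_def)
  with virtual_word[OF l l refl] have "wd (I_word n \<beta> h) - virt_img ?l ?l \<in> irr" by simp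
  with s virt_img_fa_on[OF l l] show ?thesis
    unfolding e_prod_coset[OF s] unfolding A_def by (intro virt_proj_eq) auto
qed

end

section \<open>Capelli elements are central\<close>

lemma upt_plus_one: "[1..<Suc k + 1] = [1..<k + 1] @ [Suc k]"
  by simp

text \<open>An ordered product indexed by positions, so that changing one factor is a function
  update.\<close>

definition seq_prod :: "nat \<Rightarrow> (nat \<Rightarrow> 'r::monoid_mult) \<Rightarrow> 'r" where
  "seq_prod k F = prod_list (map F [1..<k + 1])"

lemma seq_prod_0 [simp]: "seq_prod 0 F = 1"
  by (simp add: seq_prod_def)

lemma seq_prod_Suc: "seq_prod (Suc k) F = seq_prod k F * F (Suc k)"
  unfolding seq_prod_def upt_plus_one by simp

lemma seq_prod_cong: "(\<And>j. j \<in> {1..k} \<Longrightarrow> F j = G j) \<Longrightarrow> seq_prod k F = seq_prod k G"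
  unfolding seq_prod_def by (rule arg_cong[of _ _ prod_list], rule map_cong) auto

lemma seq_prod_upd_out: "j > k \<Longrightarrow> seq_prod k (F(j := z)) = seq_prod k F"
  by (rule seq_prod_cong) auto

lemma seq_prod_diff:
  fixes F :: "nat \<Rightarrow> 'r::ring_1"
  assumes "j \<in> {1..k}"
  shows "seq_prod k (F(j := u - v)) = seq_prod k (F(j := u)) - seq_prod k (F(j := v))"
  using assms
proof (induction k)
  case (Suc k)
  show ?case
  proof (cases "j = Suc k")
    case True
    show ?thesis
      by (simp only: seq_prod_Suc True seq_prod_upd_out[OF lessI] fun_upd_same right_diff_distrib)
  next
    case False
    with Suc show ?thesis by (simp add: seq_prod_Suc left_diff_distrib)
  qed
qed simp

lemma seq_prod_zero:
  fixes F :: "nat \<Rightarrow> 'r::ring_1"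
  assumes "j \<in> {1..k}" "F j = 0"
  shows "seq_prod k F = 0"
  using assms by (induction k) (auto simp: seq_prod_Suc le_Suc_eq)

text \<open>The Leibniz rule for the inner derivation given by y.\<close>

lemma seq_prod_commutator:
  fixes F :: "nat \<Rightarrow> 'r::ring_1"
  shows "y * seq_prod k F - seq_prod k F * y = (\<Sum>j=1..k. seq_prod k (F(j := y * F j - F j * y)))"
proof (induction k)
  case (Suc k)
  have "y * seq_prod (Suc k) F - seq_prod (Suc k) F * y
      = (y * seq_prod k F - seq_prod k F * y) * F (Suc k) + seq_prod k F * (y * F (Suc k) - F (Suc k) * y)"
    by (simp add: seq_prod_Suc algebra_simps)
  also have "\<dots> = (\<Sum>j=1..k. seq_prod (Suc k) (F(j := y * F j - F j * y)))
      + seq_prod (Suc k) (F(Suc k := y * F (Suc k) - F (Suc k) * y))"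
    unfolding Suc by (simp add: seq_prod_Suc sum_distrib_right seq_prod_upd_out)
  finally show ?case unfolding sum.cl_ivl_Suc by simp
qed simp

lemma seq_prod_split:
  assumes "1 \<le> m" "Suc m \<le> k"
  shows "seq_prod k F = prod_list (map F [1..<m]) * (F m * F (Suc m)) * prod_list (map F [Suc (Suc m)..<k + 1])"
proof -
  have "[1..<k + 1] = [1..<m] @ [m, Suc m] @ [Suc (Suc m)..<k + 1]"
    using assms upt_add_eq_append[of 1 m "k + 1 - m"] by (simp add: upt_rec[of m] upt_rec[of "Suc m"])
  then show ?thesis by (simp add: seq_prod_def mult.assoc)
qed

text \<open>Centrality uses only the commutation relations. In the operator algebra these are
  equations, so the computation is done there and carried back by faithfulness.\<close>

locale gl_units =
  fixes E :: "nat \<Rightarrow> nat \<Rightarrow> 'r::complex_algebra"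
  assumes comm: "E i j * E k l - E k l * E i j = (if j = k then E i l else 0) - (if l = i then E k j else 0)"
begin

definition shifted :: "nat \<Rightarrow> nat \<Rightarrow> 'r \<Rightarrow> 'r" where
  "shifted p q c = E p q + (if p = q then c else 0)"

text \<open>Rows and columns are arbitrary index functions, repetitions allowed, because the sum
  over all index functions is the expression whose centrality is visible. The diagonal shift belongs
  to equal indices, not to equal positions.\<close>

definition coldet :: "nat \<Rightarrow> (nat \<Rightarrow> nat) \<Rightarrow> (nat \<Rightarrow> nat) \<Rightarrow> 'r" where
  "coldet k I J = (\<Sum>\<sigma> | \<sigma> permutes {1..k}. of_int (sign \<sigma>) *
     seq_prod k (\<lambda>j. shifted (I (\<sigma> j)) (J j) (of_nat (k - j))))"

lemma shifted_comm:
  assumes "\<And>y. y * c = c * y"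
  shows "E a b * shifted p q c - shifted p q c * E a b
    = (if b = p then shifted a q c else 0) - (if a = q then shifted p b c else 0)"
  using comm[of a b p q] assms[of "E a b"] by (auto simp: shifted_def algebra_simps)

text \<open>Commuting with E a b turns a row index b into a, or a column index a into b with the
  opposite sign. Summed over all index functions the two effects cancel position by position, for
  each \<sigma> separately.\<close>

lemma seq_prod_shifted_commutator:
  assumes "\<sigma> permutes {1..k}" "a \<in> {1..n}" "b \<in> {1..n}"
  defines "G \<equiv> \<lambda>I J. seq_prod k (\<lambda>j. shifted (I (\<sigma> j)) (J j) (of_nat (k - j)))"
  shows "(\<Sum>I\<in>{1..k} \<rightarrow>\<^sub>E {1..n}. E a b * G I I - G I I * E a b) = 0"
proof -
  let ?S = "{1..k} \<rightarrow>\<^sub>E {1..n}"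
  have fin: "finite ?S" by (rule finite_PiE) auto
  have one: "E a b * G I I - G I I * E a b
    = (\<Sum>m=1..k. if I m = b then G (I(m := a)) I else 0) - (\<Sum>m=1..k. if I m = a then G I (I(m := b)) else 0)" for I
  proof -
    let ?F = "\<lambda>j. shifted (I (\<sigma> j)) (I j) (of_nat (k - j))"
    have "E a b * G I I - G I I * E a b = (\<Sum>j=1..k. seq_prod k (?F(j := E a b * ?F j - ?F j * E a b)))"
      unfolding G_def by (rule seq_prod_commutator)
    also have "\<dots> = (\<Sum>j=1..k. (if I (\<sigma> j) = b then G (I(\<sigma> j := a)) I else 0)
        - (if I j = a then G I (I(j := b)) else 0))"
    proof (rule sum.cong)
      fix j assume j: "j \<in> {1..k}"
      have inj: "\<sigma> j' = \<sigma> j \<longleftrightarrow> j' = j" for j'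
        using permutes_inj[OF assms(1)] by (auto simp: inj_def)
      have 1: "seq_prod k (?F(j := if b = I (\<sigma> j) then shifted a (I j) (of_nat (k - j)) else 0))
        = (if I (\<sigma> j) = b then G (I(\<sigma> j := a)) I else 0)"
      proof (cases "b = I (\<sigma> j)")
        case True
        then show ?thesis unfolding G_def by (auto intro!: seq_prod_cong simp: inj)
      next
        case False
        have "seq_prod k (?F(j := 0)) = 0" by (rule seq_prod_zero[OF j]) simp
        with False show ?thesis by auto
      qed
      have 2: "seq_prod k (?F(j := if a = I j then shifted (I (\<sigma> j)) b (of_nat (k - j)) else 0))
        = (if I j = a then G I (I(j := b)) else 0)"
      proof (cases "a = I j")
        case True
        then show ?thesis unfolding G_def by (auto intro!: seq_prod_cong)
      next
        case False
        have "seq_prod k (?F(j := 0)) = 0" by (rule seq_prod_zero[OF j]) simp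
        with False show ?thesis by auto
      qed
      show "seq_prod k (?F(j := E a b * ?F j - ?F j * E a b))
        = (if I (\<sigma> j) = b then G (I(\<sigma> j := a)) I else 0) - (if I j = a then G I (I(j := b)) else 0)"
        by (subst shifted_comm) (simp_all only: seq_prod_diff[OF j] 1 2 mult_of_nat_commute)
    qed simp
    also have "\<dots> = (\<Sum>j=1..k. if I (\<sigma> j) = b then G (I(\<sigma> j := a)) I else 0)
        - (\<Sum>j=1..k. if I j = a then G I (I(j := b)) else 0)"
      by (rule sum_subtractf)
    also have "(\<Sum>j=1..k. if I (\<sigma> j) = b then G (I(\<sigma> j := a)) I else 0)
      = (\<Sum>m=1..k. if I m = b then G (I(m := a)) I else 0)"
      by (rule sum.reindex_bij_betw[OF permutes_imp_bij[OF assms(1)]])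
    finally show ?thesis .
  qed
  \<comment> \<open>Renaming the value at position m from b to a matches the pairs with row index a
    and column index b at that position on both sides.\<close>
  have two: "(\<Sum>I\<in>?S. if I m = b then G (I(m := a)) I else 0)
      = (\<Sum>I\<in>?S. if I m = a then G I (I(m := b)) else 0)" if m: "m \<in> {1..k}" for m
  proof -
    have "(\<Sum>I\<in>?S. if I m = b then G (I(m := a)) I else 0) = (\<Sum>I | I \<in> ?S \<and> I m = b. G (I(m := a)) I)"
      using fin by (simp add: sum.If_cases Int_def)
    also have "\<dots> = (\<Sum>I | I \<in> ?S \<and> I m = a. G I (I(m := b)))"
      by (rule sum.reindex_bij_witness[of _ "\<lambda>I. I(m := b)" "\<lambda>I. I(m := a)"])
        (use m assms(2,3) in \<open>auto simp: PiE_iff extensional_def\<close>)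
    also have "\<dots> = (\<Sum>I\<in>?S. if I m = a then G I (I(m := b)) else 0)"
      using fin by (simp add: sum.If_cases Int_def)
    finally show ?thesis .
  qed
  have "(\<Sum>I\<in>?S. E a b * G I I - G I I * E a b)
    = (\<Sum>m=1..k. (\<Sum>I\<in>?S. if I m = b then G (I(m := a)) I else 0))
      - (\<Sum>m=1..k. (\<Sum>I\<in>?S. if I m = a then G I (I(m := b)) else 0))"
    unfolding one sum_subtractf by (subst (1 2) sum.swap) simp
  also have "\<dots> = 0" using two by simp
  finally show ?thesis .
qed

lemma sum_coldet_central:
  fixes a b k n :: nat
  assumes "a \<in> {1..n}" "b \<in> {1..n}"
  defines "C \<equiv> (\<Sum>I\<in>{1..k} \<rightarrow>\<^sub>E {1..n}. coldet k I I)"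
  shows "E a b * C = C * E a b"
proof -
  have s: "y * (of_int s * z) = of_int s * (y * z)" for y z :: 'r and s
    by (metis mult.assoc mult_of_int_commute)
  have "E a b * C - C * E a b = (\<Sum>\<sigma> | \<sigma> permutes {1..k}. of_int (sign \<sigma>) *
    (\<Sum>I\<in>{1..k} \<rightarrow>\<^sub>E {1..n}. E a b * seq_prod k (\<lambda>j. shifted (I (\<sigma> j)) (I j) (of_nat (k - j)))
       - seq_prod k (\<lambda>j. shifted (I (\<sigma> j)) (I j) (of_nat (k - j))) * E a b))"
    unfolding C_def coldet_def sum_distrib_left sum_distrib_right sum_subtractf right_diff_distrib
    by (subst (1 2) sum.swap) (simp add: s mult.assoc)
  also have "\<dots> = 0"
    using seq_prod_shifted_commutator[OF _ assms(1,2)] by (intro sum.neutral) auto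
  finally show ?thesis by simp
qed

text \<open>The order of the factors follows the columns, so a permutation of the rows merely
  reindexes the sum over \<sigma>.\<close>

lemma coldet_row:
  assumes "\<tau> permutes {1..k}"
  shows "coldet k (I \<circ> \<tau>) J = of_int (sign \<tau>) * coldet k I J"
proof -
  let ?f = "\<lambda>\<sigma>. of_int (sign \<tau>) * (of_int (sign \<sigma>) * seq_prod k (\<lambda>j. shifted (I (\<sigma> j)) (J j) (of_nat (k - j))))"
  have "of_int (sign \<tau>) * coldet k I J = sum ?f {\<sigma>. \<sigma> permutes {1..k}}"
    by (simp add: coldet_def sum_distrib_left)
  also have "\<dots> = (\<Sum>\<sigma> | \<sigma> permutes {1..k}. ?f (\<tau> \<circ> \<sigma>))"
    by (rule setum_permutations_compose_left[OF assms])
  also have "\<dots> = coldet k (I \<circ> \<tau>) J"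
    unfolding coldet_def
  proof (rule sum.cong)
    fix \<sigma> assume "\<sigma> \<in> {\<sigma>. \<sigma> permutes {1..k}}"
    then have "sign (\<tau> \<circ> \<sigma>) = sign \<tau> * sign \<sigma>"
      using assms by (intro sign_compose) (auto intro: permutes_imp_permutation[of "{1..k}"])
    then show "?f (\<tau> \<circ> \<sigma>) = of_int (sign \<sigma>) * seq_prod k (\<lambda>j. shifted ((I \<circ> \<tau>) (\<sigma> j)) (J j) (of_nat (k - j)))"
      by (simp add: mult.assoc[symmetric] of_int_mult[symmetric] del: of_int_mult)
  qed simp
  finally show ?thesis ..
qed

lemma half: "x + x = 0 \<Longrightarrow> x = (0::'r)"
proof -
  assume x: "x + x = 0"
  have "x = (1/2 + 1/2) *\<^sub>C x" by simp
  also have "\<dots> = (1/2) *\<^sub>C (x + x)" by (simp only: scaleC_add_left scaleC_add_right)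
  finally show "x = 0" by (simp add: x)
qed

lemma coldet_repeated:
  assumes "a \<in> {1..k}" "b \<in> {1..k}" "a \<noteq> b" "I a = I b"
  shows "coldet k I J = 0"
proof -
  have "I \<circ> transpose a b = I"
    using assms(4) by (auto simp: fun_eq_iff transpose_def)
  moreover have "coldet k (I \<circ> transpose a b) J = - coldet k I J"
    using coldet_row[OF permutes_swap_id[OF assms(1,2)], of I J] assms(3) by (simp add: sign_swap_id)
  ultimately have "coldet k I J + coldet k I J = 0" by (metis ab_left_minus)
  then show ?thesis by (rule half)
qed

text \<open>The drop of the shift by one between neighbouring columns compensates the commutators: this makes
  a determinant that is alternating in its rows also alternating in its columns.\<close>

lemma shifted_exchange:
  "shifted p q (of_nat u + 1) * shifted p' q' (of_nat u) + shifted p q' (of_nat u + 1) * shifted p' q (of_nat u)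
     = shifted p' q (of_nat u + 1) * shifted p q' (of_nat u) + shifted p' q' (of_nat u + 1) * shifted p q (of_nat u)"
proof -
  define d :: "nat \<Rightarrow> nat \<Rightarrow> complex" where "d i j = (if i = j then 1 else 0)" for i j
  define U :: complex where "U = of_nat u"
  have X1: "shifted i j (of_nat u) = E i j + (d i j * U) *\<^sub>C 1" for i j
    by (simp add: shifted_def d_def U_def scaleC_of_nat)
  have X2: "shifted i j (of_nat u + 1) = E i j + (d i j * U + d i j) *\<^sub>C 1" for i j
    by (simp add: shifted_def d_def U_def scaleC_of_nat scaleC_add_left)
  have ex: "(A + s *\<^sub>C 1) * (A' + t *\<^sub>C 1) = A * A' + t *\<^sub>C A + s *\<^sub>C A' + (s * t) *\<^sub>C 1" for A A' :: 'r and s t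
    by (simp add: distrib_left distrib_right scaleC_add_right mult.commute)
  have "E p q * E p' q' - E p' q' * E p q = d q p' *\<^sub>C E p q' - d q' p *\<^sub>C E p' q"
    "E p q' * E p' q - E p' q * E p q' = d q' p' *\<^sub>C E p q - d q p *\<^sub>C E p' q'"
    using comm by (auto simp: d_def)
  then have f: "E p q * E p' q' + d q' p *\<^sub>C E p' q = E p' q' * E p q + d q p' *\<^sub>C E p q'"
    "E p q' * E p' q + d q p *\<^sub>C E p' q' = E p' q * E p q' + d q' p' *\<^sub>C E p q"
    by (simp_all add: algebra_simps)
  have "(E p q * E p' q' + d q' p *\<^sub>C E p' q) + (E p q' * E p' q + d q p *\<^sub>C E p' q')
      = (E p' q' * E p q + d q p' *\<^sub>C E p q') + (E p' q * E p q' + d q' p' *\<^sub>C E p q)"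
    by (simp only: f)
  moreover have "d q p' = d p' q" "d q' p = d p q'" "d q' p' = d p' q'" "d q p = d p q"
    by (auto simp: d_def)
  ultimately show ?thesis
    unfolding X1 X2 ex by (simp add: scaleC_add_left algebra_simps)
qed

text \<open>Columns must be neighbours: the two factors concerned then stand side by side with
  shifts differing by one, and \<open>shifted_exchange\<close> applies between common outer
  factors.\<close>

lemma coldet_col_swap:
  assumes "1 \<le> m" "Suc m \<le> k"
  shows "coldet k I (J \<circ> transpose m (Suc m)) = - coldet k I J"
proof -
  let ?s = "transpose m (Suc m)"
  have s: "?s permutes {1..k}" using assms by (intro permutes_swap_id) auto
  let ?t = "\<lambda>\<sigma> J. of_int (sign \<sigma>) * seq_prod k (\<lambda>j. shifted (I (\<sigma> j)) (J j) (of_nat (k - j)))"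
  \<comment> \<open>Doubling the sum allows each \<sigma> to be grouped with its composite with the
    transposition, four terms at a time.\<close>
  have D2: "coldet k I J = (\<Sum>\<sigma> | \<sigma> permutes {1..k}. ?t (\<sigma> \<circ> ?s) J)" for J
    unfolding coldet_def by (rule sum_permutations_compose_right[OF s])
  have "coldet k I J + coldet k I (J \<circ> ?s) + (coldet k I J + coldet k I (J \<circ> ?s))
    = (\<Sum>\<sigma> | \<sigma> permutes {1..k}. ?t \<sigma> J + ?t \<sigma> (J \<circ> ?s)) +
      (\<Sum>\<sigma> | \<sigma> permutes {1..k}. ?t (\<sigma> \<circ> ?s) J + ?t (\<sigma> \<circ> ?s) (J \<circ> ?s))"
    unfolding sum.distrib D2[symmetric] by (simp add: coldet_def)
  also have "\<dots> = (\<Sum>\<sigma> | \<sigma> permutes {1..k}. ?t \<sigma> J + ?t \<sigma> (J \<circ> ?s) + (?t (\<sigma> \<circ> ?s) J + ?t (\<sigma> \<circ> ?s) (J \<circ> ?s)))"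
    by (rule sum.distrib[symmetric])
  also have "\<dots> = 0"
  proof (rule sum.neutral, rule ballI)
    fix \<sigma> assume "\<sigma> \<in> {\<sigma>. \<sigma> permutes {1..k}}"
    then have sg: "sign (\<sigma> \<circ> ?s) = - sign \<sigma>"
      by (subst sign_compose) (auto simp: sign_swap_id permutation_swap_id intro: permutes_imp_permutation[of "{1..k}"])
    let ?F = "\<lambda>j. shifted (I (\<sigma> j)) (J j) (of_nat (k - j))"
    define L R where "L = prod_list (map ?F [1..<m])" and "R = prod_list (map ?F [Suc (Suc m)..<k + 1])"
    define c :: 'r where "c = of_nat (k - Suc m)"
    have "k - m = Suc (k - Suc m)" using assms(2) by simp
    then have km: "of_nat (k - m) = c + 1" by (simp add: c_def add.commute)
    have tr: "?s j = j" if "j \<noteq> m" "j \<noteq> Suc m" for j using that by (simp add: transpose_def)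
    have LR: "map (\<lambda>j. shifted (I (\<sigma>' j)) (J' j) (of_nat (k - j))) [1..<m] = map ?F [1..<m]"
      "map (\<lambda>j. shifted (I (\<sigma>' j)) (J' j) (of_nat (k - j))) [Suc (Suc m)..<k + 1] = map ?F [Suc (Suc m)..<k + 1]"
      if "\<sigma>' \<in> {\<sigma>, \<sigma> \<circ> ?s}" "J' \<in> {J, J \<circ> ?s}" for \<sigma>' J'
      using that by (auto simp: tr intro!: map_cong)
    have p: "seq_prod k (\<lambda>j. shifted (I (\<sigma>' j)) (J' j) (of_nat (k - j)))
      = L * (shifted (I (\<sigma>' m)) (J' m) (c + 1) * shifted (I (\<sigma>' (Suc m))) (J' (Suc m)) c) * R"
      if "\<sigma>' \<in> {\<sigma>, \<sigma> \<circ> ?s}" "J' \<in> {J, J \<circ> ?s}" for \<sigma>' J'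
      unfolding seq_prod_split[OF assms] LR[OF that] L_def[symmetric] R_def[symmetric] km c_def[symmetric] ..
    let ?p = "I (\<sigma> m)" and ?p' = "I (\<sigma> (Suc m))" and ?q = "J m" and ?q' = "J (Suc m)"
    have "?t \<sigma> J + ?t \<sigma> (J \<circ> ?s) + (?t (\<sigma> \<circ> ?s) J + ?t (\<sigma> \<circ> ?s) (J \<circ> ?s))
      = of_int (sign \<sigma>) * (L * ((shifted ?p ?q (c + 1) * shifted ?p' ?q' c + shifted ?p ?q' (c + 1) * shifted ?p' ?q c)
         - (shifted ?p' ?q (c + 1) * shifted ?p ?q' c + shifted ?p' ?q' (c + 1) * shifted ?p ?q c)) * R)"
      unfolding sg by (subst (1 2 3 4) p) (simp_all add: algebra_simps)
    also have "\<dots> = 0" unfolding c_def by (subst shifted_exchange) simp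
    finally show "?t \<sigma> J + ?t \<sigma> (J \<circ> ?s) + (?t (\<sigma> \<circ> ?s) J + ?t (\<sigma> \<circ> ?s) (J \<circ> ?s)) = 0" .
  qed
  finally have "coldet k I J + coldet k I (J \<circ> ?s) = 0" by (rule half)
  then show ?thesis by (simp add: eq_neg_iff_add_eq_0 add.commute)
qed

lemma coldet_diag_adjacent:
  assumes "1 \<le> m" "Suc m \<le> k"
  shows "coldet k (I \<circ> transpose m (Suc m)) (I \<circ> transpose m (Suc m)) = coldet k I I"
  using coldet_row[of "transpose m (Suc m)" k I "I \<circ> transpose m (Suc m)"] coldet_col_swap[OF assms, of I I] assms
  by (simp add: permutes_swap_id sign_swap_id)

text \<open>Conjugating by an adjacent transposition shortens the distance; rows and columns are
  permuted together, so the two signs cancel at each step.\<close>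

lemma coldet_diag_transpose:
  assumes "a < b" "1 \<le> a" "b \<le> k"
  shows "coldet k (I \<circ> transpose a b) (I \<circ> transpose a b) = coldet k I I"
  using assms
proof (induction b arbitrary: I)
  case (Suc b)
  show ?case
  proof (cases "a = b")
    case True
    show ?thesis unfolding True by (rule coldet_diag_adjacent) (use Suc.prems True in auto)
  next
    case False
    let ?s = "transpose b (Suc b)"
    have "transpose (Suc b) b \<circ> transpose b a \<circ> transpose (Suc b) b = transpose (Suc b) a"
      using False Suc.prems by (intro transpose_comp_triple) auto
    then have "transpose a (Suc b) = ?s \<circ> transpose a b \<circ> ?s"
      by (simp add: transpose_commute)
    then have e: "I \<circ> transpose a (Suc b) = I \<circ> ?s \<circ> transpose a b \<circ> ?s"
      by (simp only: o_assoc)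
    have "coldet k (I \<circ> ?s \<circ> transpose a b \<circ> ?s) (I \<circ> ?s \<circ> transpose a b \<circ> ?s)
        = coldet k (I \<circ> ?s \<circ> transpose a b) (I \<circ> ?s \<circ> transpose a b)"
      by (rule coldet_diag_adjacent) (use Suc.prems in auto)
    also have "\<dots> = coldet k (I \<circ> ?s) (I \<circ> ?s)"
      by (rule Suc.IH) (use Suc.prems False in auto)
    also have "\<dots> = coldet k I I"
      by (rule coldet_diag_adjacent) (use Suc.prems in auto)
    finally show ?thesis unfolding e .
  qed
qed simp

lemma coldet_diag_perm:
  assumes "\<tau> permutes {1..k}"
  shows "coldet k (I \<circ> \<tau>) (I \<circ> \<tau>) = coldet k I I"
  using assms finite_atLeastAtMost
proof (induction arbitrary: I rule: permutes_induct)
  case (swap a b p)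
  have "coldet k (I \<circ> transpose a b) (I \<circ> transpose a b) = coldet k I I"
  proof (cases "a < b")
    case True
    then show ?thesis using swap coldet_diag_transpose by simp
  next
    case False
    then show ?thesis using swap coldet_diag_transpose[of b a k I] by (simp add: transpose_commute)
  qed
  then show ?case using swap.IH[of "I \<circ> transpose a b"] by (simp only: o_assoc)
qed simp

lemma coldet_cong:
  assumes "\<And>j. j \<in> {1..k} \<Longrightarrow> I j = I' j" "\<And>j. j \<in> {1..k} \<Longrightarrow> J j = J' j"
  shows "coldet k I J = coldet k I' J'"
  unfolding coldet_def
proof (intro sum.cong refl)
  fix \<sigma> assume "\<sigma> \<in> {\<sigma>. \<sigma> permutes {1..k}}"
  then have "\<sigma> j \<in> {1..k}" if "j \<in> {1..k}" for j
    using that permutes_in_image by fastforce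
  with assms have "seq_prod k (\<lambda>j. shifted (I (\<sigma> j)) (J j) (of_nat (k - j))) = seq_prod k (\<lambda>j. shifted (I' (\<sigma> j)) (J' j) (of_nat (k - j)))"
    by (intro seq_prod_cong) auto
  then show "of_int (sign \<sigma>) * seq_prod k (\<lambda>j. shifted (I (\<sigma> j)) (J j) (of_nat (k - j)))
    = of_int (sign \<sigma>) * seq_prod k (\<lambda>j. shifted (I' (\<sigma> j)) (J' j) (of_nat (k - j)))" by simp
qed

end

section \<open>From all index functions to increasing lists\<close>

definition inc_lists :: "nat \<Rightarrow> nat \<Rightarrow> nat list set" where
  "inc_lists k n = {is. length is = k \<and> sorted_wrt (<) is \<and> set is \<subseteq> {1..n}}"

lemma finite_inc_lists: "finite (inc_lists k n)"
proof -
  have "inc_lists k n \<subseteq> {is. set is \<subseteq> {1..n} \<and> length is = k}" by (auto simp: inc_lists_def)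
  then show ?thesis using finite_lists_length_eq[of "{1..n}" k] finite_subset by blast
qed

definition capelli :: "(nat \<Rightarrow> nat \<Rightarrow> 'r) \<Rightarrow> nat \<Rightarrow> nat \<Rightarrow> 'r::complex_algebra" where
  "capelli e n k = (\<Sum>is\<in>inc_lists k n. \<Sum>\<sigma> | \<sigma> permutes {1..k}. of_int (sign \<sigma>) *
     prod_list (map (\<lambda>j. e (is ! (\<sigma> j - 1)) (is ! (j - 1)) + (if \<sigma> j = j then of_nat (k - j) else 0)) [1..<k + 1]))"

context gl_units
begin

text \<open>Along a strictly increasing list equal indices mean equal positions, so both conventions
  for the diagonal shift agree.\<close>

lemma capelli_eq_coldet: "capelli E n k = (\<Sum>is\<in>inc_lists k n. coldet k (\<lambda>a. is ! (a - 1)) (\<lambda>a. is ! (a - 1)))"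
  unfolding capelli_def coldet_def
proof (intro sum.cong refl)
  fix "is" \<sigma> assume i: "is \<in> inc_lists k n" and s: "\<sigma> \<in> {\<sigma>. \<sigma> permutes {1..k}}"
  have d: "distinct is" "length is = k" using i by (auto simp: inc_lists_def strict_sorted_iff)
  have "is ! (\<sigma> j - 1) = is ! (j - 1) \<longleftrightarrow> \<sigma> j = j" if j: "j \<in> {1..k}" for j
  proof -
    have "\<sigma> j \<in> {1..k}" using s j permutes_in_image by fastforce
    with j d show ?thesis by (auto simp: nth_eq_iff_index_eq)
  qed
  then show "of_int (sign \<sigma>) * prod_list (map (\<lambda>j. E (is ! (\<sigma> j - 1)) (is ! (j - 1)) + (if \<sigma> j = j then of_nat (k - j) else 0)) [1..<k + 1])
    = of_int (sign \<sigma>) * seq_prod k (\<lambda>j. shifted (is ! (\<sigma> j - 1)) (is ! (j - 1)) (of_nat (k - j)))"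
    unfolding seq_prod_def[symmetric] by (intro arg_cong2[of _ _ _ _ "(*)"] refl seq_prod_cong) (auto simp: shifted_def)
qed

text \<open>Index functions with a repeated value contribute zero. The injective ones are increasing
  lists composed with permutations, and the k! permutations of a list share one determinant.\<close>

lemma sum_coldet_eq_capelli: "(\<Sum>I\<in>{1..k} \<rightarrow>\<^sub>E {1..n}. coldet k I I) = of_nat (fact k) * capelli E n k"
proof -
  let ?S = "{1..k} \<rightarrow>\<^sub>E {1..n}"
  let ?P = "{\<tau>. \<tau> permutes {1..k}}"
  let ?I = "\<lambda>is. \<lambda>a. is ! (a - 1)"
  let ?g = "\<lambda>(is, \<tau>). restrict (?I is \<circ> \<tau>) {1..k}"
  have finS: "finite ?S" by (rule finite_PiE) auto
  have img: "?g x ` {1..k} = set (fst x)" if "x \<in> inc_lists k n \<times> ?P" for x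
  proof -
    obtain "is" \<tau> where x: "x = (is, \<tau>)" by (cases x)
    with that have t: "\<tau> permutes {1..k}" and l: "length is = k" by (auto simp: inc_lists_def)
    have "?g x ` {1..k} = ?I is ` (\<tau> ` {1..k})" by (auto simp: x image_iff)
    also have "\<dots> = ?I is ` {1..k}" using permutes_image[OF t] by simp
    also have "\<dots> = set is"
      unfolding set_conv_nth l by (force simp: image_iff intro: bexI[of _ "Suc i" for i])
    finally show ?thesis by (simp add: x)
  qed
  have inj: "inj_on ?g (inc_lists k n \<times> ?P)"
  proof (rule inj_onI)
    fix x y assume xy: "x \<in> inc_lists k n \<times> ?P" "y \<in> inc_lists k n \<times> ?P" "?g x = ?g y"
    obtain "is" \<tau> is' \<tau>' where x: "x = (is, \<tau>)" "y = (is', \<tau>')" by (cases x, cases y)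
    have "set (fst x) = set (fst y)"
      unfolding img[OF xy(1), symmetric] img[OF xy(2), symmetric] xy(3) ..
    then have "set is = set is'" by (simp add: x)
    then have e: "is = is'"
      using xy(1,2) strict_sorted_equal[of "is" is'] by (auto simp: x inc_lists_def)
    have l: "distinct is" "length is = k" using xy(1) by (auto simp: x inc_lists_def strict_sorted_iff)
    have t: "\<tau> permutes {1..k}" "\<tau>' permutes {1..k}" using xy(1,2) by (auto simp: x)
    have "\<tau> a = \<tau>' a" for a
    proof (cases "a \<in> {1..k}")
      case True
      then have "is ! (\<tau> a - 1) = is ! (\<tau>' a - 1)"
        using fun_cong[OF xy(3), of a] by (simp add: x e)
      moreover have k: "\<tau> a \<in> {1..k}" "\<tau>' a \<in> {1..k}"
        using True t permutes_in_image by fastforce+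
      then have "\<tau> a - 1 < length is" "\<tau>' a - 1 < length is" using l by auto
      ultimately have "\<tau> a - 1 = \<tau>' a - 1"
        using nth_eq_iff_index_eq[OF l(1)] by blast
      with k show ?thesis by (simp add: eq_diff_iff)
    next
      case False
      then show ?thesis using t by (simp add: permutes_not_in)
    qed
    then show "x = y" by (simp add: x e fun_eq_iff)
  qed
  \<comment> \<open>The list is the sorted range of I, and \<tau> sends a position of I to the place
    of its value in that list.\<close>
  have onto: "{I \<in> ?S. inj_on I {1..k}} \<subseteq> ?g ` (inc_lists k n \<times> ?P)"
  proof
    fix I assume "I \<in> {I \<in> ?S. inj_on I {1..k}}"
    then have I: "I \<in> ?S" "inj_on I {1..k}" by auto
    define "is" where "is = sorted_list_of_set (I ` {1..k})"
    have "length is = k" "set is = I ` {1..k}" "distinct is"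
      using I by (auto simp: is_def card_image)
    then have i: "is \<in> inc_lists k n"
      using I by (auto simp: inc_lists_def is_def)
    have ex: "\<exists>p. p < k \<and> is ! p = I a" if "a \<in> {1..k}" for a
      using that \<open>set is = I ` {1..k}\<close> \<open>length is = k\<close> by (metis imageI in_set_conv_nth)
    define \<tau> where "\<tau> a = (if a \<in> {1..k} then Suc (SOME p. p < k \<and> is ! p = I a) else a)" for a
    have tau: "\<tau> a \<in> {1..k} \<and> is ! (\<tau> a - 1) = I a" if "a \<in> {1..k}" for a
      using someI_ex[OF ex[OF that]] that by (auto simp: \<tau>_def)
    have "\<tau> permutes {1..k}"
    proof (rule bij_imp_permutes)
      have "inj_on \<tau> {1..k}"
        using tau I(2) by (metis inj_on_def)
      then show "bij_betw \<tau> {1..k} {1..k}"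
        using tau by (intro bij_betw_imageI endo_inj_surj) auto
      show "\<tau> a = a" if "a \<notin> {1..k}" for a using that by (simp only: \<tau>_def if_False)
    qed
    moreover have "I = ?g (is, \<tau>)"
      using I(1) tau by (auto simp: fun_eq_iff restrict_def PiE_iff extensional_def)
    ultimately show "I \<in> ?g ` (inc_lists k n \<times> ?P)"
      using i by blast
  qed
  have into: "?g ` (inc_lists k n \<times> ?P) \<subseteq> ?S"
  proof
    fix I assume "I \<in> ?g ` (inc_lists k n \<times> ?P)"
    then obtain x where x: "x \<in> inc_lists k n \<times> ?P" "I = ?g x" by blast
    then have "I ` {1..k} \<subseteq> {1..n}" using img by (auto simp: inc_lists_def)
    moreover have "I \<in> extensional {1..k}" using x(2) by (cases x) auto
    ultimately show "I \<in> ?S" by (auto simp: PiE_iff)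
  qed
  have "(\<Sum>I\<in>?S. coldet k I I) = (\<Sum>I\<in>?g ` (inc_lists k n \<times> ?P). coldet k I I)"
  proof (rule sum.mono_neutral_right[OF finS into], rule ballI)
    fix I assume "I \<in> ?S - ?g ` (inc_lists k n \<times> ?P)"
    then have "\<not> inj_on I {1..k}" using onto by blast
    then obtain a b where "a \<in> {1..k}" "b \<in> {1..k}" "a \<noteq> b" "I a = I b"
      unfolding inj_on_def by blast
    then show "coldet k I I = 0" by (rule coldet_repeated)
  qed
  also have "\<dots> = (\<Sum>x\<in>inc_lists k n \<times> ?P. coldet k (?g x) (?g x))"
    by (subst sum.reindex[OF inj]) (simp add: comp_def)
  also have "\<dots> = (\<Sum>is\<in>inc_lists k n. \<Sum>\<tau>\<in>?P. coldet k (?g (is, \<tau>)) (?g (is, \<tau>)))"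
    unfolding sum.cartesian_product by (intro sum.cong refl) (auto simp: split_beta)
  also have "\<dots> = (\<Sum>is\<in>inc_lists k n. \<Sum>\<tau>\<in>?P. coldet k (?I is) (?I is))"
  proof (intro sum.cong refl)
    fix "is" \<tau> assume "\<tau> \<in> ?P"
    then have t: "\<tau> permutes {1..k}" by simp
    have "coldet k (?g (is, \<tau>)) (?g (is, \<tau>)) = coldet k (?I is \<circ> \<tau>) (?I is \<circ> \<tau>)"
      by (rule coldet_cong) auto
    then show "coldet k (?g (is, \<tau>)) (?g (is, \<tau>)) = coldet k (?I is) (?I is)"
      using coldet_diag_perm[OF t] by simp
  qed
  also have "\<dots> = (\<Sum>is\<in>inc_lists k n. of_nat (fact k) * coldet k (?I is) (?I is))"
    using card_permutations[of "{1..k}" k] by simp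
  finally show ?thesis
    by (simp add: capelli_eq_coldet sum_distrib_left)
qed

theorem capelli_central:
  assumes "a \<in> {1..n}" "b \<in> {1..n}"
  shows "E a b * capelli E n k = capelli E n k * E a b"
proof -
  have "of_nat (fact k) *\<^sub>C (E a b * capelli E n k) = of_nat (fact k) *\<^sub>C (capelli E n k * E a b)"
    using sum_coldet_central[OF assms, of k] unfolding sum_coldet_eq_capelli scaleC_of_nat[symmetric]
    by simp
  then have "(1 / of_nat (fact k)) *\<^sub>C (of_nat (fact k) *\<^sub>C (E a b * capelli E n k))
    = (1 / of_nat (fact k)) *\<^sub>C (of_nat (fact k) *\<^sub>C (capelli E n k * E a b))" by simp
  then show ?thesis by simp
qed

end

section \<open>Capelli elements in the enveloping algebra\<close>

interpretation der_op: gl_units "\<lambda>i j. der_op (Proper i, Proper j)"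
proof
  fix i j k l
  show "der_op (Proper i, Proper j) * der_op (Proper k, Proper l) - der_op (Proper k, Proper l) * der_op (Proper i, Proper j)
    = (if j = k then der_op (Proper i, Proper l) else 0) - (if l = i then der_op (Proper k, Proper j) else 0)"
    using der_op_relator[of "(Proper i, Proper j)" "(Proper k, Proper l)"]
    by (auto simp: relator_def br_def unit_sign_def)
qed

lemma eval_capelli: "eval g (capelli gl_e n k) = capelli (\<lambda>i j. g (Proper i, Proper j)) n k"
proof -
  have "eval g (if b then of_nat m else 0) = (if b then of_nat m else 0)" for b m
    by simp
  then show ?thesis
    by (simp add: capelli_def gl_e_def comp_def)
qed

lemma inc_lists_nth:
  assumes "is \<in> inc_lists k n" "j \<in> {1..k}"
  shows "is ! (j - 1) \<in> {1..n}"
proof -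
  have "is ! (j - 1) \<in> set is" using assms by (auto simp: inc_lists_def)
  then show ?thesis using assms by (auto simp: inc_lists_def)
qed

lemma capelli_entry_fa_on:
  assumes "is \<in> inc_lists k n" "\<sigma> permutes {1..k}" "j \<in> {1..k}"
  shows "gl_e (is ! (\<sigma> j - 1)) (is ! (j - 1)) + (if \<sigma> j = j then of_nat (k - j) else 0) \<in> fa_on (gl_basis n)"
proof -
  have "\<sigma> j \<in> {1..k}" using assms(2,3) permutes_in_image by fastforce
  then have "gl_e (is ! (\<sigma> j - 1)) (is ! (j - 1)) \<in> fa_on (gl_basis n)"
    by (intro gl_e_fa_on inc_lists_nth[OF assms(1)] assms(3))
  then show ?thesis
    by (rule fa_on_add) simp
qed

lemma capelli_fa_on: "capelli gl_e n k \<in> fa_on (gl_basis n)"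
  unfolding capelli_def
proof (intro fa_on_sum fa_on_mult fa_on_of_int fa_on_prod_list)
  fix "is" \<sigma> x
  assume "is \<in> inc_lists k n" "\<sigma> \<in> {\<sigma>. \<sigma> permutes {1..k}}"
    "x \<in> set (map (\<lambda>j. gl_e (is ! (\<sigma> j - 1)) (is ! (j - 1)) + (if \<sigma> j = j then of_nat (k - j) else 0)) [1..<k + 1])"
  moreover have "set [1..<k + 1] = {1..k}" by auto
  ultimately show "x \<in> fa_on (gl_basis n)"
    unfolding set_map using capelli_entry_fa_on[of "is" k n \<sigma>] by blast
qed

lemma coset_sign:
  assumes "t \<in> fa_on (A \<times> A)"
  shows "coset A (of_int (sign \<sigma>) * t) = [sign \<sigma>] \<cdot>\<^bsub>env_alg A\<^esub> coset A t"
  using assms add_pow_sign[of "coset A t" A] coset_uminus[OF assms]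
  by (cases "evenperm \<sigma>") (auto simp: sign_def)

lemma Capelli_H_coset: "Capelli_H n k = coset (proper_symbols n) (capelli gl_e n k)"
proof -
  let ?P = "proper_symbols n"
  interpret ring "Ugl n" by (rule ring_env_alg)
  let ?F = "\<lambda>is \<sigma> j. gl_e (is ! (\<sigma> j - 1)) (is ! (j - 1)) + (if \<sigma> j = j then of_nat (k - j) else 0)"
  let ?x = "\<lambda>is a b. egl n (is ! (a - 1)) (is ! (b - 1))
        \<oplus>\<^bsub>Ugl n\<^esub> (if a = b then scalgl n (of_nat (k - a)) else \<zero>\<^bsub>Ugl n\<^esub>)"
  let ?p = "\<lambda>is \<sigma>. prod_list (map (?F is \<sigma>) [1..<k + 1])"
  let ?t = "\<lambda>is. \<Sum>\<sigma> | \<sigma> permutes {1..k}. of_int (sign \<sigma>) * ?p is \<sigma>"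
  let ?I = "{is. length is = k \<and> sorted_wrt (<) is \<and> set is \<subseteq> {1..n}}"
  have F: "?F is \<sigma> j \<in> fa_on (gl_basis n)" if "is \<in> inc_lists k n" "\<sigma> permutes {1..k}" "j \<in> {1..k}" for "is" \<sigma> j
    using that by (rule capelli_entry_fa_on)
  have pF: "?p is \<sigma> \<in> fa_on (gl_basis n)"
    if "is \<in> inc_lists k n" "\<sigma> permutes {1..k}" for "is" \<sigma>
    using F[OF that] by (intro fa_on_prod_list) auto
  have fp: "finite {\<sigma>. \<sigma> permutes {1..k}}" by (rule finite_permutations) simp
  have 1: "coset ?P (?F is \<sigma> j) = ?x is (\<sigma> j) j"
    if "is \<in> inc_lists k n" "\<sigma> permutes {1..k}" "j \<in> {1..k}" for "is" \<sigma> j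
  proof -
    have "\<sigma> j \<in> {1..k}" using that(2,3) permutes_in_image by fastforce
    then have "gl_e (is ! (\<sigma> j - 1)) (is ! (j - 1)) \<in> fa_on (gl_basis n)"
      using inc_lists_nth[OF that(1)] that(3) by (intro gl_e_fa_on)
    then show ?thesis
      by (subst coset_add) (auto simp: unit_elt_coset gl_e_def scal_coset scaleC_of_nat coset_zero)
  qed
  have 2: "coset ?P (?p is \<sigma>)
    = list_prod (Ugl n) (map (\<lambda>j. ?x is (\<sigma> j) j) [1..<k + 1])"
    if "is \<in> inc_lists k n" "\<sigma> permutes {1..k}" for "is" \<sigma>
  proof -
    have "map (coset ?P) (map (?F is \<sigma>) [1..<k + 1]) = map (\<lambda>j. ?x is (\<sigma> j) j) [1..<k + 1]"
      unfolding map_map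
    proof (rule map_cong[OF refl])
      fix j assume "j \<in> set [1..<k + 1]"
      then have "j \<in> {1..k}" by auto
      from 1[OF that this] show "(coset ?P \<circ> ?F is \<sigma>) j = ?x is (\<sigma> j) j"
        by (simp only: comp_apply)
    qed
    moreover have "coset ?P (?p is \<sigma>)
        = list_prod (Ugl n) (map (coset ?P) (map (?F is \<sigma>) [1..<k + 1]))"
      using F[OF that] by (intro coset_prod_list) auto
    ultimately show ?thesis by (simp only:)
  qed
  have 3: "coset ?P (?t is)
    = cdet (Ugl n) k (?x is)"
    if i: "is \<in> inc_lists k n" for "is"
  proof -
    have "coset ?P (?t is)
      = (\<Oplus>\<^bsub>Ugl n\<^esub>\<sigma>\<in>{\<sigma>. \<sigma> permutes {1..k}}. coset ?P (of_int (sign \<sigma>) * ?p is \<sigma>))"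
      using pF[OF i] by (intro coset_sum[OF fp]) auto
    also have "\<dots> = cdet (Ugl n) k (?x is)"
      unfolding cdet_def
    proof (rule finsum_cong'[OF refl], rule funcsetI)
      fix \<sigma> assume "\<sigma> \<in> {\<sigma>. \<sigma> permutes {1..k}}"
      then have s: "\<sigma> permutes {1..k}" by simp
      have e: "coset ?P (of_int (sign \<sigma>) * ?p is \<sigma>)
        = [sign \<sigma>] \<cdot>\<^bsub>Ugl n\<^esub> list_prod (Ugl n) (map (\<lambda>j. ?x is (\<sigma> j) j) [1..<k + 1])"
        unfolding coset_sign[OF pF[OF i s]] 2[OF i s] ..
      then show "coset ?P (of_int (sign \<sigma>) * ?p is \<sigma>)
        = [sign \<sigma>] \<cdot>\<^bsub>Ugl n\<^esub> list_prod (Ugl n) (map (\<lambda>j. ?x is (\<sigma> j) j) [1..<k + 1])" .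
      have "of_int (sign \<sigma>) * ?p is \<sigma> \<in> fa_on (gl_basis n)"
        using pF[OF i s] by simp
      then show "[sign \<sigma>] \<cdot>\<^bsub>Ugl n\<^esub> list_prod (Ugl n) (map (\<lambda>j. ?x is (\<sigma> j) j) [1..<k + 1]) \<in> carrier (Ugl n)"
        unfolding e[symmetric] by (rule coset_carrier)
    qed
    finally show ?thesis .
  qed
  have "coset ?P (capelli gl_e n k) = (\<Oplus>\<^bsub>Ugl n\<^esub>is\<in>inc_lists k n.
     coset ?P (?t is))"
    unfolding capelli_def using pF
    by (intro coset_sum finite_inc_lists fa_on_sum) auto
  also have "\<dots> = Capelli_H n k"
    unfolding Capelli_H_def
  proof (rule finsum_cong')
    show "inc_lists k n = ?I"
      by (simp add: inc_lists_def)
    show "coset ?P (?t i)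
    = cdet (Ugl n) k (?x i)"
      if "i \<in> ?I" for i
      using 3[of i] that by (simp add: inc_lists_def)
    then show "(\<lambda>is. cdet (Ugl n) k (?x is))
      \<in> ?I \<rightarrow> carrier (Ugl n)"
    proof (intro funcsetI)
      fix x assume x: "x \<in> ?I"
      then have x': "x \<in> inc_lists k n" by (simp add: inc_lists_def)
      have "(?t x) \<in> fa_on (gl_basis n)"
        using pF[OF x'] by (intro fa_on_sum) auto
      then show "cdet (Ugl n) k (?x x) \<in> carrier (Ugl n)"
        unfolding 3[OF x', symmetric] by (rule coset_carrier)
    qed
  qed
  finally show ?thesis ..
qed

section \<open>The centre, described by representatives\<close>

definition central :: "nat \<Rightarrow> unit_symbol fa set" where
  "central n = {t \<in> fa_on (gl_basis n). \<forall>a\<in>{1..n}. \<forall>b\<in>{1..n}. gl_e a b * t - t * gl_e a b \<in> env_ker (proper_symbols n)}"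

lemma central_fa_on: "t \<in> central n \<Longrightarrow> t \<in> fa_on (gl_basis n)"
  by (simp add: central_def)

lemma central_commutes:
  assumes "t \<in> central n" "r \<in> fa_on (gl_basis n)"
  shows "r * t - t * r \<in> env_ker (proper_symbols n)"
  using assms(2)
proof (induction r rule: fa_on_induct)
  case (add a b)
  then show ?case using env_ker_add[OF add(3,4)] by (simp add: algebra_simps)
next
  case (scale c a)
  then show ?case using env_ker_scaleC[OF scale(2), of c] by (simp add: scaleC_diff_right)
next
  case (word w)
  then show ?case
  proof (induction w)
    case (Cons x w)
    have x: "wd [x] * t - t * wd [x] \<in> env_ker (proper_symbols n)"
      using Cons.prems assms(1) by (auto simp: central_def gl_e_def proper_symbols_def)
    have "wd (x # w) * t - t * wd (x # w) = wd [x] * (wd w * t - t * wd w) + (wd [x] * t - t * wd [x]) * wd w"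
      by (simp add: wd_Cons[of x w] algebra_simps)
    also have "\<dots> \<in> env_ker (proper_symbols n)"
      using Cons x by (intro env_ker_add env_ker_lmult env_ker_rmult) auto
    finally show ?case .
  qed (simp add: wd_Nil)
qed simp

lemma coset_zeta: "t \<in> fa_on (gl_basis n) \<Longrightarrow> coset (proper_symbols n) t \<in> carrier (\<zeta> n) \<longleftrightarrow> t \<in> central n"
proof
  let ?P = "proper_symbols n"
  assume t: "t \<in> fa_on (gl_basis n)"
  {
    assume "coset ?P t \<in> carrier (\<zeta> n)"
    then have c: "coset ?P t \<otimes>\<^bsub>Ugl n\<^esub> u = u \<otimes>\<^bsub>Ugl n\<^esub> coset ?P t" if "u \<in> carrier (Ugl n)" for u
      using that by (simp add: \<zeta>_def)
    show "t \<in> central n"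
      unfolding central_def
    proof (intro CollectI conjI ballI t)
      fix a b assume ab: "a \<in> {1..n}" "b \<in> {1..n}"
      then have "coset ?P (gl_e a b * t) = coset ?P (t * gl_e a b)"
        using c[of "coset ?P (gl_e a b)"] t gl_e_fa_on[OF ab] by (simp add: coset_mult)
      then show "gl_e a b * t - t * gl_e a b \<in> env_ker ?P" by (simp add: coset_eq_iff)
    qed
  }
  {
    assume "t \<in> central n"
    then have "coset ?P t \<otimes>\<^bsub>Ugl n\<^esub> u = u \<otimes>\<^bsub>Ugl n\<^esub> coset ?P t" if "u \<in> carrier (Ugl n)" for u
    proof -
      from that obtain r where r: "u = coset ?P r" "r \<in> fa_on (gl_basis n)" by (auto simp: carrier_env)
      from central_commutes[OF \<open>t \<in> central n\<close> r(2)] have "coset ?P (r * t) = coset ?P (t * r)"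
        by (simp add: coset_eq_iff)
      with t r show ?thesis by (simp add: coset_mult)
    qed
    with t show "coset ?P t \<in> carrier (\<zeta> n)" by (simp add: \<zeta>_def)
  }
qed

lemma carrier_zeta: "carrier (\<zeta> n) = coset (proper_symbols n) ` central n"
proof (intro equalityI subsetI)
  fix z assume z: "z \<in> carrier (\<zeta> n)"
  then have "z \<in> carrier (Ugl n)" by (simp add: \<zeta>_def)
  then obtain t where "z = coset (proper_symbols n) t" "t \<in> fa_on (gl_basis n)" by (auto simp: carrier_env)
  with z show "z \<in> coset (proper_symbols n) ` central n" by (simp add: coset_zeta)
qed (use central_fa_on coset_zeta in auto)

text \<open>The commutator is zero in the operator algebra, and by faithfulness it then lies in the
  ideal of relations.\<close>

lemma capelli_central: "capelli gl_e n k \<in> central n"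
  unfolding central_def
proof (intro CollectI conjI ballI capelli_fa_on)
  fix a b assume ab: "a \<in> {1..n}" "b \<in> {1..n}"
  have "eval der_op (gl_e a b * capelli gl_e n k - capelli gl_e n k * gl_e a b) = 0"
    using der_op.capelli_central[OF ab, of k] by (simp add: eval_capelli gl_e_def)
  then show "gl_e a b * capelli gl_e n k - capelli gl_e n k * gl_e a b \<in> env_ker (proper_symbols n)"
    using gl_e_fa_on[OF ab] capelli_fa_on[of n k] by (intro pairing_faithful) (auto simp: pairing_def)
qed

lemma central_add:
  assumes "a \<in> central n" "b \<in> central n"
  shows "a + b \<in> central n"
  unfolding central_def
proof (intro CollectI conjI ballI)
  fix i j assume ij: "i \<in> {1..n}" "j \<in> {1..n}"
  have "gl_e i j * (a + b) - (a + b) * gl_e i j = (gl_e i j * a - a * gl_e i j) + (gl_e i j * b - b * gl_e i j)"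
    by (simp add: algebra_simps)
  also have "\<dots> \<in> env_ker (proper_symbols n)" using assms ij by (intro env_ker_add) (auto simp: central_def)
  finally show "gl_e i j * (a + b) - (a + b) * gl_e i j \<in> env_ker (proper_symbols n)" .
qed (use assms central_fa_on in simp)

lemma central_mult:
  assumes "a \<in> central n" "b \<in> central n"
  shows "a * b \<in> central n"
  unfolding central_def
proof (intro CollectI conjI ballI)
  fix i j assume ij: "i \<in> {1..n}" "j \<in> {1..n}"
  have "gl_e i j * (a * b) - (a * b) * gl_e i j = (gl_e i j * a - a * gl_e i j) * b + a * (gl_e i j * b - b * gl_e i j)"
    by (simp add: algebra_simps)
  also have "\<dots> \<in> env_ker (proper_symbols n)"
    using assms ij by (intro env_ker_add env_ker_lmult env_ker_rmult) (auto simp: central_def)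
  finally show "gl_e i j * (a * b) - (a * b) * gl_e i j \<in> env_ker (proper_symbols n)" .
qed (use assms central_fa_on in simp)

lemma central_one: "1 \<in> central n"
  by (simp add: central_def)

lemma central_scaleC: "a \<in> central n \<Longrightarrow> c *\<^sub>C a \<in> central n"
  by (auto simp: central_def scaleC_diff_right[symmetric])

section \<open>Invariant forms and the companion slice\<close>

text \<open>Letters were never made commutative; this is commutativity as seen by a
  functional.\<close>

definition swap_inv :: "(letter list \<Rightarrow> complex) \<Rightarrow> bool" where
  "swap_inv f \<longleftrightarrow> (\<forall>w1 l l' w2. f (w1 @ l # l' # w2) = f (w1 @ l' # l # w2))"

lemma swap_inv_Cons: "swap_inv f \<Longrightarrow> swap_inv (\<lambda>w. f (l # w))"
  unfolding swap_inv_def by (metis append_Cons)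

lemma swap_inv_swap: "swap_inv f \<Longrightarrow> f (l # l' # w) = f (l' # l # w)"
  unfolding swap_inv_def by (metis append_Nil)

text \<open>Between proper indices the derivation is even and acts on each letter without a sign, so
  exchanging neighbours commutes with it.\<close>

lemma swap_inv_der:
  assumes "swap_inv f"
  shows "swap_inv (der (Proper a) (Proper b) f)"
  unfolding swap_inv_def
proof (intro allI)
  fix w1 l l' w2
  show "der (Proper a) (Proper b) f (w1 @ l # l' # w2) = der (Proper a) (Proper b) f (w1 @ l' # l # w2)"
    using assms
  proof (induction w1 arbitrary: f)
    case Nil
    have e: "(\<lambda>w. f (l # l' # w)) = (\<lambda>w. f (l' # l # w))"
      using swap_inv_swap[OF Nil] by (simp add: fun_eq_iff)
    have "f (x # l' # w2) = f (l' # x # w2)" "f (x # l # w2) = f (l # x # w2)" for x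
      using swap_inv_swap[OF Nil] by auto
    then show ?case by (simp add: e)
  next
    case (Cons u w1)
    have 1: "f (x # w1 @ l # l' # w2) = f (x # w1 @ l' # l # w2)" for x
      using Cons.prems unfolding swap_inv_def by (metis append_Cons)
    have 2: "f (w1 @ l # l' # w2) = f (w1 @ l' # l # w2)"
      using Cons.prems unfolding swap_inv_def by blast
    show ?case using Cons.IH[OF swap_inv_Cons[OF Cons.prems]] by (simp add: 1 2)
  qed
qed

lemma eval_der_op_induct:
  assumes "t \<in> fa_on (gl_basis n)" "P f"
    and "\<And>f a b. P f \<Longrightarrow> a \<in> {1..n} \<Longrightarrow> b \<in> {1..n} \<Longrightarrow> P (der (Proper a) (Proper b) f)"
    and "\<And>f g c d. P f \<Longrightarrow> P g \<Longrightarrow> P (\<lambda>w. c * f w + d * g w)"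
  shows "P (app (eval der_op t) f)"
  using assms(1)
proof (induction t rule: fa_on_induct)
  case zero
  have "app 0 f = (\<lambda>w. 0 * f w + 0 * f w)" by (simp add: fun_eq_iff)
  then show ?case using assms(4)[OF assms(2,2), of 0 0] by simp
next
  case (add a b)
  have "app (eval der_op (a + b)) f = (\<lambda>w. 1 * app (eval der_op a) f w + 1 * app (eval der_op b) f w)"
    by (simp add: fun_eq_iff)
  then show ?case using assms(4)[OF add(3,4), of 1 1] by simp
next
  case (scale c a)
  have "app (eval der_op (c *\<^sub>C a)) f = (\<lambda>w. c * app (eval der_op a) f w + 0 * app (eval der_op a) f w)"
    by (simp add: fun_eq_iff)
  then show ?case using assms(4)[OF scale(2,2), of c 0] by simp
next
  case (word w)
  then show ?case using assms(2)
  proof (induction w arbitrary: f)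
    case (Cons x w)
    obtain a b where x: "x = (Proper a, Proper b)" "a \<in> {1..n}" "b \<in> {1..n}"
      using Cons.prems(1) by (auto simp: proper_symbols_def)
    show ?case
      using Cons.IH[of "der (Proper a) (Proper b) f"] Cons.prems assms(3)[OF Cons.prems(2) x(2,3)]
      by (simp add: x(1) app_der_op)
  qed simp
qed

lemma swap_inv_pairing:
  assumes "t \<in> fa_on (gl_basis n)"
  shows "swap_inv (pairing t)"
  unfolding pairing_def
proof (rule eval_der_op_induct[OF assms])
  show "swap_inv counit" by (auto simp: swap_inv_def counit_def)
  show "swap_inv (der (Proper a) (Proper b) f)" if "swap_inv f" for f a b
    using that by (rule swap_inv_der)
  show "swap_inv (\<lambda>w. c * f w + d * g w)" if "swap_inv f" "swap_inv g" for f g c d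
    using that by (simp add: swap_inv_def)
qed

text \<open>Right translations. They commute with the derivations of the left translations and agree with them
  under the constant term, whence the invariance of the functional of a central element.\<close>

fun rder :: "nat \<Rightarrow> nat \<Rightarrow> (letter list \<Rightarrow> complex) \<Rightarrow> letter list \<Rightarrow> complex" where
  "rder c d f [] = 0"
| "rder c d f (l # w) = (if snd l = c then f ((fst l, d) # w) + const_part (fst l, d) * f w else 0)
     + rder c d (\<lambda>u. f (l # u)) w"

lemma rder_lin: "rder a b (\<lambda>u. c * f u + d * g u) w = c * rder a b f w + d * rder a b g w"
proof (induction w arbitrary: f g)
  case (Cons l w)
  show ?case by (auto simp: Cons algebra_simps)
qed simp

lemma rder_add: "rder a b (\<lambda>u. f u + g u) w = rder a b f w + rder a b g w"
  using rder_lin[of a b 1 f 1 g] by simp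

lemma rder_scale: "rder a b (\<lambda>u. c * f u) w = c * rder a b f w"
  using rder_lin[of a b c f 0 f] by simp

lemma rder_if: "rder a b (\<lambda>u. if P then f u else 0) w = (if P then rder a b f w else 0)"
  using rder_scale[of a b 0 f w] by simp

lemma der_rder: "der (Proper x) (Proper y) (rder c d f) w = rder c d (der (Proper x) (Proper y) f) w"
proof (induction w arbitrary: f)
  case (Cons l w)
  show ?case
    by (simp add: der_add der_scale der_if rder_add rder_scale rder_if Cons)
qed simp

lemma der_counit: "der (Proper a) (Proper b) counit w = rder a b counit w"
proof (cases w)
  case (Cons l u)
  have 0: "(\<lambda>u. counit (l # u)) = (\<lambda>u. 0 * counit u)" by (simp add: counit_def)
  show ?thesis
    unfolding Cons der.simps rder.simps 0 der_scale rder_scale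
    by (cases l) (auto simp: counit_def const_part_def)
qed simp

lemma app_rder:
  assumes "t \<in> fa_on (gl_basis n)"
  shows "app (eval der_op t) (rder c d f) = rder c d (app (eval der_op t) f)"
proof -
  have "(\<lambda>g. app (eval der_op t) (rder c d f) = rder c d (app (eval der_op t) f)) f"
  proof -
    define S where "S = {t \<in> fa_on (gl_basis n). \<forall>f. app (eval der_op t) (rder c d f) = rder c d (app (eval der_op t) f)}"
    have "t \<in> S"
      using assms
    proof (induction t rule: fa_on_induct)
      case zero
      have "rder c d (\<lambda>w. 0) = (\<lambda>w. 0)" using rder_scale[of c d 0 counit] by (simp add: fun_eq_iff)
      then show ?case by (simp add: S_def fun_eq_iff app_simps(1)[abs_def])
    next
      case (add a b)
      have "app (eval der_op a + eval der_op b) g = (\<lambda>w. app (eval der_op a) g w + app (eval der_op b) g w)" for g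
        by (simp add: fun_eq_iff)
      note e = this
      show ?case
        unfolding S_def
      proof (intro CollectI conjI allI)
        show "a + b \<in> fa_on (gl_basis n)" using add by simp
        show "app (eval der_op (a + b)) (rder c d f) = rder c d (app (eval der_op (a + b)) f)" for f
          unfolding eval_add e by (rule ext) (use add in \<open>simp add: S_def rder_add\<close>)
      qed
    next
      case (scale e a)
      have "app (e *\<^sub>C eval der_op a) g = (\<lambda>w. e * app (eval der_op a) g w)" for g
        by (simp add: fun_eq_iff)
      note e' = this
      show ?case
        unfolding S_def
      proof (intro CollectI conjI allI)
        show "e *\<^sub>C a \<in> fa_on (gl_basis n)" using scale by simp
        show "app (eval der_op (e *\<^sub>C a)) (rder c d f) = rder c d (app (eval der_op (e *\<^sub>C a)) f)" for f
          unfolding eval_scaleC e' by (rule ext) (use scale in \<open>simp add: S_def rder_scale\<close>)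
      qed
    next
      case (word w)
      have "app (eval der_op (wd w)) (rder c d f) = rder c d (app (eval der_op (wd w)) f)" for f
        using word
      proof (induction w arbitrary: f)
        case (Cons x w)
        obtain a b where x: "x = (Proper a, Proper b)"
          using Cons.prems(1) by (auto simp: proper_symbols_def)
        have "der (Proper a) (Proper b) (rder c d f) = rder c d (der (Proper a) (Proper b) f)"
          using der_rder by (simp add: fun_eq_iff)
        then show ?case using Cons by (simp add: x app_der_op)
      qed simp
      with word show ?case by (simp add: S_def)
    qed
    then show ?thesis by (simp add: S_def)
  qed
  then show ?thesis .
qed

fun ad_der :: "nat \<Rightarrow> nat \<Rightarrow> (letter list \<Rightarrow> complex) \<Rightarrow> letter list \<Rightarrow> complex" where
  "ad_der a b f [] = 0"
| "ad_der a b f (l # w) = (if fst l = Proper b then f ((Proper a, snd l) # w) else 0)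
     - (if snd l = a then f ((fst l, b) # w) else 0) + ad_der a b (\<lambda>u. f (l # u)) w"

text \<open>The constant terms of left and right translation agree and cancel. Hence the difference
  preserves word length: it is infinitesimal conjugation on homogeneous forms.\<close>

lemma ad_der_eq: "ad_der a b f w = der (Proper a) (Proper b) f w - rder a b f w"
proof (induction w arbitrary: f)
  case (Cons l w)
  then show ?case by (cases l) (auto simp: const_part_def)
qed simp

text \<open>To the right of t, e_{a,b} acts on the functional of t by left translation. To the left
  of t it meets the constant term, where it may be exchanged for right translation, which then
  passes through t.\<close>

lemma ad_der_pairing:
  assumes "t \<in> central n" "a \<in> {1..n}" "b \<in> {1..n}"
  shows "ad_der a b (pairing t) w = 0"
proof -
  have t: "t \<in> fa_on (gl_basis n)" using assms(1) by (rule central_fa_on)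
  have "pairing (gl_e a b * t) = app (eval der_op t) (der (Proper a) (Proper b) counit)"
    by (simp add: pairing_def gl_e_def app_der_op)
  also have "der (Proper a) (Proper b) counit = rder a b counit" using der_counit by (simp add: fun_eq_iff)
  also have "app (eval der_op t) (rder a b counit) = rder a b (pairing t)"
    unfolding app_rder[OF t] by (simp add: pairing_def)
  finally have 1: "pairing (gl_e a b * t) = rder a b (pairing t)" .
  have 2: "pairing (t * gl_e a b) = der (Proper a) (Proper b) (pairing t)"
    by (simp add: pairing_def gl_e_def app_der_op)
  have "pairing (gl_e a b * t - t * gl_e a b) w = 0"
    using assms by (intro pairing_env_ker[where A = "proper_symbols n"]) (auto simp: central_def)
  then show ?thesis by (simp add: ad_der_eq 1 2)
qed

text \<open>Diagonal units act on words by weights: row occurrences minus column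
  occurrences.\<close>

lemma ad_der_diag: "ad_der b b f w = (of_nat (count (mset (map fst w)) (Proper b))
    - of_nat (count (mset (map snd w)) b)) * f w"
proof (induction w arbitrary: f)
  case (Cons l w)
  show ?case by (cases l) (auto simp: Cons algebra_simps)
qed simp

section \<open>Functionals as multilinear forms in matrices\<close>

fun mlin :: "nat \<Rightarrow> (letter list \<Rightarrow> complex) \<Rightarrow> (letter \<Rightarrow> complex) list \<Rightarrow> complex" where
  "mlin n f [] = f []"
| "mlin n f (X # Xs) = (\<Sum>l\<in>letters n. X l * mlin n (\<lambda>w. f (l # w)) Xs)"

lemma finite_letters: "finite (letters n)"
  by (simp add: letters_def proper_symbols_def)

lemma sum_letters: "(\<Sum>l\<in>letters n. g l) = (\<Sum>i=1..n. \<Sum>j=1..n. g (Proper i, j))"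
proof -
  have "(\<Sum>l\<in>letters n. g l) = (\<Sum>x\<in>proper_symbols n. \<Sum>j=1..n. g (x, j))"
    unfolding letters_def by (simp add: sum.cartesian_product)
  also have "\<dots> = (\<Sum>i=1..n. \<Sum>j=1..n. g (Proper i, j))"
    unfolding proper_symbols_def by (subst sum.reindex) (auto simp: inj_on_def)
  finally show ?thesis .
qed

lemma mlin_cong_f:
  assumes "\<And>w. length w = length Xs \<Longrightarrow> set w \<subseteq> letters n \<Longrightarrow> f w = g w"
  shows "mlin n f Xs = mlin n g Xs"
  using assms
proof (induction Xs arbitrary: f g)
  case (Cons X Xs)
  have "mlin n (\<lambda>w. f (l # w)) Xs = mlin n (\<lambda>w. g (l # w)) Xs" if "l \<in> letters n" for l
    by (rule Cons.IH) (use Cons.prems[of "l # _"] that in simp)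
  then show ?case unfolding mlin.simps by (intro sum.cong) auto
qed simp

lemma mlin_add: "mlin n (\<lambda>w. f w + g w) Xs = mlin n f Xs + mlin n g Xs"
  by (induction Xs arbitrary: f g) (auto simp: sum.distrib distrib_left)

lemma mlin_scale: "mlin n (\<lambda>w. c * f w) Xs = c * mlin n f Xs"
  by (induction Xs arbitrary: f) (auto simp: sum_distrib_left mult.left_commute)

lemma mlin_diff: "mlin n (\<lambda>w. f w - g w) Xs = mlin n f Xs - mlin n g Xs"
  using mlin_add[of n f "\<lambda>w. - 1 * g w" Xs] mlin_scale[of n "- 1" g Xs] by simp

lemma mlin_zero: "mlin n (\<lambda>w. 0) Xs = 0"
  by (induction Xs) auto

lemma mlin_head_cong:
  "(\<And>l. l \<in> letters n \<Longrightarrow> X l = Y l) \<Longrightarrow> mlin n f (X # Xs) = mlin n f (Y # Xs)"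
  by simp

lemma mlin_head_lin: "mlin n f ((\<lambda>l. c * X l + d * Y l) # Xs) = c * mlin n f (X # Xs) + d * mlin n f (Y # Xs)"
  by (simp add: sum.distrib sum_distrib_left algebra_simps)

lemma mlin_swap:
  assumes "swap_inv f"
  shows "mlin n f (X # Y # Xs) = mlin n f (Y # X # Xs)"
proof -
  have e: "(\<lambda>w. f (l # l' # w)) = (\<lambda>w. f (l' # l # w))" for l l'
    using swap_inv_swap[OF assms] by (simp add: fun_eq_iff)
  have "mlin n f (X # Y # Xs) = (\<Sum>l\<in>letters n. \<Sum>l'\<in>letters n. X l * (Y l' * mlin n (\<lambda>w. f (l # l' # w)) Xs))"
    by (simp add: sum_distrib_left)
  also have "\<dots> = (\<Sum>l'\<in>letters n. \<Sum>l\<in>letters n. X l * (Y l' * mlin n (\<lambda>w. f (l # l' # w)) Xs))"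
    by (rule sum.swap)
  also have "\<dots> = mlin n f (Y # X # Xs)"
    by (simp add: sum_distrib_left e[of _ "_ :: letter"] mult.left_commute)
  finally show ?thesis .
qed

lemma mlin_move:
  assumes "swap_inv f"
  shows "mlin n f (us @ X # vs) = mlin n f (X # us @ vs)"
  using assms
proof (induction us arbitrary: f)
  case (Cons u us)
  have "mlin n f ((u # us) @ X # vs) = mlin n f (u # X # us @ vs)"
    using Cons.IH[OF swap_inv_Cons[OF Cons.prems]] by simp
  also have "\<dots> = mlin n f (X # u # us @ vs)" using Cons.prems by (rule mlin_swap)
  finally show ?case by simp
qed simp

lemma mlin_mset:
  assumes "swap_inv f" "mset Xs = mset Ys"
  shows "mlin n f Xs = mlin n f Ys"
  using assms
proof (induction Xs arbitrary: f Ys)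
  case (Cons X Xs)
  have "X \<in> set Ys" using Cons.prems(2) by (metis list.set_intros(1) set_mset_mset)
  then obtain us vs where v: "Ys = us @ X # vs" by (meson split_list)
  then have "mset Xs = mset (us @ vs)" using Cons.prems(2) by simp
  from Cons.IH[OF swap_inv_Cons[OF Cons.prems(1)] this] show ?case
    unfolding v mlin_move[OF Cons.prems(1)] by simp
qed simp

definition commut :: "nat \<Rightarrow> (nat \<Rightarrow> nat \<Rightarrow> complex) \<Rightarrow> (letter \<Rightarrow> complex) \<Rightarrow> letter \<Rightarrow> complex" where
  "commut n A X l = (\<Sum>m=1..n. A (idx (fst l)) m * X (Proper m, snd l) - X (Proper (idx (fst l)), m) * A m (snd l))"

text \<open>\<open>ad_der\<close> acts on coefficients, the commutator on arguments, and the two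
  actions are adjoint. Invariance of f thus says that the sum over all slots of the derivatives in
  the directions [A, X] is zero.\<close>

lemma mlin_ad_der:
  "(\<Sum>p<length Xs. mlin n f (Xs[p := commut n A (Xs ! p)]))
     = (\<Sum>a=1..n. \<Sum>b=1..n. A a b * mlin n (ad_der a b f) Xs)"
proof (induction Xs arbitrary: f)
  case (Cons X Xs)
  define g where "g l = mlin n (\<lambda>w. f (l # w)) Xs" for l
  have head: "mlin n f (commut n A X # Xs) = (\<Sum>a=1..n. \<Sum>b=1..n. A a b *
     (\<Sum>l\<in>letters n. X l * ((if fst l = Proper b then g (Proper a, snd l) else 0)
       - (if snd l = a then g (fst l, b) else 0))))"
  proof -
    have "mlin n f (commut n A X # Xs) = (\<Sum>i=1..n. \<Sum>j=1..n. (\<Sum>m=1..n. A i m * X (Proper m, j) - X (Proper i, m) * A m j) * g (Proper i, j))"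
      by (simp add: sum_letters commut_def g_def)
    also have "\<dots> = (\<Sum>i=1..n. \<Sum>j=1..n. \<Sum>m=1..n. A i m * (X (Proper m, j) * g (Proper i, j)))
        - (\<Sum>i=1..n. \<Sum>j=1..n. \<Sum>m=1..n. A m j * (X (Proper i, m) * g (Proper i, j)))"
      by (simp add: sum_subtractf right_diff_distrib sum_distrib_left mult_ac)
    also have "(\<Sum>i=1..n. \<Sum>j=1..n. \<Sum>m=1..n. A i m * (X (Proper m, j) * g (Proper i, j)))
      = (\<Sum>a=1..n. \<Sum>b=1..n. A a b * (\<Sum>j=1..n. X (Proper b, j) * g (Proper a, j)))"
      by (rule sum.cong[OF refl], subst sum.swap) (simp add: sum_distrib_left)
    also have "(\<Sum>i=1..n. \<Sum>j=1..n. \<Sum>m=1..n. A m j * (X (Proper i, m) * g (Proper i, j)))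
      = (\<Sum>a=1..n. \<Sum>b=1..n. A a b * (\<Sum>i=1..n. X (Proper i, a) * g (Proper i, b)))"
    proof -
      have "(\<Sum>i=1..n. \<Sum>j=1..n. \<Sum>m=1..n. A m j * (X (Proper i, m) * g (Proper i, j)))
        = (\<Sum>i=1..n. \<Sum>m=1..n. \<Sum>j=1..n. A m j * (X (Proper i, m) * g (Proper i, j)))"
        by (rule sum.cong[OF refl], rule sum.swap)
      also have "\<dots> = (\<Sum>m=1..n. \<Sum>i=1..n. \<Sum>j=1..n. A m j * (X (Proper i, m) * g (Proper i, j)))"
        by (rule sum.swap)
      also have "\<dots> = (\<Sum>m=1..n. \<Sum>j=1..n. \<Sum>i=1..n. A m j * (X (Proper i, m) * g (Proper i, j)))"
        by (rule sum.cong[OF refl], rule sum.swap)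
      finally show ?thesis by (simp add: sum_distrib_left)
    qed
    also have "(\<Sum>a=1..n. \<Sum>b=1..n. A a b * (\<Sum>j=1..n. X (Proper b, j) * g (Proper a, j)))
       - (\<Sum>a=1..n. \<Sum>b=1..n. A a b * (\<Sum>i=1..n. X (Proper i, a) * g (Proper i, b)))
      = (\<Sum>a=1..n. \<Sum>b=1..n. A a b * ((\<Sum>j=1..n. X (Proper b, j) * g (Proper a, j))
         - (\<Sum>i=1..n. X (Proper i, a) * g (Proper i, b))))"
      by (simp add: sum_subtractf right_diff_distrib)
    also have "\<dots> = (\<Sum>a=1..n. \<Sum>b=1..n. A a b *
     (\<Sum>l\<in>letters n. X l * ((if fst l = Proper b then g (Proper a, snd l) else 0)
       - (if snd l = a then g (fst l, b) else 0))))"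
    proof (intro sum.cong refl arg_cong2[of _ _ _ _ "(*)"])
      fix a b assume ab: "a \<in> {1..n}" "b \<in> {1..n}"
      have i1: "(\<Sum>j=1..n. if i = b then X (Proper i, j) * g (Proper a, j) else 0)
        = (if i = b then (\<Sum>j=1..n. X (Proper b, j) * g (Proper a, j)) else 0)" for i
        by auto
      have "(\<Sum>l\<in>letters n. X l * ((if fst l = Proper b then g (Proper a, snd l) else 0)
       - (if snd l = a then g (fst l, b) else 0)))
       = (\<Sum>i=1..n. \<Sum>j=1..n. if i = b then X (Proper i, j) * g (Proper a, j) else 0)
       - (\<Sum>i=1..n. \<Sum>j=1..n. if j = a then X (Proper i, j) * g (Proper i, b) else 0)"
        unfolding sum_letters sum_subtractf[symmetric] by (intro sum.cong refl) (auto simp: right_diff_distrib)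
      also have "\<dots> = (\<Sum>j=1..n. X (Proper b, j) * g (Proper a, j))
         - (\<Sum>i=1..n. X (Proper i, a) * g (Proper i, b))"
        unfolding i1 using ab by (simp add: sum.delta)
      finally show "(\<Sum>j=1..n. X (Proper b, j) * g (Proper a, j))
         - (\<Sum>i=1..n. X (Proper i, a) * g (Proper i, b))
        = (\<Sum>l\<in>letters n. X l * ((if fst l = Proper b then g (Proper a, snd l) else 0)
       - (if snd l = a then g (fst l, b) else 0)))" ..
    qed
    finally show ?thesis .
  qed
  have "(\<Sum>p<length (X # Xs). mlin n f ((X # Xs)[p := commut n A ((X # Xs) ! p)]))
    = mlin n f (commut n A X # Xs) + (\<Sum>p<length Xs. \<Sum>l\<in>letters n. X l * mlin n (\<lambda>w. f (l # w)) (Xs[p := commut n A (Xs ! p)]))"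
    unfolding length_Cons sum.lessThan_Suc_shift by simp
  also have "(\<Sum>p<length Xs. \<Sum>l\<in>letters n. X l * mlin n (\<lambda>w. f (l # w)) (Xs[p := commut n A (Xs ! p)]))
    = (\<Sum>l\<in>letters n. X l * (\<Sum>a=1..n. \<Sum>b=1..n. A a b * mlin n (ad_der a b (\<lambda>w. f (l # w))) Xs))"
    by (subst sum.swap) (simp only: sum_distrib_left[symmetric] Cons.IH)
  also have "\<dots> = (\<Sum>a=1..n. \<Sum>b=1..n. A a b * (\<Sum>l\<in>letters n. X l * mlin n (ad_der a b (\<lambda>w. f (l # w))) Xs))"
  proof -
    have "(\<Sum>l\<in>letters n. X l * (\<Sum>a=1..n. \<Sum>b=1..n. A a b * mlin n (ad_der a b (\<lambda>w. f (l # w))) Xs))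
      = (\<Sum>l\<in>letters n. \<Sum>a=1..n. \<Sum>b=1..n. A a b * (X l * mlin n (ad_der a b (\<lambda>w. f (l # w))) Xs))"
      by (simp add: sum_distrib_left mult.left_commute)
    also have "\<dots> = (\<Sum>a=1..n. \<Sum>l\<in>letters n. \<Sum>b=1..n. A a b * (X l * mlin n (ad_der a b (\<lambda>w. f (l # w))) Xs))"
      by (rule sum.swap)
    also have "\<dots> = (\<Sum>a=1..n. \<Sum>b=1..n. \<Sum>l\<in>letters n. A a b * (X l * mlin n (ad_der a b (\<lambda>w. f (l # w))) Xs))"
      by (rule sum.cong[OF refl], rule sum.swap)
    finally show ?thesis by (simp add: sum_distrib_left)
  qed
  also have "mlin n f (commut n A X # Xs) + \<dots> = (\<Sum>a=1..n. \<Sum>b=1..n. A a b * mlin n (ad_der a b f) (X # Xs))"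
  proof -
    have "mlin n (ad_der a b f) (X # Xs) = (\<Sum>l\<in>letters n. X l * ((if fst l = Proper b then g (Proper a, snd l) else 0)
       - (if snd l = a then g (fst l, b) else 0))) + (\<Sum>l\<in>letters n. X l * mlin n (ad_der a b (\<lambda>w. f (l # w))) Xs)" for a b
    proof -
      have "mlin n (\<lambda>w. ad_der a b f (l # w)) Xs = (if fst l = Proper b then g (Proper a, snd l) else 0)
       - (if snd l = a then g (fst l, b) else 0) + mlin n (ad_der a b (\<lambda>w. f (l # w))) Xs" for l
        by (simp add: mlin_add mlin_diff g_def mlin_zero)
      then show ?thesis by (simp add: sum.distrib distrib_left)
    qed
    then show ?thesis unfolding head by (simp add: sum.distrib distrib_left)
  qed
  finally show ?case .
qed simp

section \<open>The companion slice\<close>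

definition slice :: "nat \<Rightarrow> (nat \<Rightarrow> complex) \<Rightarrow> letter \<Rightarrow> complex" where
  "slice n v l = (case fst l of Proper i \<Rightarrow> if snd l = n then v i else if i = Suc (snd l) then 1 else 0 | _ \<Rightarrow> 0)"

text \<open>The tangent vectors of the slice.\<close>

definition lastcol :: "nat \<Rightarrow> (nat \<Rightarrow> complex) \<Rightarrow> letter \<Rightarrow> complex" where
  "lastcol n v l = (case fst l of Proper i \<Rightarrow> if snd l = n then v i else 0 | _ \<Rightarrow> 0)"

lemma slice_add: "(\<lambda>l. 1 * slice n v l + e * lastcol n u l) = slice n (\<lambda>i. v i + e * u i)"
  by (rule ext) (auto simp: slice_def lastcol_def split: symbol.split)

text \<open>Column \<open>j + 1\<close> of a matrix \<open>A\<close> such that \<open>[A, C]\<close> and \<open>Y\<close> agree outside the last column: as \<open>C\<close> maps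
  the \<open>j\<close>-th basis vector to the next one, column \<open>j\<close> of \<open>A C - C A = Y\<close> reads \<open>A_{j+1} = C A_j + Y_j\<close>.\<close>

fun transv :: "nat \<Rightarrow> (letter \<Rightarrow> complex) \<Rightarrow> (letter \<Rightarrow> complex) \<Rightarrow> nat \<Rightarrow> nat \<Rightarrow> complex" where
  "transv n C Y 0 i = 0"
| "transv n C Y (Suc j) i = (if j = 0 then 0 else (\<Sum>m=1..n. C (Proper i, m) * transv n C Y j m) + Y (Proper i, j))"

lemma slice_transversal:
  "\<exists>A u. \<forall>l\<in>letters n. Y l = commut n A (slice n v) l + lastcol n u l"
proof -
  define A where "A i j = transv n (slice n v) Y j i" for i j
  \<comment> \<open>The last column of Y is not reached by the recursion; u absorbs whatever remains
    there.\<close>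
  define u where "u i = Y (Proper i, n) - commut n A (slice n v) (Proper i, n)" for i
  have "Y l = commut n A (slice n v) l + lastcol n u l" if l: "l \<in> letters n" for l
  proof -
    obtain i j where ij: "l = (Proper i, j)" "i \<in> {1..n}" "j \<in> {1..n}"
      using l by (auto simp: letters_def proper_symbols_def)
    show ?thesis
    proof (cases "j = n")
      case True
      then show ?thesis by (simp add: ij lastcol_def u_def)
    next
      case False
      then have j: "Suc j \<in> {1..n}" "j \<noteq> 0" using ij(3) by auto
      have "A i m * slice n v (Proper m, j) = (if m = Suc j then A i m else 0)" for m
        using False by (auto simp: slice_def)
      then have "(\<Sum>m=1..n. A i m * slice n v (Proper m, j)) = A i (Suc j)"
        using j by (simp add: sum.delta)
      moreover have "A i (Suc j) = (\<Sum>m=1..n. slice n v (Proper i, m) * A m j) + Y (Proper i, j)"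
        using j(2) by (simp add: A_def)
      ultimately show ?thesis
        using False by (simp add: ij commut_def lastcol_def sum_subtractf)
    qed
  qed
  then show ?thesis by blast
qed

text \<open>Differentiation along the slice in algebraic form: on a line the form is a polynomial in
  the parameter e, and by symmetry its linear coefficient is r equal terms. The extra arguments
  \<open>Ys\<close> let the induction park expanded slots at the end.\<close>

lemma mlin_slice_poly:
  assumes "swap_inv f"
  shows "\<exists>p. (\<forall>e. mlin n f (replicate r (slice n (\<lambda>i. v i + e * u i)) @ Ys) = poly p e) \<and>
    coeff p 0 = mlin n f (replicate r (slice n v) @ Ys) \<and>
    coeff p 1 = of_nat r * mlin n f (lastcol n u # replicate (r - 1) (slice n v) @ Ys)"
proof (induction r arbitrary: Ys)
  case 0
  show ?case by (rule exI[of _ "[:mlin n f Ys:]"]) simp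
next
  case (Suc r)
  let ?C = "slice n v" and ?S = "lastcol n u"
  let ?Ce = "\<lambda>e. slice n (\<lambda>i. v i + e * u i)"
  obtain p1 where p1: "\<And>e. mlin n f (replicate r (?Ce e) @ ?C # Ys) = poly p1 e"
    "coeff p1 0 = mlin n f (replicate r ?C @ ?C # Ys)"
    "coeff p1 1 = of_nat r * mlin n f (?S # replicate (r - 1) ?C @ ?C # Ys)"
    using Suc[of "?C # Ys"] by blast
  obtain p2 where p2: "\<And>e. mlin n f (replicate r (?Ce e) @ ?S # Ys) = poly p2 e"
    "coeff p2 0 = mlin n f (replicate r ?C @ ?S # Ys)"
    using Suc[of "?S # Ys"] by blast
  have "mlin n f (replicate (Suc r) (?Ce e) @ Ys) = poly (p1 + [:0, 1:] * p2) e" for e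
  proof -
    have "mlin n f (replicate (Suc r) (?Ce e) @ Ys) = 1 * mlin n f (?C # replicate r (?Ce e) @ Ys)
       + e * mlin n f (?S # replicate r (?Ce e) @ Ys)"
      unfolding replicate_Suc append_Cons slice_add[symmetric, of n v e u] by (rule mlin_head_lin)
    also have "\<dots> = poly (p1 + [:0, 1:] * p2) e"
      by (simp only: mlin_move[OF assms, symmetric] p1(1) p2(1)) simp
    finally show ?thesis .
  qed
  moreover have "coeff (p1 + [:0, 1:] * p2) 0 = mlin n f (replicate (Suc r) ?C @ Ys)"
    using p1(2) by (simp add: mlin_move[OF assms] del: mlin.simps)
  moreover have "coeff (p1 + [:0, 1:] * p2) 1 = of_nat (Suc r) * mlin n f (?S # replicate (Suc r - 1) ?C @ Ys)"
  proof -
    have a: "of_nat r * mlin n f (?S # replicate (r - 1) ?C @ ?C # Ys) = of_nat r * mlin n f (?S # replicate r ?C @ Ys)"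
      by (cases r) (auto simp del: mlin.simps intro!: mlin_mset[OF assms])
    have b: "mlin n f (replicate r ?C @ ?S # Ys) = mlin n f (?S # replicate r ?C @ Ys)"
      by (rule mlin_move[OF assms])
    have "coeff (p1 + [:0, 1:] * p2) 1 = coeff p1 1 + coeff p2 0" by simp
    then show ?thesis unfolding p1(3) p2(2) a b by (simp add: algebra_simps del: mlin.simps)
  qed
  ultimately show ?case by blast
qed

text \<open>Induction on the number \<open>k\<close> of arguments that are free, the other \<open>d - k\<close> being equal to a point \<open>C\<close> of
  the slice: invariance frees an argument in the directions \<open>[A, C]\<close>, and differentiation along the slice
  frees it in the last column.\<close>

theorem slice_vanishing:
  assumes sym: "swap_inv f" and inv: "\<And>a b w. a \<in> {1..n} \<Longrightarrow> b \<in> {1..n} \<Longrightarrow> ad_der a b f w = 0"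
    and van: "\<And>v. mlin n f (replicate d (slice n v)) = 0"
  shows "set w \<subseteq> letters n \<Longrightarrow> length w = d \<Longrightarrow> f w = 0"
proof -
  have main: "mlin n f (replicate (d - k) (slice n v) @ Ys) = 0" if "length Ys = k" "k \<le> d" for k v Ys
    using that
  proof (induction k arbitrary: v Ys)
    case 0
    then show ?case using van by simp
  next
    case (Suc k)
    then obtain Y Zs where Ys: "Ys = Y # Zs" "length Zs = k" by (cases Ys) auto
    let ?C = "slice n v"
    define r where "r = d - k - 1"
    have r: "d - k = Suc r" "d - Suc k = r" using Suc.prems(2) by (auto simp: r_def)
    obtain A u where Au: "\<And>l. l \<in> letters n \<Longrightarrow> Y l = commut n A ?C l + lastcol n u l"
      using slice_transversal[of n Y v] by blast
    have 1: "mlin n f (commut n A ?C # replicate r ?C @ Zs) = 0"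
    proof -
      \<comment> \<open>Invariance is applied with d - k copies of C followed by \<open>Zs\<close>.
        Each slot holding C gives the value wanted, by symmetry; a slot in \<open>Zs\<close> leaves
        d - k copies of C in place, so the induction hypothesis removes it.\<close>
      let ?Xs = "replicate (Suc r) ?C @ Zs"
      have "(\<Sum>p<length ?Xs. mlin n f (?Xs[p := commut n A (?Xs ! p)])) = 0"
      proof -
        have "ad_der a b f = (\<lambda>w. 0)" if "a \<in> {1..n}" "b \<in> {1..n}" for a b
          using inv[OF that] by (rule ext)
        then show ?thesis
          unfolding mlin_ad_der by (intro sum.neutral ballI) (simp add: mlin_zero del: mlin.simps)
      qed
      moreover have "(\<Sum>p<length ?Xs. mlin n f (?Xs[p := commut n A (?Xs ! p)]))
        = (\<Sum>p<length ?Xs. if p < Suc r then mlin n f (commut n A ?C # replicate r ?C @ Zs) else 0)"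
      proof (intro sum.cong refl)
        fix p assume p: "p \<in> {..<length ?Xs}"
        show "mlin n f (?Xs[p := commut n A (?Xs ! p)]) = (if p < Suc r then mlin n f (commut n A ?C # replicate r ?C @ Zs) else 0)"
        proof (cases "p < Suc r")
          case True
          then have n: "?Xs ! p = ?C" by (simp only: nth_append length_replicate if_True nth_replicate)
          have "mset (?Xs[p := commut n A ?C]) = add_mset (commut n A ?C) (mset ?Xs - {#?Xs ! p#})"
            using p by (intro mset_update) auto
          also have "\<dots> = mset (commut n A ?C # replicate r ?C @ Zs)"
            unfolding n by simp
          finally have m: "mset (?Xs[p := commut n A ?C]) = mset (commut n A ?C # replicate r ?C @ Zs)" .
          show ?thesis
            unfolding n if_P[OF True] by (rule mlin_mset[OF sym m])
        next
          case False
          have "?Xs[p := commut n A (?Xs ! p)] = replicate (Suc r) ?C @ Zs[p - Suc r := commut n A (?Xs ! p)]"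
            using False by (simp only: list_update_append length_replicate if_False)
          moreover have "mlin n f (replicate (d - k) ?C @ Zs[p - Suc r := commut n A (?Xs ! p)]) = 0"
            using Suc.prems Ys by (intro Suc.IH) auto
          ultimately show ?thesis using False r(1) by (simp del: mlin.simps replicate_Suc)
        qed
      qed
      moreover have "\<dots> = of_nat (Suc r) * mlin n f (commut n A ?C # replicate r ?C @ Zs)"
      proof -
        have capelli_alg: "(\<Sum>p<N. if p < m then c else 0) = of_nat m * c" if "m \<le> N" for m N and c :: complex
        proof -
          have capelli_alg: "(\<Sum>p<N. if p < m then c else 0) = (\<Sum>p<m. c)"
            by (rule sum.mono_neutral_cong_right) (use that in auto)
          then show ?thesis by simp
        qed
        show ?thesis by (rule capelli_alg) simp
      qed
      ultimately have "of_nat (Suc r) * mlin n f (commut n A ?C # replicate r ?C @ Zs) = 0" by simp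
      then show ?thesis by (metis mult_eq_0_iff of_nat_eq_0_iff nat.distinct(1))
    qed
    have 2: "mlin n f (lastcol n u # replicate r ?C @ Zs) = 0"
    proof -
      obtain p where p: "\<And>e. mlin n f (replicate (Suc r) (slice n (\<lambda>i. v i + e * u i)) @ Zs) = poly p e"
        "coeff p 1 = of_nat (Suc r) * mlin n f (lastcol n u # replicate (Suc r - 1) ?C @ Zs)"
        using mlin_slice_poly[OF sym, of n "Suc r" v u Zs] by blast
      \<comment> \<open>The whole line lies in the slice, so the induction hypothesis kills the
        polynomial and with it the linear coefficient.\<close>
      have "poly p e = 0" for e
        unfolding p(1)[symmetric] r(1)[symmetric] using Suc.prems Ys by (intro Suc.IH) auto
      then have "p = 0" by (metis poly_0 poly_eq_poly_eq_iff ext)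
      then have "of_nat (Suc r) * mlin n f (lastcol n u # replicate r ?C @ Zs) = 0"
        using p(2) by simp
      then show ?thesis by (metis mult_eq_0_iff of_nat_eq_0_iff nat.distinct(1))
    qed
    have "mlin n f (replicate r ?C @ Y # Zs) = mlin n f (Y # replicate r ?C @ Zs)"
      by (rule mlin_move[OF sym])
    also have "\<dots> = mlin n f ((\<lambda>l. 1 * commut n A ?C l + 1 * lastcol n u l) # replicate r ?C @ Zs)"
      by (rule mlin_head_cong) (simp add: Au)
    also have "\<dots> = 0" unfolding mlin_head_lin 1 2 by simp
    finally show ?case unfolding r(2) Ys .
  qed
  assume w: "set w \<subseteq> letters n" "length w = d"
  \<comment> \<open>Evaluation at elementary matrices recovers the individual coefficients of a
    form.\<close>
  have "mlin n g (map (\<lambda>l l'. if l' = l then 1 else 0) w) = g w" if "set w \<subseteq> letters n" for g w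
    using that
  proof (induction w arbitrary: g)
    case (Cons l w)
    then have "(\<Sum>l'\<in>letters n. (if l' = l then 1 else 0) * mlin n (\<lambda>w. g (l' # w)) (map (\<lambda>l l'. if l' = l then 1 else 0) w))
      = (\<Sum>l'\<in>letters n. if l' = l then g (l # w) else 0)"
      by (intro sum.cong) auto
    with Cons.prems finite_letters show ?case by (simp add: sum.delta)
  qed simp
  moreover have "mlin n f (map (\<lambda>l l'. if l' = l then 1 else 0) w) = 0"
    using main[of "map (\<lambda>l l'. if l' = l then 1 else 0) w" d] w by simp
  ultimately show "f w = 0" using w by simp
qed

section \<open>Generation of the centre\<close>

instantiation complex :: complex_algebra
begin
definition scaleC_complex :: "complex \<Rightarrow> complex \<Rightarrow> complex" where
  "scaleC_complex c x = c * x"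
instance
  by standard (simp_all add: scaleC_complex_def algebra_simps)
end

instantiation poly :: ("{comm_ring_1, complex_algebra}") complex_algebra
begin
definition scaleC_poly :: "complex \<Rightarrow> 'a poly \<Rightarrow> 'a poly" where
  "scaleC_poly c p = smult (c *\<^sub>C 1) p"
instance
proof
  fix c d :: complex and p q :: "'a poly"
  show "c *\<^sub>C (p + q) = c *\<^sub>C p + c *\<^sub>C q"
    unfolding scaleC_poly_def by (rule smult_add_right)
  show "(c + d) *\<^sub>C p = c *\<^sub>C p + d *\<^sub>C p"
    unfolding scaleC_poly_def scaleC_add_left by (rule smult_add_left)
  show "c *\<^sub>C d *\<^sub>C p = (c * d) *\<^sub>C p"
    unfolding scaleC_poly_def smult_smult by (simp only: mult_scaleC_left mult_1_left scaleC_scaleC)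
  show "1 *\<^sub>C p = p"
    unfolding scaleC_poly_def by (simp only: scaleC_one smult_1_left)
  show "c *\<^sub>C p * q = c *\<^sub>C (p * q)"
    unfolding scaleC_poly_def by (rule mult_smult_left)
  show "p * c *\<^sub>C q = c *\<^sub>C (p * q)"
    unfolding scaleC_poly_def by (rule mult_smult_right)
qed
end

text \<open>Every unit becomes a multiple of the variable, so the coefficient in degree d is the
  homogeneous part of degree d, made commutative and evaluated at X. Being an evaluation, this is
  multiplicative.\<close>

definition sym_poly :: "(letter \<Rightarrow> complex) \<Rightarrow> unit_symbol fa \<Rightarrow> complex poly" where
  "sym_poly X = eval (\<lambda>x. [:0, X (dual_letter x):])"

lemma sym_poly_wd: "sym_poly X (wd v) = monom (\<Prod>x\<leftarrow>v. X (dual_letter x)) (length v)"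
  unfolding sym_poly_def eval_wd
  by (induction v) (auto simp: monom_Suc smult_monom one_pCons monom_0)

lemma coeff_sym_poly: "coeff (sym_poly X t) m
  = (\<Sum>v | coeffs t v \<noteq> 0. if length v = m then coeffs t v * (\<Prod>x\<leftarrow>v. X (dual_letter x)) else 0)"
proof -
  have "sym_poly X t = (\<Sum>v | coeffs t v \<noteq> 0. coeffs t v *\<^sub>C sym_poly X (wd v))"
    by (simp add: sym_poly_def eval_def[of _ t])
  then show ?thesis
    by (auto simp: coeff_sum sym_poly_wd scaleC_poly_def scaleC_complex_def intro!: sum.cong)
qed

lemma coeff_sym_poly_high: "deg_lt (Suc d) t \<Longrightarrow> d < m \<Longrightarrow> coeff (sym_poly X t) m = 0"
  unfolding coeff_sym_poly by (rule sum.neutral) (auto simp: deg_lt_def less_Suc_eq_le)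

lemma sym_poly_mult: "sym_poly X (a * b) = sym_poly X a * sym_poly X b"
  and sym_poly_one: "sym_poly X 1 = 1"
  and sym_poly_scaleC: "sym_poly X (c *\<^sub>C a) = smult c (sym_poly X a)"
  and sym_poly_zero: "sym_poly X 0 = 0"
  by (simp_all add: sym_poly_def scaleC_poly_def scaleC_complex_def)

lemma coeff_sym_poly_mult:
  assumes "deg_lt (Suc a) s" "deg_lt (Suc b) t"
  shows "coeff (sym_poly X (s * t)) (a + b) = coeff (sym_poly X s) a * coeff (sym_poly X t) b"
proof -
  have "coeff (sym_poly X (s * t)) (a + b) = (\<Sum>i\<le>a + b. coeff (sym_poly X s) i * coeff (sym_poly X t) (a + b - i))"
    by (simp add: sym_poly_mult coeff_mult)
  also have "\<dots> = (\<Sum>i\<in>{a}. coeff (sym_poly X s) i * coeff (sym_poly X t) (a + b - i))"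
  proof (rule sum.mono_neutral_right)
    show "\<forall>i\<in>{..a + b} - {a}. coeff (sym_poly X s) i * coeff (sym_poly X t) (a + b - i) = 0"
    proof
      fix i assume "i \<in> {..a + b} - {a}"
      then consider "i > a" | "a + b - i > b" by fastforce
      then show "coeff (sym_poly X s) i * coeff (sym_poly X t) (a + b - i) = 0"
        using coeff_sym_poly_high[OF assms(1)] coeff_sym_poly_high[OF assms(2)] by cases auto
    qed
  qed auto
  finally show ?thesis by simp
qed

text \<open>Words longer than d are invisible to f, so the derivation has to delete a letter; any of
  the d + 1 equal arguments may be the one that supplies it.\<close>

lemma mlin_der:
  assumes "\<And>w. d < length w \<Longrightarrow> f w = 0" "a \<in> {1..n}" "b \<in> {1..n}"
  shows "mlin n (der (Proper a) (Proper b) f) (replicate (Suc d) X)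
    = of_nat (Suc d) * (X (Proper b, a) * mlin n f (replicate d X))"
  using assms(1)
proof (induction d arbitrary: f)
  case (0 f)
  have e: "mlin n (\<lambda>w. der (Proper a) (Proper b) f (l # w)) [] = (if l = (Proper b, a) then f [] else 0)" for l
    using 0 by (cases l) (auto simp: const_part_def)
  have "(Proper b, a) \<in> letters n" using assms by (auto simp: letters_def proper_symbols_def)
  then show ?case
    unfolding replicate_Suc mlin.simps(2) replicate_0 e using finite_letters
    by (simp add: if_distrib[of "\<lambda>x. _ * x"] sum.delta cong: if_cong)
next
  case (Suc d f)
  let ?X = "replicate (Suc d) X"
  have e: "mlin n (\<lambda>w. der (Proper a) (Proper b) f (l # w)) ?X
    = (if l = (Proper b, a) then mlin n f ?X else 0)
      + of_nat (Suc d) * (X (Proper b, a) * mlin n (\<lambda>w. f (l # w)) (replicate d X))" for l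
  proof -
    have "mlin n (\<lambda>w. der (Proper a) (Proper b) f (l # w)) ?X
      = mlin n (\<lambda>w. (if l = (Proper b, a) then 1 else 0) * f w + der (Proper a) (Proper b) (\<lambda>w. f (l # w)) w) ?X"
      by (rule mlin_cong_f) (cases l, use Suc.prems in \<open>auto simp: const_part_def\<close>)
    also have "\<dots> = (if l = (Proper b, a) then 1 else 0) * mlin n f ?X
        + mlin n (der (Proper a) (Proper b) (\<lambda>w. f (l # w))) ?X"
      by (simp only: mlin_add mlin_scale)
    also have "mlin n (der (Proper a) (Proper b) (\<lambda>w. f (l # w))) ?X
      = of_nat (Suc d) * (X (Proper b, a) * mlin n (\<lambda>w. f (l # w)) (replicate d X))"
      by (rule Suc.IH) (use Suc.prems in auto)
    finally show ?thesis by (simp del: mlin.simps replicate_Suc)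
  qed
  have l: "(Proper b, a) \<in> letters n" using assms by (auto simp: letters_def proper_symbols_def)
  have "mlin n (der (Proper a) (Proper b) f) (replicate (Suc (Suc d)) X)
    = (\<Sum>l\<in>letters n. X l * (if l = (Proper b, a) then mlin n f ?X else 0))
      + (\<Sum>l\<in>letters n. X l * (of_nat (Suc d) * (X (Proper b, a) * mlin n (\<lambda>w. f (l # w)) (replicate d X))))"
    unfolding replicate_Suc[of "Suc d"] mlin.simps(2)[of n _ X ?X] e distrib_left sum.distrib ..
  also have "(\<Sum>l\<in>letters n. X l * (if l = (Proper b, a) then mlin n f ?X else 0)) = X (Proper b, a) * mlin n f ?X"
    using l finite_letters by (simp add: if_distrib[of "\<lambda>x. _ * x"] sum.delta cong: if_cong del: mlin.simps replicate_Suc)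
  also have "(\<Sum>l\<in>letters n. X l * (of_nat (Suc d) * (X (Proper b, a) * mlin n (\<lambda>w. f (l # w)) (replicate d X))))
    = of_nat (Suc d) * (X (Proper b, a) * mlin n f ?X)"
    unfolding replicate_Suc mlin.simps(2) sum_distrib_left by (intro sum.cong refl) (simp only: mult_ac)
  finally show ?case by (simp add: algebra_simps del: mlin.simps replicate_Suc)
qed

lemma mlin_pairing_wd:
  assumes "set v \<subseteq> gl_basis n"
  shows "mlin n (pairing (wd v)) (replicate (length v) X) = fact (length v) * (\<Prod>x\<leftarrow>v. X (dual_letter x))"
  using assms
proof (induction v rule: rev_induct)
  case Nil
  then show ?case by (simp add: pairing_Nil counit_def)
next
  case (snoc x v)
  obtain a b where x: "x = (Proper a, Proper b)" "a \<in> {1..n}" "b \<in> {1..n}"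
    using snoc.prems by (auto simp: proper_symbols_def)
  have "mlin n (pairing (wd (v @ [x]))) (replicate (Suc (length v)) X)
    = of_nat (Suc (length v)) * (X (Proper b, a) * mlin n (pairing (wd v)) (replicate (length v) X))"
    unfolding x(1) pairing_snoc by (rule mlin_der) (use x pairing_long in auto)
  with snoc show ?case by (simp add: x(1) dual_letter_def mult_ac del: mlin.simps replicate_Suc)
qed

lemma mlin_sum: "mlin n (\<lambda>w. \<Sum>i\<in>I. f i w) Xs = (\<Sum>i\<in>I. mlin n (f i) Xs)"
  by (induction I rule: infinite_finite_induct) (auto simp: mlin_zero mlin_add)

text \<open>The d factors of a top word may consume d equal arguments in d! ways; shorter words
  cannot consume them all.\<close>

lemma mlin_pairing:
  assumes "t \<in> fa_on (gl_basis n)" "deg_lt (Suc d) t"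
  shows "mlin n (pairing t) (replicate d X) = fact d * coeff (sym_poly X t) d"
proof -
  have "pairing t = (\<lambda>w. \<Sum>v | coeffs t v \<noteq> 0. coeffs t v * pairing (wd v) w)"
    by (rule ext, subst fa_expand[OF finite_supp, of t t]) auto
  then have "mlin n (pairing t) (replicate d X) = (\<Sum>v | coeffs t v \<noteq> 0. coeffs t v * mlin n (pairing (wd v)) (replicate d X))"
    by (simp add: mlin_sum mlin_scale)
  also have "\<dots> = (\<Sum>v | coeffs t v \<noteq> 0. fact d * (if length v = d then coeffs t v * (\<Prod>x\<leftarrow>v. X (dual_letter x)) else 0))"
  proof (intro sum.cong refl)
    fix v assume v: "v \<in> {v. coeffs t v \<noteq> 0}"
    then have v': "set v \<subseteq> gl_basis n" "length v \<le> d"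
      using assms by (auto simp: fa_on_def deg_lt_def less_Suc_eq_le)
    show "coeffs t v * mlin n (pairing (wd v)) (replicate d X)
      = fact d * (if length v = d then coeffs t v * (\<Prod>x\<leftarrow>v. X (dual_letter x)) else 0)"
    proof (cases "length v = d")
      case True
      then show ?thesis using mlin_pairing_wd[OF v'(1), of X] by simp
    next
      case False
      then have "mlin n (pairing (wd v)) (replicate d X) = mlin n (\<lambda>w. 0) (replicate d X)"
        using v' by (intro mlin_cong_f pairing_long) auto
      with False show ?thesis by (simp add: mlin_zero)
    qed
  qed
  also have "\<dots> = fact d * coeff (sym_poly X t) d"
    by (simp add: coeff_sym_poly sum_distrib_left)
  finally show ?thesis .
qed

lemma deg_lt_prod_list:
  "(\<And>x. x \<in> set xs \<Longrightarrow> deg_lt 2 x) \<Longrightarrow> deg_lt (Suc (length xs)) (prod_list xs)"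
proof (induction xs)
  case Nil
  then show ?case by (simp add: deg_lt_def coeffs_one)
next
  case (Cons x xs)
  then have "deg_lt (Suc 1) x" "deg_lt (Suc (length xs)) (prod_list xs)" by (auto simp: numeral_2_eq_2)
  from deg_lt_mult1[OF this] show ?case by simp
qed

lemma deg_lt_one: "deg_lt (Suc d) 1"
  by (auto simp: deg_lt_def coeffs_one)

lemma deg_lt_of_nat: "deg_lt (Suc d) (of_nat m)"
  by (induction m) (auto intro: deg_lt_add deg_lt_one)

lemma deg_lt_of_int: "deg_lt (Suc d) (of_int m)"
  by (cases m) (auto intro: deg_lt_of_nat deg_lt_uminus deg_lt_diff deg_lt_one)

lemma deg_lt_capelli: "deg_lt (Suc k) (capelli gl_e n k)"
  unfolding capelli_def
proof (intro deg_lt_sum)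
  fix "is" \<sigma>
  let ?F = "\<lambda>j. gl_e (is ! (\<sigma> j - 1)) (is ! (j - 1)) + (if \<sigma> j = j then of_nat (k - j) else 0)"
  have "deg_lt 2 (?F j)" for j
    using deg_lt_of_nat[of 1] by (auto simp: gl_e_def numeral_2_eq_2 intro!: deg_lt_add)
  then have "deg_lt (Suc (length (map ?F [1..<k + 1]))) (prod_list (map ?F [1..<k + 1]))"
    by (intro deg_lt_prod_list) auto
  moreover have "length (map ?F [1..<k + 1]) = k" by simp
  ultimately have "deg_lt (Suc k) (prod_list (map ?F [1..<k + 1]))"
    by (simp only:)
  from deg_lt_mult1[where m = 0, OF deg_lt_of_int this]
  show "deg_lt (Suc k) (of_int (sign \<sigma>) * prod_list (map ?F [1..<k + 1]))"
    by (simp only: add_0_left)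
qed

section \<open>Symbols of the Capelli elements on the slice\<close>

lemma coeff_linear_product:
  fixes c x :: "'b \<Rightarrow> 'a::comm_ring_1"
  shows "coeff (prod_list (map (\<lambda>j. [:c j, x j:]) js)) (length js) = prod_list (map x js)"
    and "\<And>m. m > length js \<Longrightarrow> coeff (prod_list (map (\<lambda>j. [:c j, x j:]) js)) m = 0"
proof -
  have "coeff (prod_list (map (\<lambda>j. [:c j, x j:]) js)) (length js) = prod_list (map x js) \<and>
    (\<forall>m > length js. coeff (prod_list (map (\<lambda>j. [:c j, x j:]) js)) m = 0)"
  proof (induction js)
    case (Cons j js)
    let ?p = "prod_list (map (\<lambda>j. [:c j, x j:]) js)"
    have "coeff ([:c j, x j:] * ?p) (Suc m) = c j * coeff ?p (Suc m) + x j * coeff ?p m" for m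
      by simp
    moreover have "m > length (j # js) \<Longrightarrow> \<exists>m'. m = Suc m' \<and> m' > length js" for m
      by (cases m) auto
    ultimately show ?case using Cons by fastforce
  qed simp
  then show "coeff (prod_list (map (\<lambda>j. [:c j, x j:]) js)) (length js) = prod_list (map x js)"
    and "\<And>m. m > length js \<Longrightarrow> coeff (prod_list (map (\<lambda>j. [:c j, x j:]) js)) m = 0" by auto
qed

text \<open>The diagonal shifts are of lower degree and drop out, leaving the sum of principal
  minors of X. Row and column appear exchanged because \<open>dual_letter\<close> exchanges
  them.\<close>

lemma coeff_sym_poly_capelli: "coeff (sym_poly X (capelli gl_e n k)) k = (\<Sum>is\<in>inc_lists k n. \<Sum>\<sigma> | \<sigma> permutes {1..k}.
    of_int (sign \<sigma>) * (\<Prod>j\<leftarrow>[1..<k + 1]. X (Proper (is ! (j - 1)), is ! (\<sigma> j - 1))))"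
proof -
  have e: "sym_poly X (capelli gl_e n k) = (\<Sum>is\<in>inc_lists k n. \<Sum>\<sigma> | \<sigma> permutes {1..k}. of_int (sign \<sigma>) *
     prod_list (map (\<lambda>j. [:if \<sigma> j = j then of_nat (k - j) else 0,
        X (Proper (is ! (j - 1)), is ! (\<sigma> j - 1)):]) [1..<k + 1]))"
  proof -
    have "[:0, x:] + (if b then of_nat m else 0) = [:if b then of_nat m else 0, x:]" for x :: complex and b m
      by (simp add: of_nat_poly)
    then show ?thesis
      unfolding sym_poly_def eval_capelli unfolding capelli_def dual_letter_def by (simp del: upt_Suc)
  qed
  have "coeff (of_int s * p) k = of_int s * coeff p k" for s and p :: "complex poly"
    by (simp add: of_int_poly)
  moreover have "coeff (prod_list (map (\<lambda>j. [:c j, x j:]) [1..<k + 1])) k = prod_list (map x [1..<k + 1])"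
    for c x :: "nat \<Rightarrow> complex"
    using coeff_linear_product(1)[of c x "[1..<k + 1]"] by (simp del: upt_Suc)
  ultimately show ?thesis
    unfolding e by (simp add: coeff_sum del: upt_Suc)
qed

text \<open>The k-cycle moving each position down by one and 1 to k: the only permutation that meets
  nonzero entries of a principal minor of a companion matrix.\<close>

definition down_cycle :: "nat \<Rightarrow> nat \<Rightarrow> nat" where
  "down_cycle k j = (if j = 1 \<and> 1 \<le> k then k else if 2 \<le> j \<and> j \<le> k then j - 1 else j)"

lemma down_cycle_permutes: "down_cycle k permutes {1..k}"
proof (rule bij_imp_permutes)
  have "inj_on (down_cycle k) {1..k}" by (auto simp: inj_on_def down_cycle_def split: if_splits)
  then show "bij_betw (down_cycle k) {1..k} {1..k}"
    by (intro bij_betw_imageI endo_inj_surj) (auto simp: down_cycle_def)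
  show "down_cycle k j = j" if "j \<notin> {1..k}" for j using that by (auto simp: down_cycle_def)
qed

text \<open>A nonzero entry lies in the last column or just below the diagonal. As the indices
  increase, a row therefore either uses the last column or steps down to the preceding position with
  consecutive indices. The first row cannot step down, so it takes the last column and forces all
  other rows to step down.\<close>

lemma slice_term_nonzero:
  assumes i: "is \<in> inc_lists k n" and s: "\<sigma> permutes {1..k}" and k: "1 \<le> k"
    and nz: "\<And>j. j \<in> {1..k} \<Longrightarrow> slice n v (Proper (is ! (j - 1)), is ! (\<sigma> j - 1)) \<noteq> 0"
  shows "\<sigma> = down_cycle k \<and> is = [n - k + 1..<n + 1]"
proof -
  define a where "a j = is ! (j - 1)" for j
  have a_n: "a j \<in> {1..n}" if "j \<in> {1..k}" for j
    unfolding a_def by (rule inc_lists_nth[OF i that])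
  have a_mono: "a j < a j'" if "j \<in> {1..k}" "j' \<in> {1..k}" "j < j'" for j j'
    using i that sorted_wrt_nth_less[of "(<)" "is" "j - 1" "j' - 1"] by (auto simp: a_def inc_lists_def)
  have a_le: "a j < a j' \<longleftrightarrow> j < j'" if "j \<in> {1..k}" "j' \<in> {1..k}" for j j'
    using a_mono[OF that] a_mono[OF that(2,1)] by (cases j j' rule: linorder_cases) auto
  have sk: "\<sigma> j \<in> {1..k}" if "j \<in> {1..k}" for j
    using s that permutes_in_image by fastforce
  have inj: "\<sigma> j = \<sigma> j' \<longleftrightarrow> j = j'" for j j'
    using permutes_inj[OF s] by (auto simp: inj_def)
  have alt: "(a k = n \<and> \<sigma> j = k) \<or> (a j = Suc (a (\<sigma> j)) \<and> Suc (\<sigma> j) = j)" if j: "j \<in> {1..k}" for j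
  proof -
    from nz[OF j] have "a (\<sigma> j) = n \<or> a j = Suc (a (\<sigma> j))"
      by (auto simp: slice_def a_def split: if_splits)
    then show ?thesis
    proof
      assume h: "a (\<sigma> j) = n"
      have "\<not> \<sigma> j < k"
        using a_mono[OF sk[OF j], of k] a_n[of k] k h by auto
      with sk[OF j] h show ?thesis by auto
    next
      assume h: "a j = Suc (a (\<sigma> j))"
      then have "\<sigma> j < j" using a_le[OF sk[OF j] j] by simp
      moreover have "\<not> Suc (\<sigma> j) < j"
      proof
        assume l: "Suc (\<sigma> j) < j"
        have "Suc (\<sigma> j) \<in> {1..k}" using l j by auto
        with a_mono[OF sk[OF j] this] a_mono[OF this j l] h show False by simp
      qed
      ultimately show ?thesis using h by auto
    qed
  qed
  have 1: "a k = n" "\<sigma> 1 = k"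
    using alt[of 1] sk[of 1] k by auto
  have 2: "a j = Suc (a (j - 1)) \<and> \<sigma> j = j - 1" if "2 \<le> j" "j \<le> k" for j
  proof -
    have "\<sigma> j \<noteq> k" using inj[of j 1] 1(2) that by auto
    then have "a j = Suc (a (\<sigma> j))" "Suc (\<sigma> j) = j" using alt[of j] that by auto
    moreover from this(2) have "\<sigma> j = j - 1" by simp
    ultimately show ?thesis by simp
  qed
  have "\<sigma> j = down_cycle k j" for j
  proof (cases "j \<in> {1..k}")
    case True
    then show ?thesis using 1(2) 2[of j] by (cases "j = 1") (auto simp: down_cycle_def)
  next
    case False
    then show ?thesis using s down_cycle_permutes[of k] by (simp add: permutes_not_in)
  qed
  moreover have "is = [n - k + 1..<n + 1]"
  proof -
    have a1: "a (Suc m) = a 1 + m" if "m < k" for m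
      using that
    proof (induction m)
      case (Suc m)
      then show ?case using 2[of "Suc (Suc m)"] by simp
    qed simp
    have "a 1 + (k - 1) = n" using a1[of "k - 1"] 1(1) k by simp
    moreover have "a 1 \<ge> 1" using a_n[of 1] k by simp
    ultimately have "n - k + 1 = a 1" "n + 1 - (n - k + 1) = k" using k by auto
    note n = this
    have l: "length is = k" using i by (simp add: inc_lists_def)
    show ?thesis
    proof (rule nth_equalityI)
      show "length is = length [n - k + 1..<n + 1]" using n(2) l by (simp only: length_upt)
      fix m assume "m < length is"
      then have m: "m < k" using l by simp
      have "is ! m = a (Suc m)" by (simp add: a_def)
      also have "\<dots> = n - k + 1 + m" using a1[OF m] n(1) by simp
      also have "\<dots> = [n - k + 1..<n + 1] ! m" using m n k by (intro nth_upt[symmetric]) auto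
      finally show "is ! m = [n - k + 1..<n + 1] ! m" .
    qed
  qed
  ultimately show ?thesis by auto
qed

text \<open>Up to sign these are the coefficients of the characteristic polynomial of a companion
  matrix, which its last column contains.\<close>

lemma coeff_sym_poly_capelli_slice:
  assumes k: "k \<in> {1..n}"
  shows "coeff (sym_poly (slice n v) (capelli gl_e n k)) k = of_int (sign (down_cycle k)) * v (n - k + 1)"
proof -
  let ?t = "\<lambda>is \<sigma>. of_int (sign \<sigma>) * (\<Prod>j\<leftarrow>[1..<k + 1]. slice n v (Proper (is ! (j - 1)), is ! (\<sigma> j - 1)))"
  let ?i = "[n - k + 1..<n + 1]" and ?P = "{\<sigma>. \<sigma> permutes {1..k}}"
  have z: "?t is \<sigma> = 0" if "is \<in> inc_lists k n" "\<sigma> \<in> ?P" "(is, \<sigma>) \<noteq> (?i, down_cycle k)" for "is" \<sigma>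
  proof -
    have "\<not> (\<forall>j\<in>{1..k}. slice n v (Proper (is ! (j - 1)), is ! (\<sigma> j - 1)) \<noteq> 0)"
    proof
      assume "\<forall>j\<in>{1..k}. slice n v (Proper (is ! (j - 1)), is ! (\<sigma> j - 1)) \<noteq> 0"
      with slice_term_nonzero[of "is" k n \<sigma> v] that(1,2) k
      have "\<sigma> = down_cycle k \<and> is = ?i" by (simp del: upt_Suc)
      with that(3) show False by simp
    qed
    then obtain j where j: "j \<in> {1..k}" "slice n v (Proper (is ! (j - 1)), is ! (\<sigma> j - 1)) = 0"
      by blast
    then have "0 \<in> set (map (\<lambda>j. slice n v (Proper (is ! (j - 1)), is ! (\<sigma> j - 1))) [1..<k + 1])"
      by (force simp del: upt_Suc)
    then show ?thesis by (simp add: prod_list_zero_iff del: upt_Suc)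
  qed
  have i: "?i \<in> inc_lists k n"
    using k by (auto simp: inc_lists_def sorted_wrt_upt simp del: upt_Suc)
  have fin: "finite (inc_lists k n \<times> ?P)"
    by (intro finite_cartesian_product finite_inc_lists finite_permutations) simp
  have "coeff (sym_poly (slice n v) (capelli gl_e n k)) k = (\<Sum>(is, \<sigma>)\<in>inc_lists k n \<times> ?P. ?t is \<sigma>)"
    unfolding coeff_sym_poly_capelli by (rule sum.cartesian_product)
  also have "\<dots> = (\<Sum>(is, \<sigma>)\<in>{(?i, down_cycle k)}. ?t is \<sigma>)"
  proof (rule sum.mono_neutral_right[OF fin])
    show "{(?i, down_cycle k)} \<subseteq> inc_lists k n \<times> ?P" using i down_cycle_permutes by blast
    show "\<forall>x\<in>inc_lists k n \<times> ?P - {(?i, down_cycle k)}. (case x of (is, \<sigma>) \<Rightarrow> ?t is \<sigma>) = 0"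
    proof
      fix x assume x: "x \<in> inc_lists k n \<times> ?P - {(?i, down_cycle k)}"
      obtain "is" \<sigma> where p: "x = (is, \<sigma>)" by (cases x)
      from x have "?t is \<sigma> = 0" unfolding p by (intro z) blast+
      then show "(case x of (is, \<sigma>) \<Rightarrow> ?t is \<sigma>) = 0" unfolding p by (simp only: prod.case)
    qed
  qed
  also have "\<dots> = ?t ?i (down_cycle k)" by simp
  also have "(\<Prod>j\<leftarrow>[1..<k + 1]. slice n v (Proper (?i ! (j - 1)), ?i ! (down_cycle k j - 1))) = v (n - k + 1)"
  proof -
    have "map (\<lambda>j. slice n v (Proper (?i ! (j - 1)), ?i ! (down_cycle k j - 1))) [1..<k + 1]
      = map (\<lambda>j. if j = 1 then v (n - k + 1) else 1) [1..<k + 1]"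
    proof (rule map_cong[OF refl])
      fix j assume "j \<in> set [1..<k + 1]"
      then have j: "1 \<le> j" "j \<le> k" by auto
      have n: "?i ! m = n - k + 1 + m" if "m < k" for m
        using that k by (intro nth_upt) auto
      have c: "down_cycle k j \<in> {1..k}" using down_cycle_permutes[of k] j permutes_in_image by fastforce
      have 1: "?i ! (j - 1) = n - k + j" "?i ! (down_cycle k j - 1) = n - k + down_cycle k j"
        using n[of "j - 1"] n[of "down_cycle k j - 1"] j c k by auto
      show "slice n v (Proper (?i ! (j - 1)), ?i ! (down_cycle k j - 1)) = (if j = 1 then v (n - k + 1) else 1)"
        unfolding 1 using j k by (auto simp: slice_def down_cycle_def)
    qed
    also have "prod_list \<dots> = v (n - k + 1)"
    proof -
      have "[1..<k + 1] = 1 # [2..<k + 1]" using k by (simp add: upt_conv_Cons numeral_2_eq_2 del: upt_Suc)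
      moreover have "map (\<lambda>j. if j = 1 then v (n - k + 1) else 1) [2..<k + 1] = map (\<lambda>j. 1) [2..<k + 1]"
        by (rule map_cong) auto
      ultimately show ?thesis by (simp add: map_replicate_const del: upt_Suc)
    qed
    finally show ?thesis .
  qed
  finally show ?thesis .
qed

section \<open>Lifting functions on the slice to polynomials in Capelli elements\<close>

inductive_set capelli_alg :: "nat \<Rightarrow> unit_symbol fa set" for n where
  capelli_alg_scalar: "c *\<^sub>C 1 \<in> capelli_alg n"
| capelli_alg_capelli: "k \<in> {1..n} \<Longrightarrow> capelli gl_e n k \<in> capelli_alg n"
| capelli_alg_add: "a \<in> capelli_alg n \<Longrightarrow> b \<in> capelli_alg n \<Longrightarrow> a + b \<in> capelli_alg n"
| capelli_alg_mult: "a \<in> capelli_alg n \<Longrightarrow> b \<in> capelli_alg n \<Longrightarrow> a * b \<in> capelli_alg n"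

lemma capelli_alg_central: "a \<in> capelli_alg n \<Longrightarrow> a \<in> central n"
  by (induction rule: capelli_alg.induct) (auto intro: central_scaleC central_one central_add central_mult capelli_central)

lemma capelli_alg_one: "1 \<in> capelli_alg n" and capelli_alg_zero: "0 \<in> capelli_alg n"
  using capelli_alg_scalar[of 1 n] capelli_alg_scalar[of 0 n] by auto

lemma capelli_alg_scaleC: "a \<in> capelli_alg n \<Longrightarrow> c *\<^sub>C a \<in> capelli_alg n"
  using capelli_alg_mult[OF capelli_alg_scalar[of c n], of a] by simp

lemma capelli_alg_sum: "(\<And>i. i \<in> I \<Longrightarrow> f i \<in> capelli_alg n) \<Longrightarrow> sum f I \<in> capelli_alg n"
  by (induction I rule: infinite_finite_induct) (auto intro: capelli_alg_add capelli_alg_zero)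

text \<open>The last-column entry in row i is, up to sign, the symbol of the Capelli element of
  degree n + 1 - i. The other columns are constant on the slice and have weight 0.\<close>

definition slice_wt :: "nat \<Rightarrow> letter \<Rightarrow> nat" where
  "slice_wt n l = (if snd l = n then n + 1 - idx (fst l) else 0)"

text \<open>A product of Capelli elements whose symbol takes on the slice the value of the letter \<open>l\<close>.\<close>

definition slice_lift :: "nat \<Rightarrow> letter \<Rightarrow> unit_symbol fa" where
  "slice_lift n l = (if snd l = n then (1 / of_int (sign (down_cycle (slice_wt n l)))) *\<^sub>C capelli gl_e n (slice_wt n l)
     else if idx (fst l) = Suc (snd l) then 1 else 0)"

lemma slice_wt_range: "l \<in> letters n \<Longrightarrow> snd l = n \<Longrightarrow> slice_wt n l \<in> {1..n}"
  by (auto simp: letters_def slice_wt_def proper_symbols_def)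

lemma slice_lift_capelli_alg: "l \<in> letters n \<Longrightarrow> slice_lift n l \<in> capelli_alg n"
  unfolding slice_lift_def using slice_wt_range[of l n] by (simp add: capelli_alg_one capelli_alg_zero capelli_alg_scaleC capelli_alg_capelli)

lemma slice_lift_deg_lt: "deg_lt (Suc (slice_wt n l)) (slice_lift n l)"
  by (auto simp: slice_lift_def intro: deg_lt_scaleC deg_lt_capelli deg_lt_one)

lemma coeff_sym_poly_slice_lift:
  assumes "l \<in> letters n"
  shows "coeff (sym_poly (slice n v) (slice_lift n l)) (slice_wt n l) = slice n v l"
proof -
  obtain i j where ij: "l = (Proper i, j)" "i \<in> {1..n}" "j \<in> {1..n}"
    using assms by (auto simp: letters_def proper_symbols_def)
  show ?thesis
  proof (cases "j = n")
    case True
    have "n - slice_wt n l + 1 = i" using ij True by (auto simp: slice_wt_def)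
    then show ?thesis
      using slice_wt_range[OF assms] True ij coeff_sym_poly_capelli_slice[of "slice_wt n l" n v]
      by (simp add: slice_lift_def sym_poly_scaleC slice_def sign_def)
  next
    case False
    then show ?thesis using ij by (simp add: slice_lift_def slice_wt_def sym_poly_one sym_poly_zero slice_def)
  qed
qed

text \<open>The degree of the lifted product is the total weight of the word, which in general
  differs from its length.\<close>

lemma slice_lift_word:
  assumes "set w \<subseteq> letters n"
  defines "h \<equiv> prod_list (map (slice_lift n) w)" and "m \<equiv> sum_list (map (slice_wt n) w)"
  shows "h \<in> capelli_alg n \<and> deg_lt (Suc m) h \<and> coeff (sym_poly (slice n v) h) m = prod_list (map (slice n v) w)"
  using assms(1) unfolding h_def m_def
proof (induction w)
  case Nil
  then show ?case by (simp add: capelli_alg_one deg_lt_one sym_poly_one)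
next
  case (Cons l w)
  then have l: "l \<in> letters n" and IH: "prod_list (map (slice_lift n) w) \<in> capelli_alg n"
    "deg_lt (Suc (sum_list (map (slice_wt n) w))) (prod_list (map (slice_lift n) w))"
    "coeff (sym_poly (slice n v) (prod_list (map (slice_lift n) w))) (sum_list (map (slice_wt n) w)) = prod_list (map (slice n v) w)"
    by auto
  have "deg_lt (slice_wt n l + Suc (sum_list (map (slice_wt n) w))) (slice_lift n l * prod_list (map (slice_lift n) w))"
    by (rule deg_lt_mult1[OF slice_lift_deg_lt IH(2)])
  then show ?case
    using IH coeff_sym_poly_mult[OF slice_lift_deg_lt[of n l] IH(2)] coeff_sym_poly_slice_lift[OF l]
    by (auto intro: capelli_alg_mult slice_lift_capelli_alg[OF l])
qed

lemma mlin_replicate: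
  "mlin n f (replicate d X) = (\<Sum>w | set w \<subseteq> letters n \<and> length w = d. f w * prod_list (map X w))"
proof (induction d arbitrary: f)
  case 0
  have "{w. set w \<subseteq> letters n \<and> length w = 0} = {[]}" by auto
  then show ?case by simp
next
  case (Suc d)
  let ?W = "{w. set w \<subseteq> letters n \<and> length w = d}"
  have W: "{w. set w \<subseteq> letters n \<and> length w = Suc d} = (\<lambda>(l, w). l # w) ` (letters n \<times> ?W)"
    by (auto simp: length_Suc_conv image_iff)
  have "mlin n f (replicate (Suc d) X) = (\<Sum>l\<in>letters n. \<Sum>w\<in>?W. f (l # w) * prod_list (map X (l # w)))"
    by (simp add: Suc sum_distrib_left mult_ac)
  also have "\<dots> = (\<Sum>(l, w)\<in>letters n \<times> ?W. f (l # w) * prod_list (map X (l # w)))"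
    by (rule sum.cartesian_product)
  also have "\<dots> = (\<Sum>w | set w \<subseteq> letters n \<and> length w = Suc d. f w * prod_list (map X w))"
    unfolding W by (subst sum.reindex) (auto simp: inj_on_def split_beta)
  finally show ?case .
qed

text \<open>Invariance under diagonal matrices; it forces the Capelli monomials below to have degree \<open>d\<close>.\<close>

lemma balanced:
  assumes "t \<in> central n" "pairing t w \<noteq> 0" "set w \<subseteq> letters n"
  shows "sum_list (map (\<lambda>l. idx (fst l)) w) = sum_list (map snd w)"
proof -
  have c: "count (mset (map fst w)) (Proper b) = count (mset (map snd w)) b" if "b \<in> {1..n}" for b
    using ad_der_diag[of b "pairing t" w] ad_der_pairing[OF assms(1) that that, of w] assms(2) by simp
  have "mset (map (\<lambda>l. idx (fst l)) w) = mset (map snd w)"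
  proof (rule multiset_eqI)
    fix b
    show "count (mset (map (\<lambda>l. idx (fst l)) w)) b = count (mset (map snd w)) b"
    proof (cases "b \<in> {1..n}")
      case True
      have "count (mset (map (\<lambda>l. idx (fst l)) w)) b = count (mset (map fst w)) (Proper b)"
        using assms(3) by (induction w) (auto simp: letters_def proper_symbols_def)
      with c[OF True] show ?thesis by simp
    next
      case False
      then have "b \<notin> set (map (\<lambda>l. idx (fst l)) w)" "b \<notin> set (map snd w)"
        using assms(3) by (auto simp: letters_def proper_symbols_def)
      then show ?thesis by (metis count_mset_0_iff)
    qed
  qed
  then show ?thesis by (metis sum_mset_sum_list)
qed

text \<open>Weighted homogeneity: a letter that is nonzero on the slice has weight plus row equal to
  column plus one, namely (n + 1 - i) + i in the last column and 0 + (j + 1) below the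
  diagonal.\<close>

lemma slice_wt_sum:
  assumes "set w \<subseteq> letters n" "prod_list (map (slice n v) w) \<noteq> 0"
  shows "sum_list (map (slice_wt n) w) + sum_list (map (\<lambda>l. idx (fst l)) w) = sum_list (map snd w) + length w"
  using assms
proof (induction w)
  case (Cons l w)
  have l: "l \<in> letters n" "slice n v l \<noteq> 0" using Cons.prems by auto
  have "slice_wt n l + idx (fst l) = snd l + 1"
    using l by (auto simp: letters_def proper_symbols_def slice_def slice_wt_def split: if_splits)
  with Cons show ?case by auto
qed simp

text \<open>On the slice the form of t is a polynomial in the entries, and lifting each letter makes
  it a polynomial in the Capelli elements. Only words of weight d contribute: for a nonzero pairing
  the row and column sums agree by \<open>balanced\<close>, and then \<open>slice_wt_sum\<close>
  equates weight and length.\<close>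

lemma symbol_match:
  assumes t: "t \<in> central n"
  shows "\<exists>h. h \<in> capelli_alg n \<and> deg_lt (Suc d) h \<and>
    (\<forall>v. mlin n (pairing h) (replicate d (slice n v)) = mlin n (pairing t) (replicate d (slice n v)))"
proof -
  let ?W = "{w. set w \<subseteq> letters n \<and> length w = d}"
  let ?V = "{w \<in> ?W. sum_list (map (slice_wt n) w) = d}"
  have fin: "finite ?W" by (rule finite_lists_length_eq[OF finite_letters])
  \<comment> \<open>The division by d! anticipates the factor in
    \<open>mlin_pairing\<close>.\<close>
  define h where "h = (\<Sum>w\<in>?V. (pairing t w / fact d) *\<^sub>C prod_list (map (slice_lift n) w))"
  have hg: "h \<in> capelli_alg n"
    unfolding h_def using slice_lift_word by (intro capelli_alg_sum capelli_alg_scaleC) auto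
  have hd: "deg_lt (Suc d) h"
    unfolding h_def
  proof (intro deg_lt_sum deg_lt_scaleC)
    fix w assume "w \<in> ?V"
    then show "deg_lt (Suc d) (prod_list (map (slice_lift n) w))"
      using slice_lift_word[of w n] by auto
  qed
  have "mlin n (pairing h) (replicate d (slice n v)) = mlin n (pairing t) (replicate d (slice n v))" for v
  proof -
    have "mlin n (pairing h) (replicate d (slice n v)) = fact d * coeff (sym_poly (slice n v) h) d"
      using hg capelli_alg_central central_fa_on hd by (intro mlin_pairing) auto
    also have "coeff (sym_poly (slice n v) h) d = (\<Sum>w\<in>?V. (pairing t w / fact d) * coeff (sym_poly (slice n v) (prod_list (map (slice_lift n) w))) d)"
      unfolding h_def sym_poly_def eval_sum eval_scaleC
      by (simp add: coeff_sum scaleC_poly_def scaleC_complex_def)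
    also have "\<dots> = (\<Sum>w\<in>?V. (pairing t w / fact d) * prod_list (map (slice n v) w))"
    proof (intro sum.cong refl arg_cong2[of _ _ _ _ "(*)"])
      fix w assume w: "w \<in> ?V"
      then show "coeff (sym_poly (slice n v) (prod_list (map (slice_lift n) w))) d = prod_list (map (slice n v) w)"
        using slice_lift_word[of w n v] by auto
    qed
    also have "\<dots> = (\<Sum>w\<in>?W. (pairing t w / fact d) * prod_list (map (slice n v) w))"
    proof (rule sum.mono_neutral_left[OF fin])
      show "\<forall>w\<in>?W - ?V. (pairing t w / fact d) * prod_list (map (slice n v) w) = 0"
      proof
        fix w assume w: "w \<in> ?W - ?V"
        show "(pairing t w / fact d) * prod_list (map (slice n v) w) = 0"
        proof (rule ccontr)
          assume "(pairing t w / fact d) * prod_list (map (slice n v) w) \<noteq> 0"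
          then have "pairing t w \<noteq> 0" "prod_list (map (slice n v) w) \<noteq> 0" by auto
          with balanced[OF t, of w] slice_wt_sum[of w n v] w show False by auto
        qed
      qed
    qed auto
    also have "fact d * \<dots> = mlin n (pairing t) (replicate d (slice n v))"
      unfolding mlin_replicate by (simp add: sum_distrib_left)
    finally show ?thesis .
  qed
  with hg hd show ?thesis by blast
qed

theorem central_generated:
  assumes "t \<in> central n"
  shows "\<exists>g\<in>capelli_alg n. t - g \<in> env_ker (proper_symbols n)"
proof -
  obtain d where "deg_lt d t" using deg_lt_exists by blast
  \<comment> \<open>The induction is on the vanishing of the pairing at long words, since
    subtracting h lowers the degree of t only modulo the relations.\<close>
  then have "\<forall>w. d \<le> length w \<and> set w \<subseteq> letters n \<longrightarrow> pairing t w = 0" using pairing_deg_lt by blast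
  then show ?thesis using assms
  proof (induction d arbitrary: t)
    case 0
    have "t \<in> env_ker (proper_symbols n)"
      by (rule pairing_faithful) (use 0 central_fa_on in auto)
    then show ?case using capelli_alg_zero by (intro bexI[of _ 0]) auto
  next
    case (Suc d)
    obtain h where h: "h \<in> capelli_alg n" "deg_lt (Suc d) h"
      "\<And>v. mlin n (pairing h) (replicate d (slice n v)) = mlin n (pairing t) (replicate d (slice n v))"
      using symbol_match[OF Suc.prems(2), of d] by blast
    have hc: "h \<in> central n" using h(1) by (rule capelli_alg_central)
    have tc: "t - h \<in> central n"
      using central_add[OF Suc.prems(2) central_scaleC[OF hc, of "- 1"]] by (simp add: scaleC_minus_left)
    have "pairing (t - h) w = 0" if w: "d \<le> length w" "set w \<subseteq> letters n" for w
    proof (cases "length w = d")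
      case True
      show ?thesis
      proof (rule slice_vanishing[of "pairing (t - h)" n d])
        show "swap_inv (pairing (t - h))" using tc central_fa_on swap_inv_pairing by blast
        show "ad_der a b (pairing (t - h)) w = 0" if "a \<in> {1..n}" "b \<in> {1..n}" for a b w
          using that tc by (intro ad_der_pairing)
        have "pairing (t - h) = (\<lambda>w. pairing t w - pairing h w)" by (simp add: fun_eq_iff)
        then show "mlin n (pairing (t - h)) (replicate d (slice n v)) = 0" for v
          by (simp add: mlin_diff h(3))
      qed (use w True in auto)
    next
      case False
      with w have "Suc d \<le> length w" by simp
      then show ?thesis using Suc.prems(1) w pairing_deg_lt[OF h(2)] by simp
    qed
    with Suc.IH[of "t - h"] tc obtain g where "g \<in> capelli_alg n" "t - h - g \<in> env_ker (proper_symbols n)" by blast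
    then show ?case using capelli_alg_add[OF h(1)] by (intro bexI[of _ "h + g"]) (auto simp: diff_diff_eq)
  qed
qed

section \<open>Shifted symmetric functions\<close>

definition falling :: "complex \<Rightarrow> nat \<Rightarrow> complex" where
  "falling x a = (\<Prod>b<a. x - of_nat b)"

lemma falling_0 [simp]: "falling x 0 = 1"
  by (simp add: falling_def)

lemma falling_Suc: "falling x (Suc a) = falling x a * (x - of_nat a)"
  by (simp add: falling_def)

lemma falling_shift: "falling (x + 1) (Suc a) = (x + 1) * falling x a"
  unfolding falling_def prod.lessThan_Suc_shift by simp

lemma falling_diff: "falling (x + 1) (Suc a) - falling x (Suc a) = of_nat (Suc a) * falling x a"
  unfolding falling_shift unfolding falling_Suc by (simp add: algebra_simps)

text \<open>The shifted complete symmetric polynomial, the sum over weakly increasing i_1, ..., i_k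
  of the products of x_{i_j} - (k - j). Here a is the multiplicity of the first variable, whose
  factors are shifted by the number of factors after them.\<close>

fun shifted_h :: "complex list \<Rightarrow> nat \<Rightarrow> complex" where
  "shifted_h [] k = (if k = 0 then 1 else 0)"
| "shifted_h (x # xs) k = (\<Sum>a\<le>k. falling (x - of_nat (k - a)) a * shifted_h xs (k - a))"

text \<open>The elementary counterpart, over strictly increasing indices and with x_{i_j} + (k -
  j).\<close>

fun shifted_e :: "complex list \<Rightarrow> nat \<Rightarrow> complex" where
  "shifted_e [] k = (if k = 0 then 1 else 0)"
| "shifted_e (x # xs) 0 = 1"
| "shifted_e (x # xs) (Suc k) = (x + of_nat k) * shifted_e xs k + shifted_e xs (Suc k)"

lemma shifted_e_0 [simp]: "shifted_e xs 0 = 1"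
  by (cases xs) auto

lemma shifted_e_append_zeros: "shifted_e (xs @ replicate z 0) k = shifted_e xs k"
proof (induction xs arbitrary: k)
  case Nil
  show ?case
  proof (induction z arbitrary: k)
    case (Suc z)
    show ?case by (cases k) (use Suc in auto)
  qed simp
next
  case (Cons x xs)
  then show ?case by (cases k) auto
qed

text \<open>Prepending a part m to a partition raises m parts of its conjugate by one. The right
  side is built so as to be the recursion of \<open>shifted_h\<close> with first variable m, the
  number of variables here.\<close>

lemma shifted_e_shift: "shifted_e (map (\<lambda>x. x + 1) xs) k = (\<Sum>a\<le>k. falling (of_nat (length xs) - of_nat (k - a)) a * shifted_e xs (k - a))"
proof (induction xs arbitrary: k)
  case Nil
  have "falling (0 - of_nat (k - a)) a * shifted_e [] (k - a) = (if a = k then falling 0 k else 0)" if "a \<le> k" for a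
    using that by auto
  then have "(\<Sum>a\<le>k. falling (0 - of_nat (k - a)) a * shifted_e [] (k - a)) = (\<Sum>a\<le>k. if a = k then falling 0 k else 0)"
    by (intro sum.cong) auto
  also have "\<dots> = (if k = 0 then 1 else 0)"
    by (auto simp: falling_def intro!: bexI[of _ 0])
  finally show ?case by simp
next
  case (Cons x xs)
  let ?m = "of_nat (length xs) :: complex"
  show ?case
  proof (cases k)
    case 0
    then show ?thesis by simp
  next
    case (Suc k')
    let ?y = "\<lambda>a. ?m - of_nat (Suc k' - a)"
    \<comment> \<open>Splitting off x: A and C come from choosing x, by x + 1 + k' = (x + (k' - a))
      + (a + 1); B1 and B2 omit x, with m and m + 1 variables in the coefficient. The difference
      equation of \<open>falling\<close> gives B2 - B1 = C.\<close>
    define A B1 B2 C where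
      "A = (\<Sum>a\<le>k'. falling (?m - of_nat (k' - a)) a * (x + of_nat (k' - a)) * shifted_e xs (k' - a))"
      and "B1 = (\<Sum>a\<le>Suc k'. falling (?y a) a * shifted_e xs (Suc k' - a))"
      and "B2 = (\<Sum>a\<le>Suc k'. falling (?y a + 1) a * shifted_e xs (Suc k' - a))"
      and "C = (\<Sum>a\<le>k'. of_nat (Suc a) * falling (?m - of_nat (k' - a)) a * shifted_e xs (k' - a))"
    have "shifted_e (map (\<lambda>x. x + 1) (x # xs)) k
        = (x + 1 + of_nat k') * (\<Sum>a\<le>k'. falling (?m - of_nat (k' - a)) a * shifted_e xs (k' - a)) + B1"
      unfolding Suc list.map(2) shifted_e.simps Cons B1_def ..
    also have "(x + 1 + of_nat k') * (\<Sum>a\<le>k'. falling (?m - of_nat (k' - a)) a * shifted_e xs (k' - a)) = A + C"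
      unfolding A_def C_def sum_distrib_left sum.distrib[symmetric]
    proof (intro sum.cong refl)
      fix a assume "a \<in> {..k'}"
      then have "(of_nat k' :: complex) = of_nat (k' - a) + of_nat a" by (simp flip: of_nat_add)
      then show "(x + 1 + of_nat k') * (falling (?m - of_nat (k' - a)) a * shifted_e xs (k' - a))
        = falling (?m - of_nat (k' - a)) a * (x + of_nat (k' - a)) * shifted_e xs (k' - a)
          + of_nat (Suc a) * falling (?m - of_nat (k' - a)) a * shifted_e xs (k' - a)"
        by (simp add: algebra_simps)
    qed
    finally have L: "shifted_e (map (\<lambda>x. x + 1) (x # xs)) k = A + C + B1" .
    have "B2 - B1 = (\<Sum>a\<le>Suc k'. (falling (?y a + 1) a - falling (?y a) a) * shifted_e xs (Suc k' - a))"
      unfolding B1_def B2_def by (simp only: sum_subtractf left_diff_distrib)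
    also have "\<dots> = C"
      unfolding sum.atMost_Suc_shift C_def by (simp add: falling_diff)
    finally have BC: "B2 = B1 + C" by (simp add: algebra_simps)
    have "(\<Sum>a\<le>k. falling (of_nat (length (x # xs)) - of_nat (k - a)) a * shifted_e (x # xs) (k - a))
      = (\<Sum>a\<le>Suc k'. falling (?y a + 1) a * shifted_e (x # xs) (Suc k' - a))"
      unfolding Suc by (intro sum.cong refl) (simp add: algebra_simps)
    also have "\<dots> = (\<Sum>a\<le>k'. falling (?y a + 1) a * shifted_e (x # xs) (Suc k' - a)) + falling (?y (Suc k') + 1) (Suc k')"
      by simp
    also have "(\<Sum>a\<le>k'. falling (?y a + 1) a * shifted_e (x # xs) (Suc k' - a))
      = A + (\<Sum>a\<le>k'. falling (?y a + 1) a * shifted_e xs (Suc k' - a))"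
      unfolding A_def sum.distrib[symmetric]
    proof (intro sum.cong refl)
      fix a assume "a \<in> {..k'}"
      then have e: "Suc k' - a = Suc (k' - a)" by auto
      show "falling (?y a + 1) a * shifted_e (x # xs) (Suc k' - a) = falling (?m - of_nat (k' - a)) a * (x + of_nat (k' - a)) * shifted_e xs (k' - a)
        + falling (?y a + 1) a * shifted_e xs (Suc k' - a)"
        unfolding e by (simp add: algebra_simps)
    qed
    also have "A + (\<Sum>a\<le>k'. falling (?y a + 1) a * shifted_e xs (Suc k' - a)) + falling (?y (Suc k') + 1) (Suc k') = A + B2"
      unfolding B2_def by simp
    finally show ?thesis unfolding L BC by simp
  qed
qed

section \<open>Duality of the shifted polynomials under conjugation\<close>

definition conj_parts :: "nat list \<Rightarrow> nat \<Rightarrow> nat list" where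
  "conj_parts l N = map (\<lambda>j. length (filter (\<lambda>x. j \<le> x) l)) [1..<N + 1]"

text \<open>Induction on the rows. The bound N drops to the length of the first row for the
  remaining rows, which is allowed because trailing zeros do not change
  \<open>shifted_e\<close>.\<close>

theorem shifted_h_eq_shifted_e_conjugate:
  assumes "sorted_wrt (\<ge>) l" "\<And>x. x \<in> set l \<Longrightarrow> x \<le> N"
  shows "shifted_h (map of_nat l) k = shifted_e (map of_nat (conj_parts l N)) k"
  using assms
proof (induction l arbitrary: N k)
  case Nil
  have "map of_nat (conj_parts [] N) = ([] @ replicate N 0 :: complex list)"
    by (simp add: conj_parts_def map_replicate_const)
  then show ?case by (simp only: shifted_e_append_zeros) simp
next
  case (Cons x l)
  have xN: "x \<le> N" and lx: "\<And>y. y \<in> set l \<Longrightarrow> y \<le> x" and sl: "sorted_wrt (\<ge>) l"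
    using Cons.prems by auto
  have "[1..<N + 1] = [1..<x + 1] @ [x + 1..<N + 1]"
    using xN upt_add_eq_append[of 1 "x + 1" "N - x"] by (simp del: upt_Suc)
  moreover have "map (\<lambda>j. length (filter (\<lambda>y. j \<le> y) (x # l))) [x + 1..<N + 1] = replicate (N - x) 0"
  proof -
    have "map (\<lambda>j. length (filter (\<lambda>y. j \<le> y) (x # l))) [x + 1..<N + 1] = map (\<lambda>j. 0) [x + 1..<N + 1]"
      by (rule map_cong[OF refl]) (use lx in \<open>fastforce simp: filter_empty_conv\<close>)
    then show ?thesis by (simp add: map_replicate_const del: upt_Suc)
  qed
  moreover have "map (\<lambda>j. length (filter (\<lambda>y. j \<le> y) (x # l))) [1..<x + 1] = map Suc (conj_parts l x)"
    unfolding conj_parts_def map_map by (rule map_cong[OF refl]) auto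
  ultimately have "conj_parts (x # l) N = map Suc (conj_parts l x) @ replicate (N - x) 0"
    unfolding conj_parts_def by (simp del: upt_Suc)
  then have "map of_nat (conj_parts (x # l) N) = map (\<lambda>x. x + 1) (map of_nat (conj_parts l x)) @ replicate (N - x) (0::complex)"
    by (simp add: comp_def add.commute)
  then have "shifted_e (map of_nat (conj_parts (x # l) N)) k
    = (\<Sum>a\<le>k. falling (of_nat (length (conj_parts l x)) - of_nat (k - a)) a * shifted_e (map of_nat (conj_parts l x)) (k - a))"
    by (simp only: shifted_e_append_zeros shifted_e_shift length_map)
  also have "length (conj_parts l x) = x" by (simp add: conj_parts_def)
  also have "(\<Sum>a\<le>k. falling (of_nat x - of_nat (k - a)) a * shifted_e (map of_nat (conj_parts l x)) (k - a)) = shifted_h (map of_nat (x # l)) k"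
    using Cons.IH[OF sl lx] by simp
  finally show ?case ..
qed

section \<open>Sums over index lists and exponents\<close>

fun e_wt :: "(nat \<Rightarrow> complex) \<Rightarrow> nat list \<Rightarrow> complex" where
  "e_wt wt [] = 1"
| "e_wt wt (i # is) = (wt i + of_nat (length is)) * e_wt wt is"

lemma e_wt_eq_prod: "length is = k \<Longrightarrow> (\<Prod>j=1..k. wt (is ! (j - 1)) + of_nat (k - j)) = e_wt wt is"
proof (induction "is" arbitrary: k)
  case (Cons i "is")
  then obtain k' where k: "k = Suc k'" "length is = k'" by auto
  have "(\<Prod>j=1..k. wt ((i # is) ! (j - 1)) + of_nat (k - j))
    = (wt i + of_nat k') * (\<Prod>j=1..k'. wt ((i # is) ! (Suc j - 1)) + of_nat (k - Suc j))"
    unfolding k(1) by (subst prod.atLeast_Suc_atMost) (simp_all add: prod.shift_bounds_cl_Suc_ivl del: prod.cl_ivl_Suc)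
  also have "(\<Prod>j=1..k'. wt ((i # is) ! (Suc j - 1)) + of_nat (k - Suc j)) = (\<Prod>j=1..k'. wt (is ! (j - 1)) + of_nat (k' - j))"
    by (intro prod.cong refl) (auto simp: k(1) nth_Cons')
  also have "\<dots> = e_wt wt is" using Cons.IH[OF k(2)] .
  finally show ?case by (simp add: k(2))
qed simp

text \<open>Lists beginning with m and lists avoiding m give the two terms of the recursion of
  \<open>shifted_e\<close>.\<close>

lemma e_wt_sum:
  assumes "m \<le> n + 1"
  shows "(\<Sum>is | length is = k \<and> sorted_wrt (<) is \<and> set is \<subseteq> {m..n}. e_wt wt is) = shifted_e (map wt [m..<n + 1]) k"
  using assms
proof (induction "n + 1 - m" arbitrary: m k)
  case 0
  then have m: "{m..n} = {}" "[m..<n + 1] = []" by auto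
  have "{is. length is = k \<and> sorted_wrt (<) is \<and> set is \<subseteq> {m..n}} = (if k = 0 then {[]} else {})"
    unfolding m by auto
  then show ?case unfolding m(2) by simp
next
  case (Suc d)
  then have mn: "m \<le> n" by auto
  let ?S = "\<lambda>m k. {is. length is = k \<and> sorted_wrt (<) is \<and> set is \<subseteq> {m..n}}"
  have fin: "finite (?S m k)" for m k
    by (rule finite_subset[OF _ finite_lists_length_eq[of "{m..n}" k]]) auto
  have u: "[m..<n + 1] = m # [m + 1..<n + 1]" using mn by (simp add: upt_conv_Cons del: upt_Suc)
  have IH: "(\<Sum>is\<in>?S (m + 1) k. e_wt wt is) = shifted_e (map wt [m + 1..<n + 1]) k" for k
    using Suc mn by (intro Suc.hyps) auto
  show ?case
  proof (cases k)
    case 0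
    have "?S m 0 = {[]}" by auto
    then show ?thesis unfolding 0 by simp
  next
    case (Suc k')
    have S: "?S m (Suc k') = (#) m ` ?S (m + 1) k' \<union> ?S (m + 1) (Suc k')"
    proof (intro equalityI subsetI)
      fix "is" assume i: "is \<in> ?S m (Suc k')"
      then obtain j js where js: "is = j # js" "length js = k'" by (cases "is") auto
      show "is \<in> (#) m ` ?S (m + 1) k' \<union> ?S (m + 1) (Suc k')"
      proof (cases "j = m")
        case True
        with i js show ?thesis by fastforce
      next
        case False
        have "y \<ge> m + 1" if "y \<in> set is" for y
          using that i js False by fastforce
        with i have "set is \<subseteq> {m + 1..n}" by auto
        with i show ?thesis by simp
      qed
    next
      fix "is" assume "is \<in> (#) m ` ?S (m + 1) k' \<union> ?S (m + 1) (Suc k')"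
      then show "is \<in> ?S m (Suc k')" using mn by fastforce
    qed
    have disj: "(#) m ` ?S (m + 1) k' \<inter> ?S (m + 1) (Suc k') = {}" by auto
    have "(\<Sum>is\<in>?S m (Suc k'). e_wt wt is) = (\<Sum>is\<in>(#) m ` ?S (m + 1) k'. e_wt wt is) + (\<Sum>is\<in>?S (m + 1) (Suc k'). e_wt wt is)"
      unfolding S by (rule sum.union_disjoint) (use fin disj in auto)
    also have "(\<Sum>is\<in>(#) m ` ?S (m + 1) k'. e_wt wt is) = (\<Sum>is\<in>?S (m + 1) k'. (wt m + of_nat k') * e_wt wt is)"
      by (subst sum.reindex) (auto simp: comp_def intro!: sum.cong)
    finally show ?thesis unfolding Suc u IH sum_distrib_left[symmetric] by simp
  qed
qed

text \<open>What survives of \<open>virt_img\<close> on a highest weight vector: index i may be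
  matched with any of its copies, hence the count, and the shift is the number of indices still to
  be matched.\<close>

fun h_wt :: "(nat \<Rightarrow> complex) \<Rightarrow> nat list \<Rightarrow> complex" where
  "h_wt wt [] = 1"
| "h_wt wt (i # is) = of_nat (Suc (count (mset is) i)) * (wt i - of_nat (length is)) * h_wt wt is"

lemma h_wt_replicate:
  assumes "i \<notin> set rest"
  shows "h_wt wt (replicate a i @ rest) = fact a * falling (wt i - of_nat (length rest)) a * h_wt wt rest"
proof (induction a)
  case (Suc a)
  have c: "count (mset (replicate a i @ rest)) i = a" using assms by (simp add: count_mset_0_iff)
  show ?case
    unfolding replicate_Suc append_Cons h_wt.simps c Suc by (simp add: falling_Suc algebra_simps)
qed simp

definition expansion :: "nat \<Rightarrow> nat \<Rightarrow> (nat \<Rightarrow> nat) \<Rightarrow> nat list" where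
  "expansion m n h = concat (map (\<lambda>i. replicate (h i) i) [m..<n + 1])"

definition exponents :: "nat \<Rightarrow> nat \<Rightarrow> nat \<Rightarrow> (nat \<Rightarrow> nat) set" where
  "exponents m n k = {h. (\<forall>i. i \<notin> {m..n} \<longrightarrow> h i = 0) \<and> (\<Sum>i=m..n. h i) = k}"

lemma expansion_Cons: "m \<le> n \<Longrightarrow> expansion m n h = replicate (h m) m @ expansion (m + 1) n h"
  by (simp add: expansion_def upt_conv_Cons del: upt_Suc)

lemma set_expansion: "set (expansion m n h) \<subseteq> {m..n}"
  by (auto simp: expansion_def)

lemma sorted_expansion: "sorted (expansion m n h)"
proof -
  have "sorted (concat (map (\<lambda>i. replicate (h i) i) is))" if "sorted is" for "is"
    using that
  proof (induction "is")
    case (Cons i "is")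
    then show ?case by (auto simp: sorted_append)
  qed simp
  then show ?thesis unfolding expansion_def by (simp del: upt_Suc)
qed

lemma length_expansion: "length (expansion m n h) = (\<Sum>i=m..n. h i)"
proof -
  have "length (expansion m n h) = sum_list (map h [m..<n + 1])"
    by (simp add: expansion_def length_concat comp_def del: upt_Suc)
  also have "\<dots> = (\<Sum>i\<in>set [m..<n + 1]. h i)"
    by (rule sum_list_distinct_conv_sum_set) simp
  also have "set [m..<n + 1] = {m..n}" by auto
  finally show ?thesis .
qed

lemma expansion_cong: "(\<And>i. i \<in> {m..n} \<Longrightarrow> h i = g i) \<Longrightarrow> expansion m n h = expansion m n g"
  unfolding expansion_def by (intro arg_cong[of _ _ concat] map_cong) auto

lemma finite_exponents: "finite (exponents m n k)"
proof -
  have "exponents m n k \<subseteq> {h. \<forall>i. (i \<in> {m..n} \<longrightarrow> h i \<in> {..k}) \<and> (i \<notin> {m..n} \<longrightarrow> h i = 0)}"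
  proof (intro subsetI CollectI allI conjI impI)
    fix h i assume h: "h \<in> exponents m n k" and i: "i \<in> {m..n}"
    have "h i \<le> (\<Sum>i=m..n. h i)" by (rule member_le_sum) (use i in auto)
    with h show "h i \<in> {..k}" by (simp add: exponents_def)
  qed (auto simp: exponents_def)
  then show ?thesis by (rule finite_subset) (rule finite_set_of_finite_funs; simp)
qed

text \<open>The counts along a block of equal indices multiply to a factorial, which cancels the
  factor 1/h_i! in the definition of I_k.\<close>

lemma h_wt_sum:
  assumes "m \<le> n + 1"
  shows "(\<Sum>h\<in>exponents m n k. (1 / (\<Prod>i=m..n. fact (h i))) * h_wt wt (expansion m n h)) = shifted_h (map wt [m..<n + 1]) k"
  using assms
proof (induction "n + 1 - m" arbitrary: m k)
  case 0
  then have m: "{m..n} = {}" "[m..<n + 1] = []" by auto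
  have "exponents m n k = (if k = 0 then {\<lambda>i. 0} else {})"
    unfolding exponents_def m by auto
  moreover have "[m..<Suc n] = []" using m(2) by simp
  ultimately show ?case by (simp add: m(1) expansion_def del: upt_Suc)
next
  case (Suc d)
  then have mn: "m \<le> n" by auto
  have u: "[m..<n + 1] = m # [m + 1..<n + 1]" using mn by (simp add: upt_conv_Cons del: upt_Suc)
  have iv: "{m..n} = insert m {m + 1..n}" using mn by auto
  let ?w = "\<lambda>m h. (1 / (\<Prod>i=m..n. fact (h i))) * h_wt wt (expansion m n h)"
  have "(\<Sum>h\<in>exponents m n k. ?w m h) = (\<Sum>(a, g)\<in>Sigma {..k} (\<lambda>a. exponents (m + 1) n (k - a)).
     falling (wt m - of_nat (k - a)) a * ?w (m + 1) g)"
  \<comment> \<open>The exponent of m is split off and reset to 0, since the remaining exponents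
    have to vanish outside {m + 1..n}.\<close>
  proof (rule sum.reindex_bij_witness[of _ "\<lambda>(a, g). g(m := a)" "\<lambda>h. (h m, h(m := 0))"])
    fix h assume h: "h \<in> exponents m n k"
    have s: "h m + (\<Sum>i=m + 1..n. h i) = k" using h mn unfolding exponents_def iv by simp
    have s': "(\<Sum>i=m + 1..n. (h(m := 0)) i) = (\<Sum>i=m + 1..n. h i)" by (rule sum.cong) auto
    show "(\<lambda>(a, g). g(m := a)) (h m, h(m := 0)) = h" by simp
    show "(h m, h(m := 0)) \<in> Sigma {..k} (\<lambda>a. exponents (m + 1) n (k - a))"
      using h s s' mn by (auto simp: exponents_def)
    have e: "expansion (m + 1) n (h(m := 0)) = expansion (m + 1) n h"
      by (rule expansion_cong) auto
    have l: "length (expansion (m + 1) n h) = k - h m"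
      unfolding length_expansion using s by simp
    have nm: "m \<notin> set (expansion (m + 1) n h)" using set_expansion[of "m + 1" n h] by auto
    have v: "h_wt wt (expansion m n h) = fact (h m) * falling (wt m - of_nat (k - h m)) (h m) * h_wt wt (expansion (m + 1) n h)"
      unfolding expansion_Cons[OF mn] h_wt_replicate[OF nm] l ..
    have p: "(\<Prod>i=m..n. fact (h i)) = (fact (h m) * (\<Prod>i=m + 1..n. fact (h i)) :: complex)"
      unfolding iv by simp
    have p': "(\<Prod>i=m + 1..n. fact ((h(m := 0)) i)) = (\<Prod>i=m + 1..n. fact (h i) :: complex)"
      by (rule prod.cong) auto
    show "(case (h m, h(m := 0)) of (a, g) \<Rightarrow> falling (wt m - of_nat (k - a)) a * ?w (m + 1) g) = ?w m h"
      unfolding prod.case e p' p v by simp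
  next
    fix x assume x: "x \<in> Sigma {..k} (\<lambda>a. exponents (m + 1) n (k - a))"
    obtain a g where ag: "x = (a, g)" by (cases x)
    have g: "g m = 0" "a \<le> k" "(\<Sum>i=m + 1..n. g i) = k - a" "\<And>i. i \<notin> {m + 1..n} \<Longrightarrow> g i = 0"
      using x by (auto simp: ag exponents_def)
    show "(((case x of (a, g) \<Rightarrow> g(m := a)) m), (case x of (a, g) \<Rightarrow> g(m := a))(m := 0)) = x"
      using g(1) by (auto simp: ag fun_eq_iff)
    have "(\<Sum>i=m + 1..n. (g(m := a)) i) = (\<Sum>i=m + 1..n. g i)" by (rule sum.cong) auto
    then have "(\<Sum>i=m..n. (g(m := a)) i) = k" unfolding iv using g(2,3) by simp
    then show "(case x of (a, g) \<Rightarrow> g(m := a)) \<in> exponents m n k"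
      using g(4) mn by (auto simp: ag exponents_def)
  qed
  also have "\<dots> = (\<Sum>a\<le>k. \<Sum>g\<in>exponents (m + 1) n (k - a). falling (wt m - of_nat (k - a)) a * ?w (m + 1) g)"
    by (subst sum.Sigma) (auto simp: finite_exponents)
  also have "\<dots> = (\<Sum>a\<le>k. falling (wt m - of_nat (k - a)) a * shifted_h (map wt [m + 1..<n + 1]) (k - a))"
  proof (intro sum.cong refl)
    fix a
    have "(\<Sum>g\<in>exponents (m + 1) n (k - a). ?w (m + 1) g) = shifted_h (map wt [m + 1..<n + 1]) (k - a)"
      using Suc mn by (intro Suc.hyps) auto
    then show "(\<Sum>g\<in>exponents (m + 1) n (k - a). falling (wt m - of_nat (k - a)) a * ?w (m + 1) g)
      = falling (wt m - of_nat (k - a)) a * shifted_h (map wt [m + 1..<n + 1]) (k - a)"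
      by (simp only: sum_distrib_left[symmetric])
  qed
  finally show ?case unfolding u by simp
qed

section \<open>Conjugate partitions as padded lists\<close>

lemma part_antimono:
  assumes "is_partition \<mu>" "1 \<le> i" "i \<le> j"
  shows "part \<mu> j \<le> part \<mu> i"
proof (cases "i = j \<or> length \<mu> < j")
  case True
  then show ?thesis by (auto simp: part_def)
next
  case False
  then have "i - 1 < j - 1" "j - 1 < length \<mu>" using assms(2,3) by auto
  then have "\<mu> ! (j - 1) \<le> \<mu> ! (i - 1)"
    using assms(1) sorted_wrt_nth_less[of "(\<ge>)" \<mu> "i - 1" "j - 1"] by (simp add: is_partition_def)
  then show ?thesis using False assms(2,3) by (simp add: part_def)
qed

text \<open>Beyond the first part of \<mu> both sides are zero: the conjugate list has ended and no
  part is that large.\<close>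

lemma part_conj:
  assumes "is_partition \<mu>" "1 \<le> j"
  shows "part (conj_partition \<mu>) j = card {i. 1 \<le> i \<and> i \<le> length \<mu> \<and> j \<le> part \<mu> i}"
proof (cases "j \<le> part \<mu> 1")
  case True
  have "[1..<part \<mu> 1 + 1] ! (j - 1) = j"
    using True assms(2) by (subst nth_upt) auto
  moreover have len: "length (conj_partition \<mu>) = part \<mu> 1" by (simp add: conj_partition_def)
  then have "part (conj_partition \<mu>) j = conj_partition \<mu> ! (j - 1)"
    using True assms(2) by (simp add: part_def[of "conj_partition \<mu>"])
  moreover have "conj_partition \<mu> ! (j - 1)
      = card {i. 1 \<le> i \<and> i \<le> length \<mu> \<and> [1..<part \<mu> 1 + 1] ! (j - 1) \<le> part \<mu> i}"
    unfolding conj_partition_def by (rule nth_map) (use True assms(2) in auto)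
  ultimately show ?thesis by (simp only:)
next
  case False
  then have "{i. 1 \<le> i \<and> i \<le> length \<mu> \<and> j \<le> part \<mu> i} = {}"
    using part_antimono[OF assms(1), of 1] by fastforce
  then show ?thesis using False by (simp add: part_def[of "conj_partition \<mu>"]) (simp add: conj_partition_def del: upt_Suc)
qed

lemma conj_eq_conj_parts:
  assumes "is_partition \<mu>" "part (conj_partition \<mu>) 1 \<le> n"
  shows "map (part (conj_partition \<mu>)) [1..<n + 1] = conj_parts (map (part \<mu>) [1..<n + 1]) n"
  unfolding conj_parts_def
proof (rule map_cong[OF refl])
  fix j assume "j \<in> set [1..<n + 1]"
  then have j: "1 \<le> j" by auto
  have pos: "part \<mu> i \<ge> 1" if "1 \<le> i" "i \<le> length \<mu>" for i
    using assms(1) that by (auto simp: is_partition_def part_def Suc_le_eq in_set_conv_nth intro!: gr0I)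
  then have "{i. 1 \<le> i \<and> i \<le> length \<mu> \<and> 1 \<le> part \<mu> i} = {1..length \<mu>}" by auto
  \<comment> \<open>The first part of the conjugate counts all parts of \<mu>, so padding to length
    n cuts nothing off.\<close>
  then have len: "length \<mu> \<le> n" using part_conj[OF assms(1), of 1] assms(2) by simp
  have "length (filter (\<lambda>x. j \<le> x) (map (part \<mu>) [1..<n + 1])) = card {i \<in> {1..n}. j \<le> part \<mu> i}"
  proof -
    have "length (filter (\<lambda>x. j \<le> x) (map (part \<mu>) [1..<n + 1])) = length (filter (\<lambda>i. j \<le> part \<mu> i) [1..<n + 1])"
      by (simp add: filter_map comp_def del: upt_Suc)
    also have "\<dots> = card (set (filter (\<lambda>i. j \<le> part \<mu> i) [1..<n + 1]))"
      by (rule distinct_card[symmetric]) simp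
    also have "set (filter (\<lambda>i. j \<le> part \<mu> i) [1..<n + 1]) = {i \<in> {1..n}. j \<le> part \<mu> i}" by auto
    finally show ?thesis .
  qed
  also have "{i \<in> {1..n}. j \<le> part \<mu> i} = {i. 1 \<le> i \<and> i \<le> length \<mu> \<and> j \<le> part \<mu> i}"
    using len j by (auto simp: part_def split: if_splits)
  finally show "part (conj_partition \<mu>) j = length (filter (\<lambda>x. j \<le> x) (map (part \<mu>) [1..<n + 1]))"
    using part_conj[OF assms(1) j] by simp
qed

theorem duality_identity:
  assumes "is_partition \<mu>" "part \<mu> 1 \<le> n" "part (conj_partition \<mu>) 1 \<le> n"
  shows "shifted_h (map (\<lambda>i. of_nat (part \<mu> i)) [1..<n + 1]) k
    = shifted_e (map (\<lambda>i. of_nat (part (conj_partition \<mu>) i)) [1..<n + 1]) k"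
proof -
  have "sorted_wrt (\<ge>) (map (part \<mu>) [1..<n + 1])"
    unfolding sorted_wrt_map
    by (rule sorted_wrt_mono_rel[OF _ sorted_wrt_upt]) (use part_antimono[OF assms(1)] in auto)
  moreover have "x \<le> n" if "x \<in> set (map (part \<mu>) [1..<n + 1])" for x
    using that part_antimono[OF assms(1), of 1] assms(2) by (force simp del: upt_Suc)
  ultimately have "shifted_h (map of_nat (map (part \<mu>) [1..<n + 1])) k = shifted_e (map of_nat (conj_parts (map (part \<mu>) [1..<n + 1]) n)) k"
    by (rule shifted_h_eq_shifted_e_conjugate)
  then show ?thesis
    unfolding conj_eq_conj_parts[OF assms(1,3), symmetric] map_map comp_def .
qed

section \<open>Highest weight modules\<close>

lemma zeta_simps: "x \<oplus>\<^bsub>\<zeta> n\<^esub> y = x \<oplus>\<^bsub>Ugl n\<^esub> y" "x \<otimes>\<^bsub>\<zeta> n\<^esub> y = x \<otimes>\<^bsub>Ugl n\<^esub> y" "\<one>\<^bsub>\<zeta> n\<^esub> = \<one>\<^bsub>Ugl n\<^esub>"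
  by (simp_all add: \<zeta>_def)

lemma virtual_I_coset:
  assumes "\<beta> \<in> Beta ` {1..m1}"
  shows "virtual_I m0 m1 n \<beta> k = coset (proper_symbols n)
    (\<Sum>h\<in>exponents 1 n k. (1 / (\<Prod>i=1..n. fact (h i))) *\<^sub>C virt_img (expansion 1 n h) (expansion 1 n h))"
proof -
  let ?P = "proper_symbols n"
  interpret ring "Ugl n" by (rule ring_env_alg)
  have q: "virt_img (expansion 1 n h) (expansion 1 n h) \<in> fa_on (gl_basis n)" for h
    by (intro virt_img_fa_on set_expansion)
  have e: "scalgl n c \<otimes>\<^bsub>Ugl n\<^esub> virt_proj m0 m1 n (e_prod (all_symbols m0 m1 n) (I_word n \<beta> h))
    = coset ?P (c *\<^sub>C virt_img (expansion 1 n h) (expansion 1 n h))" for c h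
    unfolding virt_proj_I_word[OF assms] expansion_def[symmetric] scal_coset
    using q[of h] by (simp add: coset_mult[symmetric])
  have "coset ?P (\<Sum>h\<in>exponents 1 n k. (1 / (\<Prod>i=1..n. fact (h i))) *\<^sub>C virt_img (expansion 1 n h) (expansion 1 n h))
    = (\<Oplus>\<^bsub>Ugl n\<^esub>h\<in>exponents 1 n k. coset ?P ((1 / (\<Prod>i=1..n. fact (h i))) *\<^sub>C virt_img (expansion 1 n h) (expansion 1 n h)))"
    by (rule coset_sum) (use finite_exponents q in auto)
  also have "\<dots> = virtual_I m0 m1 n \<beta> k"
    unfolding virtual_I_def e exponents_def ..
  finally show ?thesis ..
qed

section \<open>Representatives acting on a module\<close>

context
  fixes n :: nat and s :: "complex \<Rightarrow> 'v \<Rightarrow> 'v::ab_group_add"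
    and \<rho> :: "(unit_symbol list \<Rightarrow> complex) set \<Rightarrow> 'v \<Rightarrow> 'v"
  assumes gl: "gl_module n s \<rho>"
begin

definition act :: "unit_symbol fa \<Rightarrow> 'v \<Rightarrow> 'v" where
  "act t = \<rho> (coset (proper_symbols n) t)"

lemma vector_space_s: "vector_space s"
  using gl by (simp add: gl_module_def)

lemma act_add: "t \<in> fa_on (gl_basis n) \<Longrightarrow> u \<in> fa_on (gl_basis n) \<Longrightarrow> act (t + u) v = act t v + act u v"
  and act_mult: "t \<in> fa_on (gl_basis n) \<Longrightarrow> u \<in> fa_on (gl_basis n) \<Longrightarrow> act (t * u) v = act t (act u v)"
  and act_one: "act 1 v = v"
  using gl by (simp_all add: gl_module_def act_def coset_add coset_mult coset_one)

lemma act_scale: "t \<in> fa_on (gl_basis n) \<Longrightarrow> act (c *\<^sub>C t) v = s c (act t v)"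
proof -
  assume t: "t \<in> fa_on (gl_basis n)"
  have "coset (proper_symbols n) (c *\<^sub>C t) = scalgl n c \<otimes>\<^bsub>Ugl n\<^esub> coset (proper_symbols n) t"
    unfolding scal_coset using t by (subst coset_mult[symmetric]) simp_all
  then show ?thesis using gl t by (simp add: gl_module_def act_def)
qed

lemma act_linear: "t \<in> fa_on (gl_basis n) \<Longrightarrow> Vector_Spaces.linear s s (act t)"
  using gl by (simp add: gl_module_def act_def)

lemma act_vec: "t \<in> fa_on (gl_basis n) \<Longrightarrow> act t (s c v) = s c (act t v)"
  and act_vec_add: "t \<in> fa_on (gl_basis n) \<Longrightarrow> act t (v + w) = act t v + act t w"
  and act_vec_0: "t \<in> fa_on (gl_basis n) \<Longrightarrow> act t 0 = 0"
proof -
  assume t: "t \<in> fa_on (gl_basis n)"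
  interpret Vector_Spaces.linear s s "act t" by (rule act_linear[OF t])
  show "act t (s c v) = s c (act t v)" by (rule scale)
  show "act t (v + w) = act t v + act t w" by (rule add)
  show "act t 0 = 0" by (rule zero)
qed

lemma act_0: "act 0 v = 0"
  using act_add[of 0 0 v] by simp

lemma act_diff: "t \<in> fa_on (gl_basis n) \<Longrightarrow> u \<in> fa_on (gl_basis n) \<Longrightarrow> act (t - u) v = act t v - act u v"
  using act_add[of "t - u" u v] by simp

lemma act_sum: "(\<And>i. i \<in> I \<Longrightarrow> f i \<in> fa_on (gl_basis n)) \<Longrightarrow> act (sum f I) v = (\<Sum>i\<in>I. act (f i) v)"
  by (induction I rule: infinite_finite_induct) (auto simp: act_0 act_add fa_on_sum)

lemma act_scalar: "act (c *\<^sub>C 1) v = s c v"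
  using act_scale[of 1 c v] by (simp add: act_one)

lemma s_simps: "s c (s d v) = s (c * d) v" "s 1 v = v" "s (c + d) v = s c v + s d v" "s 0 v = 0"
  "s c (v + w) = s c v + s c w" "s c 0 = 0" "s (c - d) v = s c v - s d v"
proof -
  interpret vector_space s by (rule vector_space_s)
  show "s c (s d v) = s (c * d) v" "s 1 v = v" "s (c + d) v = s c v + s d v" "s 0 v = 0"
    "s c (v + w) = s c v + s c w" "s c 0 = 0" "s (c - d) v = s c v - s d v"
    by (simp_all add: scale_left_distrib scale_right_distrib scale_left_diff_distrib)
qed

lemma s_sum: "(\<Sum>i\<in>I. s (f i) v) = s (sum f I) v"
  by (induction I rule: infinite_finite_induct) (auto simp: s_simps)

lemma act_of_nat: "act (of_nat m) v = s (of_nat m) v"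
  using act_scalar[of "of_nat m" v] by (simp add: scaleC_of_nat)

lemma act_of_int: "t \<in> fa_on (gl_basis n) \<Longrightarrow> act (of_int m * t) v = s (of_int m) (act t v)"
proof -
  assume t: "t \<in> fa_on (gl_basis n)"
  have "of_int m * t = of_int m *\<^sub>C t"
  proof (cases m)
    case (nonneg k)
    then show ?thesis by (simp add: scaleC_of_nat)
  next
    case (neg k)
    show ?thesis
      unfolding neg by (simp only: of_int_minus of_int_of_nat_eq scaleC_minus_left scaleC_of_nat mult_minus_left)
  qed
  then show ?thesis using act_scale[OF t] by simp
qed

section \<open>Eigenvalues on a highest weight vector\<close>

context
  fixes wt :: "nat \<Rightarrow> complex" and v :: 'v
  assumes diag: "\<And>i. i \<in> {1..n} \<Longrightarrow> act (gl_e i i) v = s (wt i) v"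
    and upper: "\<And>i j. i \<in> {1..n} \<Longrightarrow> j \<in> {1..n} \<Longrightarrow> i < j \<Longrightarrow> act (gl_e i j) v = 0"
begin

text \<open>The last columns act first. Fixed columns act by scalars, and at the largest moved
  column the permutation points to a smaller index, so the entry there is a raising operator and
  kills v.\<close>

lemma act_capelli_term:
  assumes i: "is \<in> inc_lists k n" and p: "\<sigma> permutes {1..k}"
  defines "F \<equiv> \<lambda>j. gl_e (is ! (\<sigma> j - 1)) (is ! (j - 1)) + (if \<sigma> j = j then of_nat (k - j) else 0)"
  shows "act (seq_prod k F) v = (if \<sigma> = id then s (\<Prod>j=1..k. wt (is ! (j - 1)) + of_nat (k - j)) v else 0)"
proof -
  have F: "F j \<in> fa_on (gl_basis n)" if "j \<in> {1..k}" for j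
    unfolding F_def by (rule capelli_entry_fa_on[OF i p that])
  have plF: "seq_prod m F \<in> fa_on (gl_basis n)" if "m \<le> k" for m
    unfolding seq_prod_def by (intro fa_on_prod_list) (use F that in auto)
  have nth: "is ! (j - 1) \<in> {1..n}" if "j \<in> {1..k}" for j
    by (rule inc_lists_nth[OF i that])
  have fixd: "act (F j) v = s (wt (is ! (j - 1)) + of_nat (k - j)) v" if "j \<in> {1..k}" "\<sigma> j = j" for j
    using nth[OF that(1)] that(2)
    by (simp add: F_def act_add gl_e_fa_on diag act_of_nat s_simps)
  show ?thesis
  proof (cases "\<sigma> = id")
    case True
    have "act (seq_prod m F) v = s (\<Prod>j=1..m. wt (is ! (j - 1)) + of_nat (k - j)) v" if "m \<le> k" for m
      using that
    proof (induction m)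
      case (Suc m)
      then have m: "Suc m \<in> {1..k}" "m \<le> k" by auto
      show ?case
        unfolding seq_prod_Suc act_mult[OF plF[OF m(2)] F[OF m(1)]] fixd[OF m(1) fun_cong[OF True, of "Suc m", unfolded id_apply]]
          act_vec[OF plF[OF m(2)]] Suc.IH[OF m(2)] s_simps(1)
        by (simp add: mult.commute)
    qed (simp add: act_one s_simps)
    then show ?thesis using True by simp
  next
    case False
    then obtain j0 where "\<sigma> j0 \<noteq> j0" by (auto simp: fun_eq_iff)
    then have j0: "j0 \<le> k" "\<sigma> j0 \<noteq> j0" "1 \<le> j0"
      using permutes_not_in[OF p, of j0] by auto
    have "act (seq_prod m F) v = 0" if "m \<le> k" "\<And>j. m < j \<Longrightarrow> \<sigma> j = j" for m
      using that
    proof (induction m)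
      case 0
      then show ?case using j0 by auto
    next
      case (Suc m)
      then have m: "Suc m \<in> {1..k}" "m \<le> k" by auto
      show ?case
      proof (cases "\<sigma> (Suc m) = Suc m")
        case True
        have "act (seq_prod m F) v = 0"
        proof (rule Suc.IH[OF m(2)])
          fix j assume "m < j"
          then show "\<sigma> j = j" using True Suc.prems(2) by (cases "j = Suc m") auto
        qed
        then show ?thesis
          unfolding seq_prod_Suc act_mult[OF plF[OF m(2)] F[OF m(1)]] fixd[OF m(1) True] act_vec[OF plF[OF m(2)]]
          by (simp add: s_simps)
      next
        case False
        have sm: "\<sigma> (Suc m) \<in> {1..k}" using p m(1) permutes_in_image by fastforce
        \<comment> \<open>A larger image would itself be fixed, against injectivity.\<close>
        have "\<not> Suc m < \<sigma> (Suc m)"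
        proof
          assume "Suc m < \<sigma> (Suc m)"
          then have "\<sigma> (\<sigma> (Suc m)) = \<sigma> (Suc m)" by (rule Suc.prems(2))
          with False show False using permutes_inj[OF p] by (auto simp: inj_def)
        qed
        with False sm have "is ! (\<sigma> (Suc m) - 1) < is ! (Suc m - 1)"
          using i m sorted_wrt_nth_less[of "(<)" "is" "\<sigma> (Suc m) - 1" "Suc m - 1"]
          by (auto simp: inc_lists_def)
        then have "act (F (Suc m)) v = 0"
          unfolding F_def using False upper[OF nth[OF sm] nth[OF m(1)]] by simp
        then show ?thesis
          unfolding seq_prod_Suc act_mult[OF plF[OF m(2)] F[OF m(1)]] by (simp add: act_vec_0 plF m)
      qed
    qed
    moreover have "\<sigma> j = j" if "k < j" for j
      using that permutes_not_in[OF p, of j] by simp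
    ultimately show ?thesis using False by simp
  qed
qed

lemma act_capelli: "act (capelli gl_e n k) v = s (shifted_e (map wt [1..<n + 1]) k) v"
proof -
  let ?F = "\<lambda>is \<sigma> j. gl_e (is ! (\<sigma> j - 1)) (is ! (j - 1)) + (if \<sigma> j = j then of_nat (k - j) else 0)"
  have fP: "finite {\<sigma>. \<sigma> permutes {1..k}}" by (rule finite_permutations) simp
  have pF: "seq_prod k (?F is \<sigma>) \<in> fa_on (gl_basis n)" if "is \<in> inc_lists k n" "\<sigma> permutes {1..k}" for "is" \<sigma>
    unfolding seq_prod_def using capelli_entry_fa_on[OF that] by (intro fa_on_prod_list) auto
  have "act (capelli gl_e n k) v = (\<Sum>is\<in>inc_lists k n. act (\<Sum>\<sigma> | \<sigma> permutes {1..k}. of_int (sign \<sigma>) * seq_prod k (?F is \<sigma>)) v)"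
    unfolding capelli_def seq_prod_def[symmetric] using pF by (intro act_sum fa_on_sum) auto
  also have "\<dots> = (\<Sum>is\<in>inc_lists k n. s (e_wt wt is) v)"
  proof (intro sum.cong refl)
    fix "is" assume i: "is \<in> inc_lists k n"
    have "act (\<Sum>\<sigma> | \<sigma> permutes {1..k}. of_int (sign \<sigma>) * seq_prod k (?F is \<sigma>)) v
      = (\<Sum>\<sigma> | \<sigma> permutes {1..k}. act (of_int (sign \<sigma>) * seq_prod k (?F is \<sigma>)) v)"
      using pF[OF i] by (intro act_sum) auto
    also have "\<dots> = (\<Sum>\<sigma> | \<sigma> permutes {1..k}. if \<sigma> = id then s (\<Prod>j=1..k. wt (is ! (j - 1)) + of_nat (k - j)) v else 0)"
    proof (intro sum.cong refl)
      fix \<sigma> assume "\<sigma> \<in> {\<sigma>. \<sigma> permutes {1..k}}"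
      then have p: "\<sigma> permutes {1..k}" by simp
      show "act (of_int (sign \<sigma>) * seq_prod k (?F is \<sigma>)) v
        = (if \<sigma> = id then s (\<Prod>j=1..k. wt (is ! (j - 1)) + of_nat (k - j)) v else 0)"
        unfolding act_of_int[OF pF[OF i p]] act_capelli_term[OF i p]
        by (auto simp: s_simps)
    qed
    also have "\<dots> = s (\<Prod>j=1..k. wt (is ! (j - 1)) + of_nat (k - j)) v"
      using fP permutes_id[of "{1..k}"] by (simp add: sum.delta)
    also have "(\<Prod>j=1..k. wt (is ! (j - 1)) + of_nat (k - j)) = e_wt wt is"
      using i by (intro e_wt_eq_prod) (simp add: inc_lists_def)
    finally show "act (\<Sum>\<sigma> | \<sigma> permutes {1..k}. of_int (sign \<sigma>) * seq_prod k (?F is \<sigma>)) v = s (e_wt wt is) v" .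
  qed
  also have "\<dots> = s (\<Sum>is\<in>inc_lists k n. e_wt wt is) v" by (rule s_sum)
  also have "(\<Sum>is\<in>inc_lists k n. e_wt wt is) = shifted_e (map wt [1..<n + 1]) k"
    unfolding inc_lists_def by (rule e_wt_sum) simp
  finally show ?thesis .
qed

text \<open>Since the list is sorted, its head i is the smallest index in \<open>js\<close>, and the
  factor next to v is either diagonal or a raising operator. Only the copies of i in
  \<open>js\<close> survive, each leaving a rearrangement of the tail.\<close>

lemma act_virt_img:
  assumes "sorted is" "set is \<subseteq> {1..n}" "mset js = mset is"
  shows "act (virt_img is js) v = s (h_wt wt is) v"
  using assms
proof (induction "is" arbitrary: js)
  case Nil
  then show ?case by (simp add: act_one s_simps)
next
  case (Cons i "is")
  have set_js: "set js = set (i # is)" using Cons.prems(3) mset_eq_setD by blast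
  have len: "length js = Suc (length is)" using Cons.prems(3) by (metis size_mset length_Cons)
  have i: "i \<in> {1..n}" using Cons.prems by auto
  have j: "js ! t \<in> {1..n}" "i \<le> js ! t" if "t < length js" for t
  proof -
    have "js ! t \<in> set (i # is)" using that set_js nth_mem by blast
    then show "js ! t \<in> {1..n}" "i \<le> js ! t" using Cons.prems by auto
  qed
  let ?c = "\<lambda>t. gl_e i (js ! t) - (if i = js ! t then of_nat (length js - 1) else 0)"
  have c_fa_on: "?c t \<in> fa_on (gl_basis n)" if "t < length js" for t
    using i j[OF that] by (auto intro!: fa_on_diff gl_e_fa_on)
  have q_fa_on: "virt_img is (remove_nth t js) \<in> fa_on (gl_basis n)" for t
    using Cons.prems set_js set_remove_nth[of t js] by (intro virt_img_fa_on) auto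
  have "act (virt_img (i # is) js) v = (\<Sum>t<length js. act (virt_img is (remove_nth t js) * ?c t) v)"
    unfolding virt_img.simps using c_fa_on q_fa_on by (intro act_sum) auto
  also have "\<dots> = (\<Sum>t<length js. if js ! t = i then s ((wt i - of_nat (length is)) * h_wt wt is) v else 0)"
  proof (intro sum.cong refl)
    fix t assume "t \<in> {..<length js}"
    then have t: "t < length js" by simp
    show "act (virt_img is (remove_nth t js) * ?c t) v = (if js ! t = i then s ((wt i - of_nat (length is)) * h_wt wt is) v else 0)"
    proof (cases "js ! t = i")
      case True
      have 1: "act (?c t) v = s (wt i - of_nat (length is)) v"
        using True i len by (simp add: act_diff gl_e_fa_on diag act_of_nat s_simps)
      have 2: "act (virt_img is (remove_nth t js)) v = s (h_wt wt is) v"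
        using Cons.prems mset_remove_nth[OF t] True by (intro Cons.IH) auto
      show ?thesis
        unfolding act_mult[OF q_fa_on c_fa_on[OF t]] 1 act_vec[OF q_fa_on] 2 s_simps(1) using True by simp
    next
      case False
      then have "i < js ! t" using j[OF t] by simp
      then have "act (?c t) v = 0" using upper[OF i j(1)[OF t]] by simp
      then show ?thesis using False by (simp only: act_mult[OF q_fa_on c_fa_on[OF t]] act_vec_0[OF q_fa_on] if_False)
    qed
  qed
  also have "\<dots> = s (\<Sum>t<length js. if js ! t = i then (wt i - of_nat (length is)) * h_wt wt is else 0) v"
    unfolding s_sum[symmetric] by (intro sum.cong refl) (simp add: s_simps)
  also have "(\<Sum>t<length js. if js ! t = i then (wt i - of_nat (length is)) * h_wt wt is else 0)
    = of_nat (card {t. t < length js \<and> js ! t = i}) * ((wt i - of_nat (length is)) * h_wt wt is)"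
  proof -
    have "{..<length js} \<inter> {t. js ! t = i} = {t. t < length js \<and> js ! t = i}" by auto
    then show ?thesis by (simp add: sum.If_cases)
  qed
  also have "card {t. t < length js \<and> js ! t = i} = Suc (count (mset is) i)"
  proof -
    have "card {t. t < length js \<and> js ! t = i} = count (mset js) i"
      by (simp add: count_mset count_list_eq_length_filter length_filter_conv_card eq_commute)
    then show ?thesis using Cons.prems(3) by simp
  qed
  finally show ?case by (simp add: mult.assoc)
qed

lemma act_virtual:
  "act (\<Sum>h\<in>exponents 1 n k. (1 / (\<Prod>i=1..n. fact (h i))) *\<^sub>C virt_img (expansion 1 n h) (expansion 1 n h)) v
    = s (shifted_h (map wt [1..<n + 1]) k) v"
proof -
  have q: "virt_img (expansion 1 n h) (expansion 1 n h) \<in> fa_on (gl_basis n)" for h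
    by (intro virt_img_fa_on set_expansion)
  have "act (\<Sum>h\<in>exponents 1 n k. (1 / (\<Prod>i=1..n. fact (h i))) *\<^sub>C virt_img (expansion 1 n h) (expansion 1 n h)) v
    = (\<Sum>h\<in>exponents 1 n k. act ((1 / (\<Prod>i=1..n. fact (h i))) *\<^sub>C virt_img (expansion 1 n h) (expansion 1 n h)) v)"
    using q by (intro act_sum) auto
  also have "\<dots> = (\<Sum>h\<in>exponents 1 n k. s ((1 / (\<Prod>i=1..n. fact (h i))) * h_wt wt (expansion 1 n h)) v)"
    using act_virt_img[OF sorted_expansion set_expansion refl] q by (simp only: act_scale s_simps)
  also have "\<dots> = s (shifted_h (map wt [1..<n + 1]) k) v"
    unfolding s_sum by (subst h_wt_sum) simp_all
  finally show ?thesis .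
qed

end

text \<open>The vectors on which a central element acts by a fixed scalar form a submodule.\<close>

lemma central_scalar:
  assumes irr: "irreducible_gl_module n s \<rho>" and t: "t \<in> central n" and v: "v \<noteq> 0" "act t v = s c v"
  shows "act t x = s c x"
proof -
  have tf: "t \<in> fa_on (gl_basis n)" using t by (rule central_fa_on)
  let ?S = "{x. act t x = s c x}"
  interpret vector_space s by (rule vector_space_s)
  have "subspace ?S"
    using act_vec_0[OF tf] by (intro subspaceI) (auto simp: act_vec_add[OF tf] act_vec[OF tf] s_simps mult.commute)
  moreover have "\<rho> u y \<in> ?S" if "u \<in> carrier (Ugl n)" "y \<in> ?S" for u y
  proof -
    from that obtain r where r: "u = coset (proper_symbols n) r" "r \<in> fa_on (gl_basis n)" by (auto simp: carrier_env)
    have "coset (proper_symbols n) (r * t) = coset (proper_symbols n) (t * r)"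
      using central_commutes[OF t r(2)] by (simp add: coset_eq_iff)
    then have "act (t * r) y = act (r * t) y" by (simp add: act_def)
    then have "act t (act r y) = act r (act t y)" using tf r(2) by (simp add: act_mult)
    also have "\<dots> = s c (act r y)" using that(2) r(2) by (simp add: act_vec)
    finally show ?thesis using r(1) by (simp add: act_def)
  qed
  ultimately have "?S = {0} \<or> ?S = UNIV"
    using irr unfolding irreducible_gl_module_def by blast
  with v show ?thesis by blast
qed

end

lemma highest_weight_vector:
  assumes "gl_module n s \<rho>" "has_highest_weight n wt s \<rho>"
  obtains v where "v \<noteq> 0" "\<And>i. i \<in> {1..n} \<Longrightarrow> act n \<rho> (gl_e i i) v = s (wt i) v"
    "\<And>i j. i \<in> {1..n} \<Longrightarrow> j \<in> {1..n} \<Longrightarrow> i < j \<Longrightarrow> act n \<rho> (gl_e i j) v = 0"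
  using assms unfolding has_highest_weight_def act_def[OF assms(1)] gl_e_def unit_elt_coset by blast

theorem theorem4p59:
  fixes n m0 m1 :: nat and \<beta> :: symbol and \<mu> :: "nat list"
    and W :: "(unit_symbol list \<Rightarrow> complex) set \<Rightarrow> (unit_symbol list \<Rightarrow> complex) set"
    and s1 :: "complex \<Rightarrow> 'v \<Rightarrow> 'v::ab_group_add"
    and \<rho>1 :: "(unit_symbol list \<Rightarrow> complex) set \<Rightarrow> 'v \<Rightarrow> 'v"
    and s2 :: "complex \<Rightarrow> 'w \<Rightarrow> 'w::ab_group_add"
    and \<rho>2 :: "(unit_symbol list \<Rightarrow> complex) set \<Rightarrow> 'w \<Rightarrow> 'w"
  assumes "n \<ge> 1"
    and "is_partition \<mu>" and "part \<mu> 1 \<le> n" and "part (conj_partition \<mu>) 1 \<le> n"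
    and "\<beta> \<in> Beta ` {1..m1}"
    and "centre_automorphism n W"
    and "\<forall>k\<in>{1..n}. W (Capelli_H n k) = virtual_I m0 m1 n \<beta> k"
    and "is_Schur n \<mu> s1 \<rho>1"
    and "is_Schur n (conj_partition \<mu>) s2 \<rho>2"
    and "\<rho> \<in> carrier (\<zeta> n)"
  shows "\<exists>c. has_eigenvalue s1 \<rho>1 \<rho> c \<and> has_eigenvalue s2 \<rho>2 (W \<rho>) c"
proof -
  let ?P = "proper_symbols n"
  \<comment> \<open>\<open>is_Schur\<close> conjugates its argument, so conjugating twice gives the
    second module the highest weight \<mu>.\<close>
  have irr1: "irreducible_gl_module n s1 \<rho>1" and irr2: "irreducible_gl_module n s2 \<rho>2"
    and hw1: "has_highest_weight n (\<lambda>i. of_nat (part (conj_partition \<mu>) i)) s1 \<rho>1"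
    and hw2: "has_highest_weight n (\<lambda>i. of_nat (part \<mu> i)) s2 \<rho>2"
    using assms(8,9) conj_partition_conj_partition[OF assms(2)] by (auto simp: is_Schur_def)
  then have gl1: "gl_module n s1 \<rho>1" and gl2: "gl_module n s2 \<rho>2"
    by (auto simp: irreducible_gl_module_def)
  have W: "W \<in> ring_hom (\<zeta> n) (\<zeta> n)"
    and Wsc: "\<And>c z. z \<in> carrier (\<zeta> n) \<Longrightarrow> W (scalgl n c \<otimes>\<^bsub>\<zeta> n\<^esub> z) = scalgl n c \<otimes>\<^bsub>\<zeta> n\<^esub> W z"
    using assms(6) by (auto simp: centre_automorphism_def ring_iso_def)
  have zU: "z \<in> carrier (Ugl n)" if "z \<in> carrier (\<zeta> n)" for z
    using that by (simp add: \<zeta>_def)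
  have cz: "coset ?P g \<in> carrier (\<zeta> n)" if "g \<in> capelli_alg n" for g
    using capelli_alg_central[OF that] by (auto simp: carrier_zeta)
  obtain v1 where v1: "v1 \<noteq> 0" "\<And>i. i \<in> {1..n} \<Longrightarrow> act n \<rho>1 (gl_e i i) v1 = s1 (of_nat (part (conj_partition \<mu>) i)) v1"
    "\<And>i j. i \<in> {1..n} \<Longrightarrow> j \<in> {1..n} \<Longrightarrow> i < j \<Longrightarrow> act n \<rho>1 (gl_e i j) v1 = 0"
    using highest_weight_vector[OF gl1 hw1] by blast
  obtain v2 where v2: "v2 \<noteq> 0" "\<And>i. i \<in> {1..n} \<Longrightarrow> act n \<rho>2 (gl_e i i) v2 = s2 (of_nat (part \<mu> i)) v2"
    "\<And>i j. i \<in> {1..n} \<Longrightarrow> j \<in> {1..n} \<Longrightarrow> i < j \<Longrightarrow> act n \<rho>2 (gl_e i j) v2 = 0"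
    using highest_weight_vector[OF gl2 hw2] by blast
  \<comment> \<open>Having a common eigenvalue on both sides passes through sums and products
    because \<open>W\<close> is a ring homomorphism, so the inductive generation of
    \<open>capelli_alg\<close> is the induction used.\<close>
  have main: "\<exists>c. has_eigenvalue s1 \<rho>1 (coset ?P g) c \<and> has_eigenvalue s2 \<rho>2 (W (coset ?P g)) c" if "g \<in> capelli_alg n" for g
    using that
  proof (induction rule: capelli_alg.induct)
    case (capelli_alg_scalar c)
    have one: "\<one>\<^bsub>\<zeta> n\<^esub> \<in> carrier (\<zeta> n)"
      using cz[OF capelli_alg_one] by (simp add: coset_one zeta_simps)
    have "coset ?P (c *\<^sub>C 1) = scalgl n c \<otimes>\<^bsub>\<zeta> n\<^esub> \<one>\<^bsub>\<zeta> n\<^esub>"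
      unfolding zeta_simps scal_coset coset_one[symmetric] by (subst coset_mult[symmetric]) simp_all
    \<comment> \<open>Compatibility with scalars makes \<open>W\<close> fix the scalar multiples of
      the unit.\<close>
    moreover have "W (scalgl n c \<otimes>\<^bsub>\<zeta> n\<^esub> \<one>\<^bsub>\<zeta> n\<^esub>) = scalgl n c \<otimes>\<^bsub>\<zeta> n\<^esub> \<one>\<^bsub>\<zeta> n\<^esub>"
      using Wsc[OF one] ring_hom_one[OF W] by simp
    ultimately have "W (coset ?P (c *\<^sub>C 1)) = coset ?P (c *\<^sub>C 1)" by simp
    then show ?case
      using act_scalar[OF gl1] act_scalar[OF gl2] by (auto simp: has_eigenvalue_def act_def[OF gl1] act_def[OF gl2])
  next
    case (capelli_alg_capelli k)
    let ?c = "shifted_e (map (\<lambda>i. of_nat (part (conj_partition \<mu>) i)) [1..<n + 1]) k"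
    have "act n \<rho>1 (capelli gl_e n k) v1 = s1 ?c v1"
      by (rule act_capelli[OF gl1]) (use v1 in auto)
    then have "act n \<rho>1 (capelli gl_e n k) x = s1 ?c x" for x
      by (rule central_scalar[OF gl1 irr1 capelli_central v1(1)])
    then have 1: "has_eigenvalue s1 \<rho>1 (coset ?P (capelli gl_e n k)) ?c"
      by (simp add: has_eigenvalue_def act_def[OF gl1])
    let ?I = "\<Sum>h\<in>exponents 1 n k. (1 / (\<Prod>i=1..n. fact (h i))) *\<^sub>C virt_img (expansion 1 n h) (expansion 1 n h)"
    have I: "W (coset ?P (capelli gl_e n k)) = coset ?P ?I"
      using assms(7) capelli_alg_capelli unfolding Capelli_H_coset virtual_I_coset[OF assms(5)] by blast
    have Ifas: "?I \<in> fa_on (gl_basis n)"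
      by (intro fa_on_sum fa_on_scaleC virt_img_fa_on set_expansion)
    \<comment> \<open>Centrality of I_k is obtained here: it is a value of \<open>W\<close> at an
      element of the centre.\<close>
    have "coset ?P ?I \<in> carrier (\<zeta> n)"
      unfolding I[symmetric] using ring_hom_closed[OF W cz[OF capelli_alg.capelli_alg_capelli[OF capelli_alg_capelli]]] .
    then have Ic: "?I \<in> central n" by (simp only: coset_zeta[OF Ifas])
    have "act n \<rho>2 ?I v2 = s2 (shifted_h (map (\<lambda>i. of_nat (part \<mu> i)) [1..<n + 1]) k) v2"
      by (rule act_virtual[OF gl2]) (use v2 in auto)
    then have "act n \<rho>2 ?I v2 = s2 ?c v2"
      unfolding duality_identity[OF assms(2-4)] .
    then have "act n \<rho>2 ?I x = s2 ?c x" for x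
      by (rule central_scalar[OF gl2 irr2 Ic v2(1)])
    then have "has_eigenvalue s2 \<rho>2 (W (coset ?P (capelli gl_e n k))) ?c"
      unfolding I by (simp add: has_eigenvalue_def act_def[OF gl2])
    with 1 show ?case by blast
  next
    case (capelli_alg_add a b)
    then obtain c d where cd: "has_eigenvalue s1 \<rho>1 (coset ?P a) c" "has_eigenvalue s2 \<rho>2 (W (coset ?P a)) c"
      "has_eigenvalue s1 \<rho>1 (coset ?P b) d" "has_eigenvalue s2 \<rho>2 (W (coset ?P b)) d" by blast
    have f: "a \<in> fa_on (gl_basis n)" "b \<in> fa_on (gl_basis n)" using capelli_alg_add capelli_alg_central central_fa_on by blast+
    have Wab: "W (coset ?P (a + b)) = W (coset ?P a) \<oplus>\<^bsub>Ugl n\<^esub> W (coset ?P b)"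
      using ring_hom_add[OF W cz cz] capelli_alg_add f by (simp add: coset_add zeta_simps)
    have "W (coset ?P a) \<in> carrier (Ugl n)" "W (coset ?P b) \<in> carrier (Ugl n)"
      using ring_hom_closed[OF W cz] capelli_alg_add zU by blast+
    then have "has_eigenvalue s2 \<rho>2 (W (coset ?P (a + b))) (c + d)"
      using cd gl2 unfolding Wab by (simp add: has_eigenvalue_def gl_module_def s_simps[OF gl2])
    moreover have "has_eigenvalue s1 \<rho>1 (coset ?P (a + b)) (c + d)"
      using cd gl1 f by (simp add: coset_add has_eigenvalue_def gl_module_def s_simps[OF gl1])
    ultimately show ?case by blast
  next
    case (capelli_alg_mult a b)
    then obtain c d where cd: "has_eigenvalue s1 \<rho>1 (coset ?P a) c" "has_eigenvalue s2 \<rho>2 (W (coset ?P a)) c"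
      "has_eigenvalue s1 \<rho>1 (coset ?P b) d" "has_eigenvalue s2 \<rho>2 (W (coset ?P b)) d" by blast
    have f: "a \<in> fa_on (gl_basis n)" "b \<in> fa_on (gl_basis n)" using capelli_alg_mult capelli_alg_central central_fa_on by blast+
    have Wab: "W (coset ?P (a * b)) = W (coset ?P a) \<otimes>\<^bsub>Ugl n\<^esub> W (coset ?P b)"
      using ring_hom_mult[OF W cz cz] capelli_alg_mult f by (simp add: coset_mult zeta_simps)
    have "W (coset ?P a) \<in> carrier (Ugl n)" "W (coset ?P b) \<in> carrier (Ugl n)"
      using ring_hom_closed[OF W cz] capelli_alg_mult zU by blast+
    then have "has_eigenvalue s2 \<rho>2 (W (coset ?P (a * b))) (c * d)"
      using cd gl2 unfolding Wab by (simp add: has_eigenvalue_def gl_module_def s_simps[OF gl2])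
    moreover have "has_eigenvalue s1 \<rho>1 (coset ?P (a * b)) (c * d)"
      using cd gl1 f by (simp add: coset_mult has_eigenvalue_def gl_module_def s_simps[OF gl1])
    ultimately show ?case by blast
  qed
  obtain t where t: "\<rho> = coset ?P t" "t \<in> central n"
    using assms(10) by (auto simp: carrier_zeta)
  \<comment> \<open>Changing the representative turns an arbitrary central element into a polynomial
    in the Capelli elements.\<close>
  obtain g where g: "g \<in> capelli_alg n" "t - g \<in> env_ker ?P" using central_generated[OF t(2)] by blast
  then have "\<rho> = coset ?P g" by (simp add: t(1) coset_eq_iff)
  with main[OF g(1)] show ?thesis by simp
qed

end
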